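(* Let $\mathcal{M}$ be a finite von Neumann algebra with center $\mathcal{Z}(\mathcal{M})$ and center-valued trace $T$. Then the map $[p] \mapsto T(p)$ induced by $T$ is a homeomorphism from $((\mathcal{P}(\mathcal{M})/\sim), QOT)$ onto a subspace of $\mathcal{Z}(\mathcal{M})_1^+$ equipped with the strong topology. Consequently, for every $p \in \mathcal{P}(\mathcal{M})$, the $QOT$-closure of the singleton is $\overline{\{[p]\}} = \{[p]\}$.
   Context: $\mathcal{P}(\mathcal{M})$ is the set of projections of $\mathcal{M}$, $\sim$ is Murray-von Neumann equivalence, and $[p]$ is the equivalence class of $p$. $QOT$ denotes the quotient topology on $(\mathcal{P}(\mathcal{M})/\sim)$ coming from the strong (equivalently, weak) operator topology on $\mathcal{P}(\mathcal{M})$; the two agree on $\mathcal{P}(\mathcal{M})$. $\mathcal{Z}(\mathcal{M})_1^+$ is the set of positive elements of norm at most $1$ in the center. On bounded sets the strong topology agrees with the $\sigma$-strong topology and so does not depend on the choice of faithful normal representation. The center-valued trace of a finite von Neumann algebra is the unique faithful positive linear map $T:\mathcal{M}\to\mathcal{Z}(\mathcal{M})$ that is $\mathcal{Z}(\mathcal{M})$-linear, satisfies $T(x^*x)=T(xx^* )$ for all $x$, and has $T(1)=1$; it is automatically normal. *)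

theory Defs
  imports "HOL-Analysis.Analysis"
begin

text \<open>A complex inner product space is a real one, for the real part of the complex inner
  product, so that norm, metric and topology are those of \<^class>\<open>real_inner\<close>. The inner product
  is linear in the second argument.\<close>

class complex_inner = real_inner +
  fixes scaleC :: "complex \<Rightarrow> 'a \<Rightarrow> 'a"  (infixr \<open>*\<^sub>C\<close> 75)
    and cinner :: "'a \<Rightarrow> 'a \<Rightarrow> complex"
  assumes scaleC_add_right: "c *\<^sub>C (x + y) = c *\<^sub>C x + c *\<^sub>C y"
    and scaleC_add_left: "(c + d) *\<^sub>C x = c *\<^sub>C x + d *\<^sub>C x"
    and scaleC_scaleC: "c *\<^sub>C d *\<^sub>C x = (c * d) *\<^sub>C x"
    and scaleC_of_real: "complex_of_real r *\<^sub>C x = r *\<^sub>R x"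
    and cinner_commute: "cinner x y = cnj (cinner y x)"
    and cinner_add_right: "cinner x (y + z) = cinner x y + cinner x z"
    and cinner_scaleC_right: "cinner x (c *\<^sub>C y) = c * cinner x y"
    and Re_cinner: "Re (cinner x y) = inner x y"

class chilbert_space = complex_inner + complete_space

lemma cinner_self: "cinner x x = complex_of_real ((norm (x :: 'a :: complex_inner))\<^sup>2)"
proof (rule complex_eqI)
  have "Im (cinner x x) = - Im (cinner x x)"
    by (metis cinner_commute cnj.simps(2))
  then show "Im (cinner x x) = Im (complex_of_real ((norm x)\<^sup>2))" by simp
qed (simp add: Re_cinner power2_norm_eq_inner)

lemma norm_scaleC: "norm (c *\<^sub>C (x :: 'a :: complex_inner)) = cmod c * norm x"
proof -
  have "cinner (c *\<^sub>C x) (c *\<^sub>C x) = c * cnj (c * cinner x x)"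
    by (metis cinner_commute cinner_scaleC_right)
  also have "\<dots> = complex_of_real ((cmod c * norm x)\<^sup>2)"
    using complex_norm_square [of c] by (simp add: cinner_self power_mult_distrib)
  finally have "(norm (c *\<^sub>C x))\<^sup>2 = (cmod c * norm x)\<^sup>2"
    unfolding cinner_self of_real_eq_iff .
  then show ?thesis by simp
qed

lemma bounded_linear_scaleC: "bounded_linear (\<lambda>x :: 'a :: complex_inner. c *\<^sub>C x)"
proof (rule bounded_linear_intro)
  fix r and x :: 'a
  show "c *\<^sub>C r *\<^sub>R x = r *\<^sub>R c *\<^sub>C x"
    by (simp add: scaleC_scaleC mult.commute flip: scaleC_of_real)
  show "norm (c *\<^sub>C x) \<le> norm x * cmod c" by (simp add: norm_scaleC)
qed (rule scaleC_add_right)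

text \<open>The type \<^typ>\<open>'a \<Rightarrow>\<^sub>L 'a\<close> consists of the real-linear bounded operators. The complex-linear
  ones are a subset, on which the norm and \<^const>\<open>strong_operator_topology\<close> are the usual ones.\<close>

definition bounded_ops :: "('a :: chilbert_space \<Rightarrow>\<^sub>L 'a) set" where
  "bounded_ops = {a. \<forall>c x. blinfun_apply a (c *\<^sub>C x) = c *\<^sub>C blinfun_apply a x}"

lift_definition scalar_op :: "complex \<Rightarrow> 'a :: chilbert_space \<Rightarrow>\<^sub>L 'a" is "\<lambda>c x. c *\<^sub>C x"
  by (rule bounded_linear_scaleC)

text \<open>Existence of the adjoint is the Riesz representation theorem. For complex-linear \<^term>\<open>a\<close>
  it is again complex-linear.\<close>

definition adj :: "('a :: chilbert_space \<Rightarrow>\<^sub>L 'a) \<Rightarrow> 'a \<Rightarrow>\<^sub>L 'a" where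
  "adj a = (THE b. \<forall>x y. cinner (blinfun_apply b x) y = cinner x (blinfun_apply a y))"

definition positive_op :: "('a :: chilbert_space \<Rightarrow>\<^sub>L 'a) \<Rightarrow> bool" where
  "positive_op a \<longleftrightarrow> a \<in> bounded_ops \<and> (\<forall>x. cinner x (a x) \<in> \<real>\<^sub>\<ge>\<^sub>0)"

definition commutant :: "('a :: chilbert_space \<Rightarrow>\<^sub>L 'a) set \<Rightarrow> ('a \<Rightarrow>\<^sub>L 'a) set" where
  "commutant S = {a \<in> bounded_ops. \<forall>s\<in>S. a o\<^sub>L s = s o\<^sub>L a}"

definition star_subalgebra :: "('a :: chilbert_space \<Rightarrow>\<^sub>L 'a) set \<Rightarrow> bool" where
  "star_subalgebra M \<longleftrightarrow> M \<subseteq> bounded_ops \<and> id_blinfun \<in> M \<and>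
     (\<forall>a\<in>M. \<forall>b\<in>M. a + b \<in> M \<and> a o\<^sub>L b \<in> M) \<and>
     (\<forall>c. \<forall>a\<in>M. scalar_op c o\<^sub>L a \<in> M) \<and> (\<forall>a\<in>M. adj a \<in> M)"

definition von_neumann_algebra :: "('a :: chilbert_space \<Rightarrow>\<^sub>L 'a) set \<Rightarrow> bool" where
  "von_neumann_algebra M \<longleftrightarrow> star_subalgebra M \<and> commutant (commutant M) = M"

definition finite_von_neumann_algebra :: "('a :: chilbert_space \<Rightarrow>\<^sub>L 'a) set \<Rightarrow> bool" where
  "finite_von_neumann_algebra M \<longleftrightarrow> von_neumann_algebra M \<and>
     (\<forall>v\<in>M. adj v o\<^sub>L v = id_blinfun \<longrightarrow> v o\<^sub>L adj v = id_blinfun)"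

definition center :: "('a :: chilbert_space \<Rightarrow>\<^sub>L 'a) set \<Rightarrow> ('a \<Rightarrow>\<^sub>L 'a) set" where
  "center M = M \<inter> commutant M"

definition center_pos_ball :: "('a :: chilbert_space \<Rightarrow>\<^sub>L 'a) set \<Rightarrow> ('a \<Rightarrow>\<^sub>L 'a) set" where
  "center_pos_ball M = {z \<in> center M. positive_op z \<and> norm z \<le> 1}"

definition projections :: "('a :: chilbert_space \<Rightarrow>\<^sub>L 'a) set \<Rightarrow> ('a \<Rightarrow>\<^sub>L 'a) set" where
  "projections M = {p \<in> M. adj p = p \<and> p o\<^sub>L p = p}"

definition mvn_rel ::
    "('a :: chilbert_space \<Rightarrow>\<^sub>L 'a) set \<Rightarrow> (('a \<Rightarrow>\<^sub>L 'a) \<times> ('a \<Rightarrow>\<^sub>L 'a)) set" where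
  "mvn_rel M = {(p, q). p \<in> projections M \<and> q \<in> projections M \<and>
     (\<exists>v\<in>M. adj v o\<^sub>L v = p \<and> v o\<^sub>L adj v = q)}"

definition mvn_class ::
    "('a :: chilbert_space \<Rightarrow>\<^sub>L 'a) set \<Rightarrow> ('a \<Rightarrow>\<^sub>L 'a) \<Rightarrow> ('a \<Rightarrow>\<^sub>L 'a) set" where
  "mvn_class M p = mvn_rel M `` {p}"

text \<open>A center-valued trace is a map on \<^term>\<open>M\<close> only; its values elsewhere are irrelevant.\<close>

definition center_valued_trace ::
    "('a :: chilbert_space \<Rightarrow>\<^sub>L 'a) set \<Rightarrow> (('a \<Rightarrow>\<^sub>L 'a) \<Rightarrow> ('a \<Rightarrow>\<^sub>L 'a)) \<Rightarrow> bool" where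
  "center_valued_trace M T \<longleftrightarrow>
     (\<forall>a\<in>M. T a \<in> center M) \<and>
     (\<forall>a\<in>M. \<forall>b\<in>M. T (a + b) = T a + T b) \<and>
     (\<forall>c. \<forall>a\<in>M. T (scalar_op c o\<^sub>L a) = scalar_op c o\<^sub>L T a) \<and>
     (\<forall>z\<in>center M. \<forall>a\<in>M. T (z o\<^sub>L a) = z o\<^sub>L T a) \<and>
     (\<forall>a\<in>M. positive_op a \<longrightarrow> positive_op (T a)) \<and>
     (\<forall>a\<in>M. positive_op a \<longrightarrow> T a = 0 \<longrightarrow> a = 0) \<and>
     (\<forall>a\<in>M. T (adj a o\<^sub>L a) = T (a o\<^sub>L adj a)) \<and>
     T id_blinfun = id_blinfun"

definition quotient_topology :: "'a topology \<Rightarrow> ('a \<Rightarrow> 'b) \<Rightarrow> 'b topology" where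
  "quotient_topology X f =
     topology (\<lambda>U. U \<subseteq> f ` topspace X \<and> openin X {x \<in> topspace X. f x \<in> U})"

lemma openin_quotient_topology:
  "openin (quotient_topology X f) U \<longleftrightarrow>
     U \<subseteq> f ` topspace X \<and> openin X {x \<in> topspace X. f x \<in> U}"
proof -
  let ?P = "\<lambda>U. U \<subseteq> f ` topspace X \<and> openin X {x \<in> topspace X. f x \<in> U}"
  have "istopology ?P"
    unfolding istopology_def
  proof (intro conjI allI impI)
    fix S T assume *: "?P S" "?P T"
    show "S \<inter> T \<subseteq> f ` topspace X" using * by blast
    have "{x \<in> topspace X. f x \<in> S \<inter> T} =
        {x \<in> topspace X. f x \<in> S} \<inter> {x \<in> topspace X. f x \<in> T}" by blast
    then show "openin X {x \<in> topspace X. f x \<in> S \<inter> T}" using * by (simp only: openin_Int)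
  next
    fix K assume *: "\<forall>S\<in>K. ?P S"
    show "\<Union>K \<subseteq> f ` topspace X" using * by blast
    have "{x \<in> topspace X. f x \<in> \<Union>K} = \<Union>((\<lambda>S. {x \<in> topspace X. f x \<in> S}) ` K)" by blast
    moreover have "openin X (\<Union>((\<lambda>S. {x \<in> topspace X. f x \<in> S}) ` K))"
      using * by (intro openin_Union) blast
    ultimately show "openin X {x \<in> topspace X. f x \<in> \<Union>K}" by simp
  qed
  then show ?thesis unfolding quotient_topology_def by simp
qed

lemma topspace_quotient_topology: "topspace (quotient_topology X f) = f ` topspace X"
proof
  have "{x \<in> topspace X. f x \<in> f ` topspace X} = topspace X" by auto
  then have "openin (quotient_topology X f) (f ` topspace X)"
    by (simp add: openin_quotient_topology)
  then show "f ` topspace X \<subseteq> topspace (quotient_topology X f)" by (rule openin_subset)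
  show "topspace (quotient_topology X f) \<subseteq> f ` topspace X"
    using openin_topspace [of "quotient_topology X f"] unfolding openin_quotient_topology by simp
qed

lemma quotient_map_quotient_topology: "quotient_map X (quotient_topology X f) f"
  by (simp add: quotient_map_def topspace_quotient_topology openin_quotient_topology)

definition QOT :: "('a :: chilbert_space \<Rightarrow>\<^sub>L 'a) set \<Rightarrow> ('a \<Rightarrow>\<^sub>L 'a) set topology" where
  "QOT M = quotient_topology (subtopology strong_operator_topology (projections M)) (mvn_class M)"

lemma topspace_QOT: "topspace (QOT M) = projections M // mvn_rel M"
  unfolding QOT_def topspace_quotient_topology quotient_def mvn_class_def
  by (simp add: strong_operator_topology_topspace UNION_singleton_eq_range)

end

theory Submission
  imports Defs
begin

text \<open>Multiplicativity of \<open>T\<close> over the center and comparison of projections give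
  \<open>T p = T q \<longleftrightarrow> p \<sim> q\<close>. For the topologies one compares the positive functionals
  \<open>\<langle>T (\<cdot>) x, x\<rangle>\<close> with the vector functionals \<open>\<langle>(\<cdot>) x, x\<rangle>\<close>: up to an error \<open>\<epsilon> \<parallel>\<cdot>\<parallel>\<close>, each of either
  kind is dominated on positive operators by a finite sum of the other kind. Zorn's lemma yields
  such a domination on a small corner \<open>e M e\<close>. In one direction the tracial property spreads it to a
  central projection covered by finitely many copies of parts of \<open>e\<close>; in the other it is enough to
  replace \<open>x\<close> by \<open>e x\<close>. The first domination says that \<open>T\<close> is normal, hence strongly continuous on
  projections. The second says that a projection with small trace is strongly small; since \<open>q\<close> is
  equivalent to some \<open>q'\<close> for which \<open>|q' - p|\<close> is a projection of trace \<open>|T q - T p|\<close>, the map is open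
  onto its image.\<close>

subsection \<open>Orthogonal projections and adjoints in real Hilbert spaces\<close>

text \<open>The error \<open>e * norm a\<close> makes the set \<open>dominated L R\<close> of good
  vectors norm closed. By \<open>closed_subspace_UNIV\<close> it is then enough to dominate one
  nonzero piece \<open>e x\<close> of each nonzero \<open>x\<close>, and one small corner is what
  Zorn's lemma delivers. In that Zorn argument the larger functional must be continuous along chains
  of projections. For a vector functional this is immediate; for \<open>T\<close> it is the first
  domination, which therefore has to precede the second. A corner alone does not settle the first
  direction: for a central \<open>z\<close> the form of \<open>T a\<close> at \<open>z x\<close> is
  that of \<open>T (z a z)\<close> at \<open>x\<close>, and for a general projection there is no
  such identity. This is the reason for the passage through the ideal \<open>dom_ideal\<close>. All
  auxiliary operators have to lie in \<open>M\<close>. Square roots and spectral projections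
  therefore come with the clause that whatever commutes with the input commutes with the output, and
  Zorn's lemma is applied to closed subspaces invariant under the commutant, ordered by inclusion,
  rather than to operators.\<close>

lemma orthogonal_decomposition:
  fixes K :: "'h :: {real_inner, banach} set"
  assumes K: "closed K" "subspace K"
  obtains k where "k \<in> K" "\<And>y. y \<in> K \<Longrightarrow> (x - k) \<bullet> y = 0"
proof -
  define d where "d = infdist x K"
  have K0: "K \<noteq> {}" using subspace_0[OF K(2)] by blast
  have d0: "0 \<le> d" unfolding d_def by (rule infdist_nonneg)
  have dle: "d \<le> norm (x - y)" if "y \<in> K" for y
    unfolding d_def using infdist_le[OF that, of x] by (simp add: dist_norm)
  have "\<exists>y. \<forall>n. y n \<in> K \<and> norm (x - y n) < d + inverse (real (Suc n))"
  proof (rule choice, rule allI)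
    fix n
    have "\<exists>y\<in>K. dist x y < d + inverse (real (Suc n))"
    proof (rule ccontr)
      assume "\<not> ?thesis"
      then have "d + inverse (real (Suc n)) \<le> infdist x K"
        using K0 by (auto simp: infdist_def not_less intro!: cINF_greatest)
      then show False by (simp add: d_def)
    qed
    then show "\<exists>y. y \<in> K \<and> norm (x - y) < d + inverse (real (Suc n))"
      by (auto simp: dist_norm)
  qed
  then obtain y where y: "\<And>n. y n \<in> K" "\<And>n. norm (x - y n) < d + inverse (real (Suc n))"
    by blast
  \<comment> \<open>Parallelogram identity for \<open>x - u\<close> and \<open>x - v\<close>: their
    midpoint is \<open>x\<close> minus a point of \<open>K\<close>, hence of norm at least
    \<open>d\<close>. Two nearly optimal points are therefore close to each other.\<close>
  have par: "(norm (u - v))\<^sup>2 \<le> 2 * (norm (x - u))\<^sup>2 + 2 * (norm (x - v))\<^sup>2 - 4 * d\<^sup>2"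
    if "u \<in> K" "v \<in> K" for u v
  proof -
    have "(1/2) *\<^sub>R (u + v) \<in> K" using that K(2) by (simp add: subspace_add subspace_scale)
    from dle[OF this] have "d\<^sup>2 \<le> (norm (x - (1/2) *\<^sub>R (u + v)))\<^sup>2"
      using d0 by (simp add: power_mono)
    then show ?thesis
      by (simp add: power2_norm_eq_inner inner_diff_left inner_diff_right inner_add_left
          inner_add_right inner_commute algebra_simps)
  qed
  have "Cauchy y"
  proof (rule metric_CauchyI)
    fix e :: real assume e: "0 < e"
    have "(\<lambda>n. 4 * (d + inverse (real (Suc n)))\<^sup>2 - 4 * d\<^sup>2) \<longlonglongrightarrow> 4 * (d + 0)\<^sup>2 - 4 * d\<^sup>2"
      by (intro tendsto_intros LIMSEQ_inverse_real_of_nat)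
    then have "eventually (\<lambda>n. 4 * (d + inverse (real (Suc n)))\<^sup>2 - 4 * d\<^sup>2 < e\<^sup>2) sequentially"
      using e by (intro order_tendstoD) auto
    then obtain n0 where n0: "4 * (d + inverse (real (Suc n0)))\<^sup>2 - 4 * d\<^sup>2 < e\<^sup>2"
      by (auto simp: eventually_sequentially)
    have b: "(norm (x - y n))\<^sup>2 \<le> (d + inverse (real (Suc n0)))\<^sup>2" if "n \<ge> n0" for n
    proof (rule power_mono)
      have "inverse (real (Suc n)) \<le> inverse (real (Suc n0))"
        using that by (intro le_imp_inverse_le) auto
      then show "norm (x - y n) \<le> d + inverse (real (Suc n0))" using y(2)[of n] by linarith
    qed simp
    show "\<exists>N. \<forall>m\<ge>N. \<forall>n\<ge>N. dist (y m) (y n) < e"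
    proof (intro exI allI impI)
      fix m n assume mn: "n0 \<le> m" "n0 \<le> n"
      have "(norm (y m - y n))\<^sup>2 < e\<^sup>2" using par[OF y(1) y(1), of m n] b[OF mn(1)] b[OF mn(2)] n0
        by linarith
      then show "dist (y m) (y n) < e" using e
        by (simp add: dist_norm power_less_imp_less_base)
    qed
  qed
  then obtain k where k: "y \<longlonglongrightarrow> k" using Cauchy_convergent_iff convergent_def by blast
  have kK: "k \<in> K" using K(1) k y(1) closed_sequentially by blast
  have lim1: "(\<lambda>n. norm (x - y n)) \<longlonglongrightarrow> norm (x - k)" by (intro tendsto_intros k)
  have lim2: "(\<lambda>n. d + inverse (real (Suc n))) \<longlonglongrightarrow> d + 0"
    by (intro tendsto_intros LIMSEQ_inverse_real_of_nat)
  have "norm (x - k) \<le> d + 0"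
    by (rule LIMSEQ_le[OF lim1 lim2]) (use y(2) less_imp_le in blast)
  then have kd: "norm (x - k) \<le> d" by simp
  have "(x - k) \<bullet> w = 0" if w: "w \<in> K" for w
  proof (cases "w = 0")
    case False
    \<comment> \<open>The minimizer of the distance from \<open>x - k\<close> along the line of
      \<open>w\<close>; as \<open>k\<close> is already nearest, the gain it produces must be
      0.\<close>
    define t where "t = ((x - k) \<bullet> w) / (w \<bullet> w)"
    have ww: "w \<bullet> w > 0" using False by simp
    have "k + t *\<^sub>R w \<in> K" using K(2) w kK by (simp add: subspace_add subspace_scale)
    from dle[OF this] kd have "(norm (x - k))\<^sup>2 \<le> (norm ((x - k) - t *\<^sub>R w))\<^sup>2"
      by (simp add: power_mono diff_diff_eq)
    also have "\<dots> = (norm (x - k))\<^sup>2 - 2 * t * ((x - k) \<bullet> w) + t * t * (w \<bullet> w)"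
      unfolding power2_norm_eq_inner
      by (simp only: inner_diff_left inner_diff_right inner_scaleR_left inner_scaleR_right)
        (simp add: inner_commute algebra_simps)
    also have "\<dots> = (norm (x - k))\<^sup>2 - ((x - k) \<bullet> w)\<^sup>2 / (w \<bullet> w)"
      using ww by (simp add: t_def power2_eq_square field_simps)
    finally have "((x - k) \<bullet> w)\<^sup>2 / (w \<bullet> w) \<le> 0" by simp
    then show ?thesis using ww by (simp add: divide_le_0_iff)
  qed simp
  with kK show thesis by (rule that)
qed

lemma orthogonal_decomposition_unique:
  fixes K :: "'h :: real_inner set"
  assumes K: "subspace K" and k: "k \<in> K" "l \<in> K"
    and orth: "\<And>y. y \<in> K \<Longrightarrow> (x - k) \<bullet> y = 0" "\<And>y. y \<in> K \<Longrightarrow> (x - l) \<bullet> y = 0"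
  shows "k = l"
proof -
  have d: "k - l \<in> K" by (rule subspace_diff[OF K k])
  have "(k - l) \<bullet> (k - l) = (x - l) \<bullet> (k - l) - (x - k) \<bullet> (k - l)"
    by (simp flip: inner_diff_left)
  then show ?thesis using orth[OF d] by simp
qed

text \<open>Total by \<open>SOME\<close> and \<open>Blinfun\<close>; meaningful once
  \<open>K\<close> is a closed subspace, where the foot of the perpendicular exists, is unique and
  depends linearly on \<open>x\<close>.\<close>

definition ortho_proj :: "'h :: {real_inner, banach} set \<Rightarrow> 'h \<Rightarrow>\<^sub>L 'h" where
  "ortho_proj K = Blinfun (\<lambda>x. SOME k. k \<in> K \<and> (\<forall>y\<in>K. (x - k) \<bullet> y = 0))"

lemma ortho_proj:
  fixes K :: "'h :: {real_inner, banach} set"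
  assumes K: "closed K" "subspace K"
  shows ortho_proj_in: "ortho_proj K x \<in> K"
    and ortho_proj_orthogonal: "y \<in> K \<Longrightarrow> (x - ortho_proj K x) \<bullet> y = 0"
proof -
  define P where "P = (\<lambda>x. SOME k. k \<in> K \<and> (\<forall>y\<in>K. (x - k) \<bullet> y = 0))"
  have P: "P x \<in> K \<and> (\<forall>y\<in>K. (x - P x) \<bullet> y = 0)" for x
    unfolding P_def by (rule someI_ex) (metis orthogonal_decomposition[OF K])
  have uniq: "P x = k" if "k \<in> K" "\<And>y. y \<in> K \<Longrightarrow> (x - k) \<bullet> y = 0" for x k
    by (rule orthogonal_decomposition_unique[OF K(2), of _ _ x]) (use P that in blast)+
  have "bounded_linear P"
  proof (rule bounded_linear_intro)
    fix x y r
    show "P (x + y) = P x + P y"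
    proof (rule uniq)
      show "P x + P y \<in> K" using P K(2) by (simp add: subspace_add)
      fix w assume "w \<in> K"
      then show "(x + y - (P x + P y)) \<bullet> w = 0"
        using P[of x] P[of y] by (auto simp: inner_diff_left inner_add_left)
    qed
    show "P (r *\<^sub>R x) = r *\<^sub>R P x"
    proof (rule uniq)
      show "r *\<^sub>R P x \<in> K" using P K(2) by (simp add: subspace_scale)
      fix w assume "w \<in> K"
      then show "(r *\<^sub>R x - r *\<^sub>R P x) \<bullet> w = 0"
        using P[of x] by (auto simp flip: scaleR_diff_right)
    qed
    have "(x - P x) \<bullet> P x = 0" using P by blast
    then have "(norm (P x))\<^sup>2 = x \<bullet> P x"
      by (simp add: power2_norm_eq_inner inner_diff_left)
    also have "\<dots> \<le> norm x * norm (P x)" by (rule norm_cauchy_schwarz)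
    finally show "norm (P x) \<le> norm x * 1"
      by (cases "P x = 0") (simp_all add: power2_eq_square)
  qed
  then have "blinfun_apply (ortho_proj K) = P"
    unfolding ortho_proj_def P_def by (rule bounded_linear_Blinfun_apply)
  with P[of x] show "ortho_proj K x \<in> K" "y \<in> K \<Longrightarrow> (x - ortho_proj K x) \<bullet> y = 0" by auto
qed

lemma ortho_proj_eqI:
  fixes K :: "'h :: {real_inner, banach} set"
  assumes K: "closed K" "subspace K" and k: "k \<in> K" "\<And>y. y \<in> K \<Longrightarrow> (x - k) \<bullet> y = 0"
  shows "ortho_proj K x = k"
  by (rule orthogonal_decomposition_unique[OF K(2), of _ _ x])
    (use ortho_proj[OF K] k in blast)+

lemma ortho_proj_fixed_iff:
  fixes K :: "'h :: {real_inner, banach} set"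
  assumes K: "closed K" "subspace K"
  shows "ortho_proj K x = x \<longleftrightarrow> x \<in> K"
  using ortho_proj_in[OF K, of x] ortho_proj_eqI[OF K, of x x] by auto

section \<open>Riesz representation, adjoints and self-adjoint operators\<close>

lemma riesz_representation:
  fixes f :: "'h :: {real_inner, banach} \<Rightarrow> real"
  assumes f: "bounded_linear f"
  obtains r where "\<And>x. f x = r \<bullet> x"
proof (cases "\<forall>x. f x = 0")
  case True
  show thesis by (rule that[of 0]) (simp add: True)
next
  case False
  interpret bounded_linear f by fact
  let ?K = "{x. f x = 0}"
  have K: "closed ?K" "subspace ?K"
    by (auto simp: subspace_def add scale zero
        intro!: closed_Collect_eq continuous_intros linear_continuous_on f)
  obtain x where x: "f x \<noteq> 0" using False by blast
  obtain k where k: "k \<in> ?K" "\<And>y. y \<in> ?K \<Longrightarrow> (x - k) \<bullet> y = 0"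
    by (rule orthogonal_decomposition[OF K, of x]) blast
  define u where "u = x - k"
  have fu: "f u \<noteq> 0" using x k(1) by (simp add: u_def diff)
  then have u0: "u \<bullet> u \<noteq> 0" using zero by auto
  \<comment> \<open>\<open>u\<close> spans the orthogonal complement of the kernel of
    \<open>f\<close>; the scaling makes both sides agree at \<open>u\<close>.\<close>
  show thesis
  proof (rule that[of "(f u / (u \<bullet> u)) *\<^sub>R u"])
    fix z
    have "z - (f z / f u) *\<^sub>R u \<in> ?K" using fu by (simp add: diff scale)
    from k(2)[OF this] have "u \<bullet> z = f z / f u * (u \<bullet> u)"
      by (simp add: u_def[symmetric] inner_diff_right)
    then show "f z = (f u / (u \<bullet> u)) *\<^sub>R u \<bullet> z" using fu u0 by simp
  qed
qed

text \<open>The adjoint for the real inner product; \<open>adj_eq_real_adj\<close> identifies it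
  with \<open>adj\<close> on complex-linear operators.\<close>

definition real_adj :: "('h :: {real_inner, banach} \<Rightarrow>\<^sub>L 'h) \<Rightarrow> 'h \<Rightarrow>\<^sub>L 'h" where
  "real_adj a = (SOME b. \<forall>x y. blinfun_apply b x \<bullet> y = x \<bullet> blinfun_apply a y)"

lemma real_adj_left: "blinfun_apply (real_adj a) x \<bullet> y = x \<bullet> blinfun_apply a y"
  for a :: "'h :: {real_inner, banach} \<Rightarrow>\<^sub>L 'h"
proof -
  have "\<exists>r. \<forall>y. x \<bullet> a y = r \<bullet> y" for x
  proof -
    have "bounded_linear (\<lambda>y. x \<bullet> a y)"
      by (intro bounded_linear_compose[OF bounded_linear_inner_right] blinfun.bounded_linear_right)
    then show ?thesis by (metis riesz_representation)
  qed
  then obtain b where b: "\<And>x y. x \<bullet> a y = b x \<bullet> y" by metis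
  have "bounded_linear b"
  proof (rule bounded_linear_intro)
    fix x y r
    show "b (x + y) = b x + b y"
      by (rule vector_eq_rdot[THEN iffD1]) (simp add: inner_add_left flip: b)
    show "b (r *\<^sub>R x) = r *\<^sub>R b x"
      by (rule vector_eq_rdot[THEN iffD1]) (simp flip: b)
    have "(norm (b x))\<^sup>2 = x \<bullet> a (b x)" by (simp add: power2_norm_eq_inner b)
    also have "\<dots> \<le> norm x * norm (a (b x))" by (rule norm_cauchy_schwarz)
    also have "\<dots> \<le> norm x * (norm a * norm (b x))"
      by (intro mult_left_mono norm_blinfun) simp
    finally show "norm (b x) \<le> norm x * norm a"
      by (cases "b x = 0") (simp_all add: power2_eq_square)
  qed
  then have "blinfun_apply (Blinfun b) = b" by (rule bounded_linear_Blinfun_apply)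
  with b have "\<forall>x y. blinfun_apply (Blinfun b) x \<bullet> y = x \<bullet> a y" by simp
  then have "\<forall>x y. blinfun_apply (real_adj a) x \<bullet> y = x \<bullet> a y"
    unfolding real_adj_def by (rule someI)
  then show ?thesis by blast
qed

lemma real_adj_right: "x \<bullet> blinfun_apply (real_adj a) y = blinfun_apply a x \<bullet> y"
  for a :: "'h :: {real_inner, banach} \<Rightarrow>\<^sub>L 'h"
  by (metis inner_commute real_adj_left)

lemma blinfun_eq_innerI:
  fixes a b :: "'h :: real_inner \<Rightarrow>\<^sub>L 'h"
  assumes "\<And>x y. a x \<bullet> y = b x \<bullet> y"
  shows "a = b"
  by (rule blinfun_eqI, rule vector_eq_rdot[THEN iffD1]) (simp add: assms)

lemma compose_eqD: "a o\<^sub>L b = c o\<^sub>L d \<Longrightarrow> a (b x) = c (d x)"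
  by (metis blinfun_apply_blinfun_compose)

lemma real_adj_eqI:
  fixes a b :: "'h :: {real_inner, banach} \<Rightarrow>\<^sub>L 'h"
  assumes "\<And>x y. b x \<bullet> y = x \<bullet> a y"
  shows "real_adj a = b"
  by (rule blinfun_eq_innerI) (simp add: real_adj_left assms)

lemma real_adj_compose: "real_adj (a o\<^sub>L b) = real_adj b o\<^sub>L real_adj a"
  by (rule real_adj_eqI) (simp add: real_adj_left)

lemma real_adj_real_adj [simp]: "real_adj (real_adj a) = a"
  by (rule real_adj_eqI) (simp add: real_adj_right)

lemma real_adj_add: "real_adj (a + b) = real_adj a + real_adj b"
  by (rule real_adj_eqI)
    (simp add: real_adj_left blinfun.add_left inner_add_left inner_add_right)

definition self_adj :: "('h :: {real_inner, banach} \<Rightarrow>\<^sub>L 'h) \<Rightarrow> bool" where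
  "self_adj a \<longleftrightarrow> (\<forall>x y. a x \<bullet> y = x \<bullet> a y)"

lemma self_adjD: "self_adj a \<Longrightarrow> a x \<bullet> y = x \<bullet> a y"
  by (simp add: self_adj_def)

lemma self_adj_iff: "self_adj a \<longleftrightarrow> real_adj a = a"
  by (metis real_adj_eqI real_adj_left self_adj_def)

lemma self_adj_add: "self_adj a \<Longrightarrow> self_adj b \<Longrightarrow> self_adj (a + b)"
  by (simp add: self_adj_def blinfun.add_left inner_add_left inner_add_right)

lemma self_adj_diff: "self_adj a \<Longrightarrow> self_adj b \<Longrightarrow> self_adj (a - b)"
  by (simp add: self_adj_def blinfun.diff_left inner_diff_left inner_diff_right)

lemma self_adj_scaleR: "self_adj a \<Longrightarrow> self_adj (r *\<^sub>R a)"
  by (simp add: self_adj_def blinfun.scaleR_left)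

lemma self_adj_id [simp]: "self_adj id_blinfun"
  by (simp add: self_adj_def)

lemma self_adj_zero [simp]: "self_adj 0"
  by (simp add: self_adj_def)

lemma self_adj_limit:
  assumes "f \<longlonglongrightarrow> a" "\<And>n. self_adj (f n)"
  shows "self_adj a"
  unfolding self_adj_def
proof (intro allI)
  fix x y
  have eq: "f n x \<bullet> y = x \<bullet> f n y" for n
    using assms(2)[of n] by (rule self_adjD)
  have lim: "(\<lambda>n. f n x \<bullet> y) \<longlonglongrightarrow> a x \<bullet> y" by (intro tendsto_intros assms(1))
  have "(\<lambda>n. x \<bullet> f n y) \<longlonglongrightarrow> x \<bullet> a y" by (intro tendsto_intros assms(1))
  with lim show "a x \<bullet> y = x \<bullet> a y" unfolding eq by (rule LIMSEQ_unique)
qed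

lemma self_adj_sandwich: "self_adj a \<Longrightarrow> self_adj (real_adj b o\<^sub>L a o\<^sub>L b)"
  unfolding self_adj_def blinfun_apply_blinfun_compose real_adj_left real_adj_right by blast

section \<open>Projections as operators\<close>

definition is_proj :: "('h :: {real_inner, banach} \<Rightarrow>\<^sub>L 'h) \<Rightarrow> bool" where
  "is_proj p \<longleftrightarrow> self_adj p \<and> p o\<^sub>L p = p"

lemma is_projI:
  fixes p :: "'h :: {real_inner, banach} \<Rightarrow>\<^sub>L 'h"
  assumes "\<And>x y. p x \<bullet> y = x \<bullet> p y" "\<And>x. p (p x) = p x"
  shows "is_proj p"
  unfolding is_proj_def self_adj_def using assms by (simp add: blinfun_eqI)

lemma is_proj_idem: "is_proj p \<Longrightarrow> p (p x) = p x"
  unfolding is_proj_def by (metis blinfun_apply_blinfun_compose)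

lemma is_proj_inner: "is_proj p \<Longrightarrow> p x \<bullet> y = x \<bullet> p y"
  by (simp add: is_proj_def self_adjD)

lemma is_proj_inner_self: "is_proj p \<Longrightarrow> p x \<bullet> x = (norm (p x))\<^sup>2"
  using is_proj_inner[of p "p x" x] by (simp add: is_proj_idem power2_norm_eq_inner)

lemma is_proj_compl: "is_proj p \<Longrightarrow> is_proj (id_blinfun - p)"
  by (rule is_projI)
    (simp_all add: blinfun.diff_left blinfun.diff_right inner_diff_left inner_diff_right
      is_proj_idem is_proj_inner[of p])

lemma is_proj_zero [simp]: "is_proj 0"
  by (rule is_projI) simp_all

lemma is_proj_pythagoras:
  assumes "is_proj p"
  shows "(norm x)\<^sup>2 = (norm (p x))\<^sup>2 + (norm (x - p x))\<^sup>2"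
  using is_proj_inner[OF assms, of x x] is_proj_inner_self[OF assms, of x]
  unfolding power2_norm_eq_inner by (simp add: inner_diff_left inner_diff_right inner_commute)

lemma is_proj_norm_le: "is_proj p \<Longrightarrow> norm (p x) \<le> norm x"
  using is_proj_pythagoras[of p x] by (simp add: power2_le_imp_le)

lemma is_proj_norm: "is_proj p \<Longrightarrow> norm p \<le> 1"
  by (intro norm_blinfun_bound) (simp_all add: is_proj_norm_le)

lemma is_proj_ortho_proj:
  assumes K: "closed K" "subspace K"
  shows "is_proj (ortho_proj K)"
proof (rule is_projI)
  fix x y
  have "(x - ortho_proj K x) \<bullet> ortho_proj K y = 0" "(y - ortho_proj K y) \<bullet> ortho_proj K x = 0"
    using ortho_proj[OF K] by auto
  then show "ortho_proj K x \<bullet> y = x \<bullet> ortho_proj K y"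
    by (simp add: inner_diff_left inner_commute[of y] inner_commute[of "ortho_proj K y"])
  show "ortho_proj K (ortho_proj K x) = ortho_proj K x"
    using ortho_proj_in[OF K] ortho_proj_fixed_iff[OF K] by blast
qed

text \<open>Invariance of \<open>K\<close> under \<open>real_adj s\<close> makes the orthogonal
  complement invariant under \<open>s\<close>, so \<open>s\<close> respects both summands.\<close>

lemma ortho_proj_commute:
  fixes s :: "'h :: {real_inner, banach} \<Rightarrow>\<^sub>L 'h"
  assumes K: "closed K" "subspace K"
    and s: "\<And>x. x \<in> K \<Longrightarrow> s x \<in> K" "\<And>x. x \<in> K \<Longrightarrow> real_adj s x \<in> K"
  shows "ortho_proj K o\<^sub>L s = s o\<^sub>L ortho_proj K"
proof (rule blinfun_eqI)
  fix x
  have "ortho_proj K (s x) = s (ortho_proj K x)"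
  proof (rule ortho_proj_eqI[OF K])
    show "s (ortho_proj K x) \<in> K" using s ortho_proj_in[OF K] by blast
    fix y assume "y \<in> K"
    then have "(x - ortho_proj K x) \<bullet> real_adj s y = 0"
      using ortho_proj_orthogonal[OF K] s(2) by blast
    then show "(s x - s (ortho_proj K x)) \<bullet> y = 0"
      by (simp add: real_adj_right blinfun.diff_right)
  qed
  then show "(ortho_proj K o\<^sub>L s) x = (s o\<^sub>L ortho_proj K) x" by simp
qed

lemma commute_real_adj:
  assumes "self_adj a" "s o\<^sub>L a = a o\<^sub>L s"
  shows "real_adj s o\<^sub>L a = a o\<^sub>L real_adj s"
  using assms by (metis real_adj_compose self_adj_iff)

text \<open>Equal ranges give \<open>p q = q\<close> and \<open>q p = p\<close>; the adjoint of the
  first equation is \<open>q p = q\<close>.\<close>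

lemma is_proj_eqI:
  fixes p q :: "'h :: {real_inner, banach} \<Rightarrow>\<^sub>L 'h"
  assumes "is_proj p" "is_proj q" "\<And>x. p x = x \<longleftrightarrow> q x = x"
  shows "p = q"
proof (rule blinfun_eq_innerI)
  fix x y
  have *: "p (q w) = q w" "q (p w) = p w" for w
    using assms(3)[of "q w"] assms(3)[of "p w"] is_proj_idem[OF assms(1), of w]
      is_proj_idem[OF assms(2), of w] by simp_all
  show "p x \<bullet> y = q x \<bullet> y"
    using is_proj_inner[OF assms(1), of x "q y"] is_proj_inner[OF assms(2), of "p x" y]
      is_proj_inner[OF assms(2), of x y] by (simp only: *)
qed

subsection \<open>Positive operators, square roots and spectral cuts\<close>

definition psd :: "('h :: {real_inner, banach} \<Rightarrow>\<^sub>L 'h) \<Rightarrow> bool" where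
  "psd a \<longleftrightarrow> self_adj a \<and> (\<forall>x. 0 \<le> a x \<bullet> x)"

lemma psdI: "self_adj a \<Longrightarrow> (\<And>x. 0 \<le> a x \<bullet> x) \<Longrightarrow> psd a"
  by (simp add: psd_def)

lemma psd_self_adj: "psd a \<Longrightarrow> self_adj a"
  by (simp add: psd_def)

lemma psd_nonneg: "psd a \<Longrightarrow> 0 \<le> a x \<bullet> x"
  by (simp add: psd_def)

lemma psd_add: "psd a \<Longrightarrow> psd b \<Longrightarrow> psd (a + b)"
  by (simp add: psd_def self_adj_add blinfun.add_left inner_add_left)

lemma psd_scaleR: "psd a \<Longrightarrow> 0 \<le> r \<Longrightarrow> psd (r *\<^sub>R a)"
  by (simp add: psd_def self_adj_scaleR blinfun.scaleR_left)

lemma psd_sandwich: "psd a \<Longrightarrow> psd (real_adj b o\<^sub>L a o\<^sub>L b)"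
  by (simp add: psd_def self_adj_sandwich real_adj_left)

lemma psd_square: "psd (real_adj a o\<^sub>L a)"
  by (rule psdI) (simp_all add: self_adj_def real_adj_left real_adj_right)

lemma psd_is_proj: "is_proj p \<Longrightarrow> psd p"
  by (rule psdI) (simp_all add: is_proj_def[THEN iffD1] is_proj_inner_self)

lemma inner_le_norm_sq:
  fixes a :: "'h :: real_inner \<Rightarrow>\<^sub>L 'h"
  shows "a x \<bullet> x \<le> norm a * (norm x)\<^sup>2"
proof -
  have "a x \<bullet> x \<le> norm (a x) * norm x" by (rule norm_cauchy_schwarz)
  also have "\<dots> \<le> (norm a * norm x) * norm x" by (intro mult_right_mono norm_blinfun) simp
  finally show ?thesis by (simp add: power2_eq_square mult.assoc)
qed

lemma psd_norm_minus: "psd (norm a *\<^sub>R id_blinfun - a)" if "self_adj a"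
proof (rule psdI)
  show "self_adj (norm a *\<^sub>R id_blinfun - a)"
    by (intro self_adj_diff self_adj_scaleR self_adj_id that)
  show "0 \<le> (norm a *\<^sub>R id_blinfun - a) x \<bullet> x" for x
    using inner_le_norm_sq[of a x]
    by (simp add: blinfun.diff_left blinfun.scaleR_left inner_diff_left power2_norm_eq_inner)
qed

text \<open>Expand \<open>0 \<le> \<langle>a (x - a x / K), x - a x / K\<rangle>\<close>.\<close>

lemma psd_norm_sq_le:
  assumes a: "psd a" and K: "0 < K" "\<And>x. a x \<bullet> x \<le> K * (norm x)\<^sup>2"
  shows "(norm (a x))\<^sup>2 \<le> K * (a x \<bullet> x)"
proof -
  define t where "t = inverse K"
  have sym: "a (a x) \<bullet> x = a x \<bullet> a x" by (rule self_adjD[OF psd_self_adj[OF a]])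
  have "0 \<le> a (x - t *\<^sub>R a x) \<bullet> (x - t *\<^sub>R a x)" by (rule psd_nonneg[OF a])
  also have "\<dots> = a x \<bullet> x - 2 * t * (a x \<bullet> a x) + t\<^sup>2 * (a (a x) \<bullet> a x)"
    by (simp add: blinfun.diff_right blinfun.scaleR_right inner_diff_left inner_diff_right sym
        power2_eq_square algebra_simps)
  also have "\<dots> \<le> a x \<bullet> x - 2 * t * (a x \<bullet> a x) + t\<^sup>2 * (K * (norm (a x))\<^sup>2)"
    by (intro add_left_mono mult_left_mono K) simp
  also have "\<dots> = a x \<bullet> x - t * (norm (a x))\<^sup>2"
    using K(1) by (simp add: t_def power2_eq_square[of "inverse K"] power2_norm_eq_inner)
  finally show ?thesis using K(1) by (simp add: t_def field_simps)
qed

lemma psd_norm_le: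
  assumes a: "psd a" and K: "0 \<le> K" "\<And>x. a x \<bullet> x \<le> K * (norm x)\<^sup>2"
  shows "norm a \<le> K"
proof (rule field_le_epsilon)
  \<comment> \<open>\<open>psd_norm_sq_le\<close> needs a positive constant, and \<open>K\<close>
    may be 0.\<close>
  fix e :: real assume e: "0 < e"
  have b: "a x \<bullet> x \<le> (K + e) * (norm x)\<^sup>2" for x
    using K(2)[of x] mult_nonneg_nonneg[OF less_imp_le[OF e] zero_le_power2[of "norm x"]]
    unfolding distrib_right by linarith
  have Ke: "0 < K + e" using K(1) e by simp
  show "norm a \<le> K + e"
  proof (rule norm_blinfun_bound)
    fix x
    have "(norm (a x))\<^sup>2 \<le> (K + e) * (a x \<bullet> x)" using psd_norm_sq_le[OF a Ke b] .
    also have "\<dots> \<le> (K + e) * ((K + e) * (norm x)\<^sup>2)"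
      using Ke b by (intro mult_left_mono) simp_all
    also have "\<dots> = ((K + e) * norm x)\<^sup>2" by (simp add: power2_eq_square)
    finally show "norm (a x) \<le> (K + e) * norm x"
      by (rule power2_le_imp_le) (use Ke in simp)
  qed (use Ke in simp)
qed

lemma psd_eq_0:
  assumes a: "psd a" and x: "a x \<bullet> x = 0"
  shows "a x = 0"
proof -
  have b: "a y \<bullet> y \<le> (norm a + 1) * (norm y)\<^sup>2" for y
    using inner_le_norm_sq[of a y] by (simp add: distrib_right add.commute[of _ "(norm y)\<^sup>2"] add_increasing)
  have "(norm (a x))\<^sup>2 \<le> (norm a + 1) * (a x \<bullet> x)"
    by (rule psd_norm_sq_le[OF a _ b]) (simp add: add_nonneg_pos)
  with x show ?thesis by simp
qed

lemma psd_eq_0I: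
  assumes a: "psd a" and x: "\<And>x. a x \<bullet> x \<le> 0"
  shows "a = 0"
proof -
  have "norm a \<le> 0" by (rule psd_norm_le[OF a]) (use x in simp_all)
  then show ?thesis by simp
qed

text \<open>With \<open>x = 1 - a\<close>, the iteration \<open>y \<mapsto> (x + y\<^sup>2) / 2\<close> started at \<open>0\<close> converges in norm to
  \<open>1 - \<surd>a\<close>: its increments are dominated by those of the scalar iteration for \<open>x = 1\<close>, which
  increases to \<open>1\<close>.\<close>

primrec sqrt_iter :: "('h :: {real_inner, banach} \<Rightarrow>\<^sub>L 'h) \<Rightarrow> nat \<Rightarrow> 'h \<Rightarrow>\<^sub>L 'h" where
  "sqrt_iter x 0 = 0"
| "sqrt_iter x (Suc n) = (1/2) *\<^sub>R (x + (sqrt_iter x n o\<^sub>L sqrt_iter x n))"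

primrec scalar_iter :: "nat \<Rightarrow> real" where
  "scalar_iter 0 = 0"
| "scalar_iter (Suc n) = (1/2) * (1 + (scalar_iter n)\<^sup>2)"

lemma scalar_iter_bounds: "0 \<le> scalar_iter n \<and> scalar_iter n \<le> 1"
proof (induction n)
  case (Suc n)
  then have "(scalar_iter n)\<^sup>2 \<le> 1" by (simp add: power_le_one)
  then show ?case by simp
qed simp

lemma scalar_iter_mono: "scalar_iter n \<le> scalar_iter (Suc n)"
proof -
  have "0 \<le> (1 - scalar_iter n)\<^sup>2" by simp
  then show ?thesis by (simp add: power2_eq_square algebra_simps)
qed

lemma scalar_iter_convergent: "convergent scalar_iter"
proof (rule Bseq_mono_convergent)
  show "Bseq scalar_iter" using scalar_iter_bounds by (intro BseqI'[of _ 1]) simp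
  show "\<forall>m n. m \<le> n \<longrightarrow> scalar_iter m \<le> scalar_iter n"
    using incseq_SucI[of scalar_iter, OF scalar_iter_mono] by (simp only: incseq_def)
qed

lemma sqrt_iter_bounds:
  assumes x: "norm x \<le> 1"
  shows "norm (sqrt_iter x n) \<le> scalar_iter n"
    and "norm (sqrt_iter x (Suc n) - sqrt_iter x n) \<le> scalar_iter (Suc n) - scalar_iter n"
proof -
  have le: "norm (sqrt_iter x n) \<le> scalar_iter n" for n
  proof (induction n)
    case (Suc n)
    have "norm (sqrt_iter x (Suc n)) \<le> (1/2) * (norm x + norm (sqrt_iter x n) * norm (sqrt_iter x n))"
      using norm_triangle_ineq[of x "sqrt_iter x n o\<^sub>L sqrt_iter x n"]
        norm_blinfun_compose[of "sqrt_iter x n" "sqrt_iter x n"] by simp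
    also have "\<dots> \<le> (1/2) * (1 + scalar_iter n * scalar_iter n)"
      by (intro mult_left_mono add_mono mult_mono x Suc.IH) (use scalar_iter_bounds in auto)
    finally show ?case by (simp add: power2_eq_square)
  qed simp
  show "norm (sqrt_iter x n) \<le> scalar_iter n" by (rule le)
  show "norm (sqrt_iter x (Suc n) - sqrt_iter x n) \<le> scalar_iter (Suc n) - scalar_iter n"
  proof (induction n)
    case 0
    then show ?case using x by simp
  next
    case (Suc n)
    let ?u = "sqrt_iter x n" and ?v = "sqrt_iter x (Suc n)"
    have "sqrt_iter x (Suc (Suc n)) - ?v = (1/2) *\<^sub>R ((?v o\<^sub>L ?v) - (?u o\<^sub>L ?u))"
      by (simp only: sqrt_iter.simps(2)[of x "Suc n"] sqrt_iter.simps(2)[of x n])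
        (simp flip: scaleR_diff_right)
    \<comment> \<open>A difference of squares that is valid without commutation. Estimated term by
      term, it reproduces the same identity for \<open>scalar_iter\<close>.\<close>
    also have "(?v o\<^sub>L ?v) - (?u o\<^sub>L ?u) = (?v o\<^sub>L (?v - ?u)) + ((?v - ?u) o\<^sub>L ?u)"
      by (rule blinfun_eqI)
        (simp only: blinfun.diff_left blinfun.add_left blinfun.diff_right
          blinfun_apply_blinfun_compose diff_add_eq, simp)
    finally have "norm (sqrt_iter x (Suc (Suc n)) - ?v) =
        (1/2) * norm ((?v o\<^sub>L (?v - ?u)) + ((?v - ?u) o\<^sub>L ?u))" by simp
    also have "\<dots> \<le> (1/2) * (norm ?v * norm (?v - ?u) + norm (?v - ?u) * norm ?u)"
      by (intro mult_left_mono norm_triangle_mono norm_blinfun_compose) simp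
    also have "\<dots> \<le> (1/2) * (scalar_iter (Suc n) * (scalar_iter (Suc n) - scalar_iter n) +
        (scalar_iter (Suc n) - scalar_iter n) * scalar_iter n)"
      by (intro mult_left_mono add_mono mult_mono Suc.IH le)
        (use scalar_iter_bounds scalar_iter_mono[of n] in \<open>auto simp del: scalar_iter.simps\<close>)
    also have "\<dots> = (1/2) * ((scalar_iter (Suc n))\<^sup>2 - (scalar_iter n)\<^sup>2)"
      by (simp only: power2_eq_square) (simp only: algebra_simps)
    also have "\<dots> = scalar_iter (Suc (Suc n)) - scalar_iter (Suc n)"
      by (simp only: scalar_iter.simps(2)[of "Suc n"] scalar_iter.simps(2)[of n])
        (simp add: algebra_simps)
    finally show ?case .
  qed
qed

lemma sqrt_iter_convergent:
  assumes x: "norm x \<le> 1"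
  shows "convergent (sqrt_iter x)"
proof -
  have step: "norm (sqrt_iter x (n + k) - sqrt_iter x n) \<le> scalar_iter (n + k) - scalar_iter n" for n k
  proof (induction k)
    case (Suc k)
    have "norm (sqrt_iter x (n + Suc k) - sqrt_iter x n) \<le>
        norm (sqrt_iter x (Suc (n + k)) - sqrt_iter x (n + k)) + norm (sqrt_iter x (n + k) - sqrt_iter x n)"
      using norm_triangle_ineq[of "sqrt_iter x (Suc (n + k)) - sqrt_iter x (n + k)"
          "sqrt_iter x (n + k) - sqrt_iter x n"] by (simp del: sqrt_iter.simps)
    also have "\<dots> \<le> scalar_iter (n + Suc k) - scalar_iter n"
      using sqrt_iter_bounds(2)[OF x, of "n + k"] Suc.IH by (simp del: sqrt_iter.simps scalar_iter.simps)
    finally show ?case .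
  qed simp
  have "Cauchy scalar_iter" using scalar_iter_convergent by (simp add: Cauchy_convergent_iff)
  have "Cauchy (sqrt_iter x)"
  proof (rule CauchyI')
    fix e :: real assume "0 < e"
    then obtain n0 where n0: "\<And>m n. m \<ge> n0 \<Longrightarrow> n \<ge> n0 \<Longrightarrow> dist (scalar_iter m) (scalar_iter n) < e"
      using \<open>Cauchy scalar_iter\<close> unfolding Cauchy_def by blast
    show "\<exists>M. \<forall>m\<ge>M. \<forall>n>m. dist (sqrt_iter x m) (sqrt_iter x n) < e"
    proof (rule exI[of _ n0], intro allI impI)
      fix m n assume mn: "n0 \<le> m" "m < n"
      have "norm (sqrt_iter x m - sqrt_iter x n) \<le> scalar_iter n - scalar_iter m"
        using step[of m "n - m"] mn(2) by (simp add: norm_minus_commute)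
      also have "\<dots> < e" using n0[of n m] mn by (simp add: dist_real_def)
      finally show "dist (sqrt_iter x m) (sqrt_iter x n) < e" by (simp add: dist_norm)
    qed
  qed
  then show ?thesis by (simp add: Cauchy_convergent_iff)
qed

lemma tendsto_compose_op:
  fixes f g :: "nat \<Rightarrow> 'h :: real_normed_vector \<Rightarrow>\<^sub>L 'h"
  shows "f \<longlonglongrightarrow> a \<Longrightarrow> g \<longlonglongrightarrow> b \<Longrightarrow> (\<lambda>n. f n o\<^sub>L g n) \<longlonglongrightarrow> (a o\<^sub>L b)"
  by (rule bounded_bilinear.tendsto[OF bounded_bilinear_blinfun_compose])

text \<open>The limit \<open>y\<close> satisfies \<open>2 y = (1 - a) + y y\<close>, which says that
  \<open>1 - y\<close> squares to \<open>a\<close>. The iterates are polynomials in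
  \<open>a\<close>, so whatever commutes with \<open>a\<close> commutes with the limit; this is how
  roots of elements of \<open>M\<close> stay in \<open>M\<close>.\<close>

lemma psd_sqrt_contraction:
  assumes a: "psd a" and a1: "\<And>x. a x \<bullet> x \<le> (norm x)\<^sup>2"
  obtains h where "psd h" "h o\<^sub>L h = a" "\<And>s. s o\<^sub>L a = a o\<^sub>L s \<Longrightarrow> s o\<^sub>L h = h o\<^sub>L s"
proof -
  define x where "x = id_blinfun - a"
  have sx: "self_adj x" unfolding x_def by (intro self_adj_diff self_adj_id psd_self_adj a)
  have px: "psd x"
    by (rule psdI[OF sx])
      (use a1 in \<open>simp add: x_def blinfun.diff_left inner_diff_left power2_norm_eq_inner\<close>)
  have nx: "norm x \<le> 1"
    by (rule psd_norm_le[OF px])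
      (use psd_nonneg[OF a] in \<open>simp_all add: x_def blinfun.diff_left inner_diff_left
        power2_norm_eq_inner\<close>)
  obtain y where y: "sqrt_iter x \<longlonglongrightarrow> y"
    using sqrt_iter_convergent[OF nx] by (auto simp: convergent_def)
  have "(\<lambda>n. sqrt_iter x (Suc n)) \<longlonglongrightarrow> (1/2) *\<^sub>R (x + (y o\<^sub>L y))"
    unfolding sqrt_iter.simps by (intro tendsto_intros tendsto_compose_op y)
  moreover have "(\<lambda>n. sqrt_iter x (Suc n)) \<longlonglongrightarrow> y" by (rule LIMSEQ_Suc[OF y])
  ultimately have fixp: "y = (1/2) *\<^sub>R (x + (y o\<^sub>L y))" by (rule LIMSEQ_unique[rotated])
  have ny: "norm y \<le> 1"
  proof (rule LIMSEQ_le_const2[OF tendsto_norm[OF y]])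
    show "\<exists>N. \<forall>n\<ge>N. norm (sqrt_iter x n) \<le> 1"
      using sqrt_iter_bounds(1)[OF nx] scalar_iter_bounds order_trans by blast
  qed
  have "self_adj (sqrt_iter x n)" for n
  proof (induction n)
    case (Suc n)
    have "self_adj (sqrt_iter x n o\<^sub>L sqrt_iter x n)"
      using self_adjD[OF Suc.IH] by (simp add: self_adj_def)
    then show ?case by (simp add: self_adj_add self_adj_scaleR sx)
  qed simp
  then have sy: "self_adj y" by (rule self_adj_limit[OF y])
  show thesis
  proof (rule that[of "id_blinfun - y"])
    show "psd (id_blinfun - y)"
    proof (rule psdI)
      show "self_adj (id_blinfun - y)" by (intro self_adj_diff self_adj_id sy)
      fix v
      have "y v \<bullet> v \<le> norm y * (norm v)\<^sup>2" by (rule inner_le_norm_sq)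
      also have "\<dots> \<le> 1 * (norm v)\<^sup>2" by (intro mult_right_mono ny) simp
      finally show "0 \<le> (id_blinfun - y) v \<bullet> v"
        by (simp add: blinfun.diff_left inner_diff_left power2_norm_eq_inner)
    qed
    show "(id_blinfun - y) o\<^sub>L (id_blinfun - y) = a"
    proof (rule blinfun_eqI)
      fix v
      have "2 *\<^sub>R y v = 2 *\<^sub>R ((1/2) *\<^sub>R (x + (y o\<^sub>L y))) v" using fixp by simp
      also have "\<dots> = x v + y (y v)" by (simp add: blinfun.scaleR_left blinfun.add_left)
      finally have "y v + y v = v - a v + y (y v)" by (simp add: scaleR_2 x_def blinfun.diff_left)
      then show "((id_blinfun - y) o\<^sub>L (id_blinfun - y)) v = a v"
        by (simp add: blinfun.diff_left blinfun.diff_right algebra_simps)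
    qed
    fix s assume s: "s o\<^sub>L a = a o\<^sub>L s"
    have sx: "s o\<^sub>L x = x o\<^sub>L s"
      using compose_eqD[OF s] by (intro blinfun_eqI) (simp add: x_def blinfun.diff_left blinfun.diff_right)
    have sn: "s o\<^sub>L sqrt_iter x n = sqrt_iter x n o\<^sub>L s" for n
    proof (induction n)
      case (Suc n)
      have "s (x v) = x (s v)" "s (sqrt_iter x n v) = sqrt_iter x n (s v)" for v
        by (rule compose_eqD[OF sx], rule compose_eqD[OF Suc.IH])
      then show ?case
        by (intro blinfun_eqI) (simp add: blinfun.bilinear_simps)
    qed simp
    have "(\<lambda>n. s o\<^sub>L sqrt_iter x n) \<longlonglongrightarrow> (s o\<^sub>L y)" by (intro tendsto_compose_op tendsto_const y)
    moreover have "(\<lambda>n. sqrt_iter x n o\<^sub>L s) \<longlonglongrightarrow> (y o\<^sub>L s)" by (intro tendsto_compose_op tendsto_const y)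
    ultimately have "s o\<^sub>L y = y o\<^sub>L s" unfolding sn by (rule LIMSEQ_unique)
    then show "s o\<^sub>L (id_blinfun - y) = (id_blinfun - y) o\<^sub>L s"
      using compose_eqD[of s y y s] by (intro blinfun_eqI) (simp add: blinfun.diff_left blinfun.diff_right)
  qed
qed

lemma psd_sqrt:
  assumes a: "psd a"
  obtains h where "psd h" "h o\<^sub>L h = a" "\<And>s. s o\<^sub>L a = a o\<^sub>L s \<Longrightarrow> s o\<^sub>L h = h o\<^sub>L s"
proof -
  \<comment> \<open>Dividing by \<open>norm a + 1\<close> rather than \<open>norm a\<close> also
    covers \<open>a = 0\<close>.\<close>
  define r where "r = norm a + 1"
  have r: "0 < r" by (simp add: r_def add_nonneg_pos)
  have p: "psd (inverse r *\<^sub>R a)" using r by (intro psd_scaleR a) simp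
  have b: "(inverse r *\<^sub>R a) x \<bullet> x \<le> (norm x)\<^sup>2" for x
  proof -
    have "a x \<bullet> x \<le> r * (norm x)\<^sup>2"
      using inner_le_norm_sq[of a x] by (simp add: r_def distrib_right add_increasing2)
    then show ?thesis using r by (simp add: blinfun.scaleR_left field_simps)
  qed
  obtain h where h: "psd h" "h o\<^sub>L h = inverse r *\<^sub>R a"
    "\<And>s. s o\<^sub>L inverse r *\<^sub>R a = inverse r *\<^sub>R a o\<^sub>L s \<Longrightarrow> s o\<^sub>L h = h o\<^sub>L s"
    using psd_sqrt_contraction[OF p b] by blast
  show thesis
  proof (rule that[of "sqrt r *\<^sub>R h"])
    show "psd (sqrt r *\<^sub>R h)" using r by (intro psd_scaleR h) simp
    have "(sqrt r *\<^sub>R h) o\<^sub>L (sqrt r *\<^sub>R h) = r *\<^sub>R (h o\<^sub>L h)"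
      using r by (intro blinfun_eqI) (simp add: blinfun.scaleR_left blinfun.scaleR_right)
    then show "(sqrt r *\<^sub>R h) o\<^sub>L (sqrt r *\<^sub>R h) = a" using r by (simp add: h(2))
    fix s assume s: "s o\<^sub>L a = a o\<^sub>L s"
    have "s o\<^sub>L inverse r *\<^sub>R a = inverse r *\<^sub>R a o\<^sub>L s"
      using compose_eqD[OF s] by (intro blinfun_eqI) (simp add: blinfun.scaleR_left blinfun.scaleR_right)
    from compose_eqD[OF h(3)[OF this]] show "s o\<^sub>L sqrt r *\<^sub>R h = sqrt r *\<^sub>R h o\<^sub>L s"
      by (intro blinfun_eqI) (simp add: blinfun.scaleR_left blinfun.scaleR_right)
  qed
qed

text \<open>The projection onto the kernel of \<open>|a| - a\<close>.\<close>

lemma spectral_cut: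
  assumes a: "self_adj a"
  obtains E where "is_proj E" "\<And>s. s o\<^sub>L a = a o\<^sub>L s \<Longrightarrow> s o\<^sub>L E = E o\<^sub>L s"
    "\<And>x. E x = x \<Longrightarrow> 0 \<le> a x \<bullet> x" "\<And>x. E x = 0 \<Longrightarrow> a x \<bullet> x \<le> 0"
proof -
  \<comment> \<open>The root \<open>h\<close> of the square is the absolute value of
    \<open>a\<close>.\<close>
  have "psd (a o\<^sub>L a)" using psd_square[of a] a by (simp add: self_adj_iff)
  then obtain h where h: "psd h" "h o\<^sub>L h = a o\<^sub>L a"
    "\<And>s. s o\<^sub>L (a o\<^sub>L a) = (a o\<^sub>L a) o\<^sub>L s \<Longrightarrow> s o\<^sub>L h = h o\<^sub>L s"
    using psd_sqrt by blast
  have comm: "s o\<^sub>L h = h o\<^sub>L s" if "s o\<^sub>L a = a o\<^sub>L s" for s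
  proof (rule h(3), rule blinfun_eqI)
    fix x
    have "s (a x) = a (s x)" for x by (rule compose_eqD[OF that])
    then show "(s o\<^sub>L (a o\<^sub>L a)) x = (a o\<^sub>L a o\<^sub>L s) x" by simp
  qed
  define K where "K = {x. h x = a x}"
  have K: "closed K" "subspace K"
    by (auto simp: K_def subspace_def blinfun.add_right blinfun.scaleR_right
        intro!: closed_Collect_eq continuous_intros linear_continuous_on blinfun.bounded_linear_right)
  have sK: "s x \<in> K" if "s o\<^sub>L a = a o\<^sub>L s" "x \<in> K" for s x
    using compose_eqD[OF comm[OF that(1)], of x] compose_eqD[OF that(1), of x] that(2)
    unfolding K_def by simp
  define E where "E = ortho_proj K"
  have E: "is_proj E" unfolding E_def by (rule is_proj_ortho_proj[OF K])
  show thesis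
  proof (rule that[OF E])
    show "s o\<^sub>L E = E o\<^sub>L s" if s: "s o\<^sub>L a = a o\<^sub>L s" for s
      unfolding E_def
      by (rule ortho_proj_commute[OF K, symmetric]) (blast intro: sK s commute_real_adj[OF a])+
    show "0 \<le> a x \<bullet> x" if "E x = x" for x
    proof -
      have "x \<in> K" using that ortho_proj_fixed_iff[OF K] by (simp add: E_def)
      then show ?thesis using psd_nonneg[OF h(1), of x] by (simp add: K_def)
    qed
    fix x assume x: "E x = 0"
    have ha: "h (a w) = a (h w)" "h (h w) = a (a w)" for w
      by (rule compose_eqD[OF comm[of a, OF refl], symmetric], rule compose_eqD[OF h(2)])
    \<comment> \<open>Since \<open>h h = a a\<close> and \<open>h a = a h\<close>, the range of
      \<open>h + a\<close> lies in \<open>K\<close>. A vector orthogonal to \<open>K\<close> is thus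
      killed by \<open>h + a\<close>, so \<open>a\<close> acts on it as \<open>- h\<close>.\<close>
    have "(h x + a x) \<bullet> w = 0" for w
    proof -
      have "h w + a w \<in> K" by (simp add: K_def blinfun.add_right ha)
      then have "E (h w + a w) = h w + a w" using ortho_proj_fixed_iff[OF K] by (simp add: E_def)
      then have "x \<bullet> (h w + a w) = E x \<bullet> (h w + a w)" using is_proj_inner[OF E, of x] by simp
      then show ?thesis using x self_adjD[OF a, of x w] self_adjD[OF psd_self_adj[OF h(1)], of x w]
        by (simp add: inner_add_left inner_add_right)
    qed
    then have "h x + a x = 0" by (metis inner_eq_zero_iff)
    then have "a x = - h x" by (simp add: add_eq_0_iff)
    then show "a x \<bullet> x \<le> 0" using psd_nonneg[OF h(1), of x] by simp
  qed
qed

text \<open>The cut of \<open>h\<close> at the level \<open>d\<close>. As \<open>d\<close> is half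
  the Rayleigh quotient of \<open>h\<close> at \<open>x\<close>, the vector \<open>x\<close> cannot
  lie in the part where the form of \<open>h\<close> is at most \<open>d\<close>, so
  \<open>E x\<close> is nonzero. The bound by \<open>norm h\<close> keeps \<open>d\<close> at most
  one half when \<open>h\<close> is a contraction.\<close>

lemma spectral_cut_positive:
  assumes h: "psd h" "h \<noteq> 0"
  obtains d E x where "0 < d" "2 * d \<le> norm h" "is_proj E" "E x \<noteq> 0"
    "\<And>s. s o\<^sub>L h = h o\<^sub>L s \<Longrightarrow> s o\<^sub>L E = E o\<^sub>L s"
    "\<And>y. E y = y \<Longrightarrow> d * (norm y)\<^sup>2 \<le> h y \<bullet> y"
proof -
  obtain x where x: "0 < h x \<bullet> x" using psd_eq_0I[OF h(1)] h(2) by (auto simp: not_le[symmetric])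
  then have xx: "0 < (norm x)\<^sup>2" by auto
  define d where "d = (h x \<bullet> x) / (2 * (norm x)\<^sup>2)"
  have d: "0 < d" using x xx by (simp add: d_def)
  have dx: "h x \<bullet> x = 2 * d * (norm x)\<^sup>2" using xx by (simp add: d_def)
  have "2 * d * (norm x)\<^sup>2 \<le> norm h * (norm x)\<^sup>2" using inner_le_norm_sq[of h x] dx by simp
  then have d2: "2 * d \<le> norm h" using xx by (rule mult_right_le_imp_le)
  have "self_adj (h - d *\<^sub>R id_blinfun)"
    by (intro self_adj_diff self_adj_scaleR self_adj_id psd_self_adj h)
  then obtain E where E: "is_proj E"
    "\<And>s. s o\<^sub>L (h - d *\<^sub>R id_blinfun) = (h - d *\<^sub>R id_blinfun) o\<^sub>L s \<Longrightarrow> s o\<^sub>L E = E o\<^sub>L s"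
    "\<And>x. E x = x \<Longrightarrow> 0 \<le> (h - d *\<^sub>R id_blinfun) x \<bullet> x"
    "\<And>x. E x = 0 \<Longrightarrow> (h - d *\<^sub>R id_blinfun) x \<bullet> x \<le> 0"
    using spectral_cut by blast
  have inner: "(h - d *\<^sub>R id_blinfun) y \<bullet> y = h y \<bullet> y - d * (norm y)\<^sup>2" for y
    by (simp add: blinfun.diff_left blinfun.scaleR_left inner_diff_left power2_norm_eq_inner)
  have comm: "s o\<^sub>L E = E o\<^sub>L s" if "s o\<^sub>L h = h o\<^sub>L s" for s
    by (rule E(2), rule blinfun_eqI) (simp add: blinfun.bilinear_simps compose_eqD[OF that])
  have "E x \<noteq> 0"
  proof
    assume "E x = 0"
    from E(4)[OF this] have "2 * (d * (norm x)\<^sup>2) \<le> d * (norm x)\<^sup>2" unfolding inner by (simp add: dx)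
    then show False using mult_pos_pos[OF d xx] by linarith
  qed
  with d d2 E(1) show thesis by (rule that[OF _ _ _ _ comm]) (use E(3) inner in auto)
qed

text \<open>The first digit in the binary expansion of a positive contraction.\<close>

lemma psd_binary_step:
  assumes b: "psd b" and b1: "psd (id_blinfun - b)"
  obtains E where "is_proj E" "\<And>s. s o\<^sub>L b = b o\<^sub>L s \<Longrightarrow> s o\<^sub>L E = E o\<^sub>L s"
    "psd (2 *\<^sub>R b - E)" "psd (id_blinfun - (2 *\<^sub>R b - E))"
proof -
  \<comment> \<open>The digit is 1 where \<open>b\<close> is at least one half, that is, where
    \<open>2 b - 1\<close> is nonnegative.\<close>
  define a where "a = 2 *\<^sub>R b - id_blinfun"
  have "self_adj a" unfolding a_def by (intro self_adj_diff self_adj_scaleR self_adj_id psd_self_adj b)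
  then obtain E where E: "is_proj E" "\<And>s. s o\<^sub>L a = a o\<^sub>L s \<Longrightarrow> s o\<^sub>L E = E o\<^sub>L s"
    "\<And>x. E x = x \<Longrightarrow> 0 \<le> a x \<bullet> x" "\<And>x. E x = 0 \<Longrightarrow> a x \<bullet> x \<le> 0"
    using spectral_cut by blast
  have comm: "s o\<^sub>L E = E o\<^sub>L s" if "s o\<^sub>L b = b o\<^sub>L s" for s
  proof (rule E(2), rule blinfun_eqI)
    fix x
    have "s (b x) = b (s x)" by (rule compose_eqD[OF that])
    then show "(s o\<^sub>L a) x = (a o\<^sub>L s) x"
      by (simp add: a_def blinfun.bilinear_simps)
  qed
  have bE: "b (E x) = E (b x)" for x by (rule compose_eqD[OF comm[of b, OF refl]])
  have split: "b x \<bullet> x = b (E x) \<bullet> E x + b (x - E x) \<bullet> (x - E x)" for x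
  proof -
    have "b (E x) \<bullet> (x - E x) = 0" "b (x - E x) \<bullet> E x = 0"
      using is_proj_inner[OF E(1), of "b x" "x - E x"] is_proj_inner[OF E(1), of "b (x - E x)" x]
      by (simp_all add: bE blinfun.diff_right is_proj_idem[OF E(1)])
    moreover have "b x = b (E x) + b (x - E x)" by (simp add: blinfun.diff_right)
    moreover have "(b (E x) + b (x - E x)) \<bullet> x = (b (E x) + b (x - E x)) \<bullet> (E x + (x - E x))"
      by simp
    ultimately show ?thesis by (simp only: inner_add_left inner_add_right)
  qed
  have Ex: "E (E x) = E x" "E (x - E x) = 0" for x
    by (simp_all add: blinfun.diff_right is_proj_idem[OF E(1)])
  \<comment> \<open>On the range of \<open>E\<close>, \<open>b\<close> lies between 1/2 and 1 and
    \<open>2 b - 1\<close> is again a positive contraction; on the complement \<open>b\<close> lies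
    between 0 and 1/2 and \<open>2 b\<close> is one. By \<open>split\<close> the two parts can be
    treated separately.\<close>
  have pos: "0 \<le> 2 * (b (E x) \<bullet> E x) - E x \<bullet> E x"
    and neg: "2 * (b (x - E x) \<bullet> (x - E x)) - (x - E x) \<bullet> (x - E x) \<le> 0" for x
    using E(3)[OF Ex(1), of x] E(4)[OF Ex(2), of x]
    by (simp_all only: a_def blinfun.diff_left blinfun.scaleR_left inner_diff_left
        inner_scaleR_left blinfun_apply_id_blinfun)
  have EE: "E x \<bullet> x = E x \<bullet> E x" for x
    using is_proj_inner_self[OF E(1), of x] by (simp add: power2_norm_eq_inner)
  have xx: "x \<bullet> x = E x \<bullet> E x + (x - E x) \<bullet> (x - E x)" for x
    using is_proj_pythagoras[OF E(1), of x] by (simp only: power2_norm_eq_inner)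
  have lt1: "b y \<bullet> y \<le> y \<bullet> y" for y
    using psd_nonneg[OF b1, of y] by (simp add: blinfun.diff_left inner_diff_left)
  have sE: "self_adj E" using E(1) by (simp add: is_proj_def)
  show thesis
  proof (rule that[OF E(1) comm])
    show "psd (2 *\<^sub>R b - E)"
    proof (rule psdI)
      show "self_adj (2 *\<^sub>R b - E)" by (intro self_adj_diff self_adj_scaleR psd_self_adj b sE)
      show "0 \<le> (2 *\<^sub>R b - E) x \<bullet> x" for x
        using pos[of x] split[of x] EE[of x] psd_nonneg[OF b, of "x - E x"]
        by (simp add: blinfun.diff_left blinfun.scaleR_left inner_diff_left)
    qed
    show "psd (id_blinfun - (2 *\<^sub>R b - E))"
    proof (rule psdI)
      show "self_adj (id_blinfun - (2 *\<^sub>R b - E))"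
        by (intro self_adj_diff self_adj_scaleR self_adj_id psd_self_adj b sE)
      fix x
      have "(id_blinfun - (2 *\<^sub>R b - E)) x \<bullet> x = x \<bullet> x - 2 * (b x \<bullet> x) + E x \<bullet> x"
        by (simp add: blinfun.diff_left blinfun.scaleR_left inner_diff_left)
      then show "0 \<le> (id_blinfun - (2 *\<^sub>R b - E)) x \<bullet> x"
        using neg[of x] split[of x] EE[of x] xx[of x] lt1[of "E x"] by linarith
    qed
  qed
qed

subsection \<open>Partial isometries and comparison of projections\<close>

text \<open>Multiplication by \<open>i\<close> lies in a complex von Neumann algebra and in its commutant, so it is
  enough to argue with real-linear operators; the center is \<open>M \<inter> N\<close>.\<close>

locale real_vn_algebra =
  fixes M N :: "('h :: {real_inner, banach} \<Rightarrow>\<^sub>L 'h) set"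
  assumes M_iff: "a \<in> M \<longleftrightarrow> (\<forall>s\<in>N. a o\<^sub>L s = s o\<^sub>L a)"
    and N_iff: "a \<in> N \<longleftrightarrow> (\<forall>s\<in>M. a o\<^sub>L s = s o\<^sub>L a)"
    and adj_M: "a \<in> M \<Longrightarrow> real_adj a \<in> M"
begin

lemma MN_commute: "a \<in> M \<Longrightarrow> s \<in> N \<Longrightarrow> blinfun_apply a (blinfun_apply s x) = s (a x)"
  using M_iff compose_eqD by blast

lemma M_I: "(\<And>s x. s \<in> N \<Longrightarrow> blinfun_apply a (blinfun_apply s x) = s (a x)) \<Longrightarrow> a \<in> M"
  unfolding M_iff by (auto intro: blinfun_eqI)

lemma N_I: "(\<And>s x. s \<in> M \<Longrightarrow> blinfun_apply a (blinfun_apply s x) = s (a x)) \<Longrightarrow> a \<in> N"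
  unfolding N_iff by (auto intro: blinfun_eqI)

lemma adj_N: "s \<in> N \<Longrightarrow> real_adj s \<in> N"
proof (rule N_I, rule vector_eq_rdot[THEN iffD1], rule allI)
  fix a :: "'h \<Rightarrow>\<^sub>L 'h" and x y assume s: "s \<in> N" and a: "a \<in> M"
  have "real_adj a (s y) = s (real_adj a y)" by (rule MN_commute[OF adj_M[OF a] s])
  then show "real_adj s (a x) \<bullet> y = a (real_adj s x) \<bullet> y"
    by (metis real_adj_left real_adj_right)
qed

lemma id_M [simp]: "id_blinfun \<in> M" and zero_M [simp]: "0 \<in> M"
  by (auto intro!: M_I)

lemma add_M: "a \<in> M \<Longrightarrow> b \<in> M \<Longrightarrow> a + b \<in> M"
  by (rule M_I) (simp add: blinfun.add_left blinfun.add_right MN_commute)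

lemma diff_M: "a \<in> M \<Longrightarrow> b \<in> M \<Longrightarrow> a - b \<in> M"
  by (rule M_I) (simp add: blinfun.diff_left blinfun.diff_right MN_commute)

lemma scaleR_M: "a \<in> M \<Longrightarrow> r *\<^sub>R a \<in> M"
  by (rule M_I) (simp add: blinfun.scaleR_left blinfun.scaleR_right MN_commute)

lemma compose_M: "a \<in> M \<Longrightarrow> b \<in> M \<Longrightarrow> a o\<^sub>L b \<in> M"
  by (rule M_I) (simp add: MN_commute)

lemmas M_intros = id_M zero_M add_M diff_M scaleR_M compose_M adj_M

lemma id_N [simp]: "id_blinfun \<in> N" and zero_N [simp]: "0 \<in> N"
  by (auto intro!: N_I)

lemma diff_N: "a \<in> N \<Longrightarrow> b \<in> N \<Longrightarrow> a - b \<in> N"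
  by (rule N_I) (simp add: blinfun.diff_left blinfun.diff_right flip: MN_commute)

lemma scaleR_N: "a \<in> N \<Longrightarrow> r *\<^sub>R a \<in> N"
  by (rule N_I) (simp add: blinfun.scaleR_left blinfun.scaleR_right flip: MN_commute)

lemma compose_N: "a \<in> N \<Longrightarrow> b \<in> N \<Longrightarrow> a o\<^sub>L b \<in> N"
  by (rule N_I) (simp flip: MN_commute)

text \<open>Norm completeness of \<open>M\<close> keeps the fixed point in
  \<open>partial_isometry_exists\<close> inside \<open>M\<close>.\<close>

lemma closed_M: "closed M"
proof -
  have "M = (\<Inter>s\<in>N. {a. a o\<^sub>L s = s o\<^sub>L a})" using M_iff by blast
  also have "closed \<dots>"
    by (intro closed_INT ballI closed_Collect_eq
        bounded_bilinear.continuous_on[OF bounded_bilinear_blinfun_compose] continuous_intros)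
  finally show ?thesis .
qed

text \<open>\<open>a\<close> commutes with all of \<open>N\<close>, hence so does \<open>h\<close>.
  The commutation clauses of \<open>psd_sqrt\<close> and of the spectral cuts have exactly this
  shape.\<close>

lemma bicommutant_M:
  "a \<in> M \<Longrightarrow> (\<And>s. s o\<^sub>L a = a o\<^sub>L s \<Longrightarrow> s o\<^sub>L h = h o\<^sub>L s) \<Longrightarrow> h \<in> M"
  using M_iff by metis

lemma bicommutant_N:
  "a \<in> N \<Longrightarrow> (\<And>s. s o\<^sub>L a = a o\<^sub>L s \<Longrightarrow> s o\<^sub>L h = h o\<^sub>L s) \<Longrightarrow> h \<in> N"
  using N_iff by metis

lemma ortho_proj_M:
  assumes K: "closed K" "subspace K" and inv: "\<And>s x. s \<in> N \<Longrightarrow> x \<in> K \<Longrightarrow> blinfun_apply s x \<in> K"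
  shows "ortho_proj K \<in> M"
  unfolding M_iff using ortho_proj_commute[OF K] inv adj_N by blast

lemma ortho_proj_N:
  assumes K: "closed K" "subspace K" and inv: "\<And>s x. s \<in> M \<Longrightarrow> x \<in> K \<Longrightarrow> blinfun_apply s x \<in> K"
  shows "ortho_proj K \<in> N"
  unfolding N_iff using ortho_proj_commute[OF K] inv adj_M by blast

text \<open>The fixed point \<open>k\<close> inverts \<open>h = |b|\<close> on the range of a spectral projection \<open>E\<close> on which
  \<open>h \<ge> e\<close>; then \<open>b E k\<close> is isometric on the range of \<open>E\<close>.\<close>

lemma partial_isometry_exists:
  assumes a: "a \<in> M" "a \<noteq> 0"
  obtains u w E where "u \<in> M" "w \<in> M" "E \<in> M" "is_proj E" "E \<noteq> 0" "real_adj u o\<^sub>L u = E"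
    "u = a o\<^sub>L w" "\<And>x. blinfun_apply a x = 0 \<Longrightarrow> blinfun_apply E x = 0"
proof -
  \<comment> \<open>Normalized so that the absolute value \<open>h\<close> of \<open>b\<close> is a
    contraction and \<open>1 - h\<close> is positive.\<close>
  define b where "b = inverse (norm a) *\<^sub>R a"
  have nb: "norm b = 1" using a(2) by (simp add: b_def)
  have b: "b \<in> M" unfolding b_def by (rule scaleR_M[OF a(1)])
  obtain h where h: "psd h" "h o\<^sub>L h = real_adj b o\<^sub>L b"
    "\<And>s. s o\<^sub>L (real_adj b o\<^sub>L b) = (real_adj b o\<^sub>L b) o\<^sub>L s \<Longrightarrow> s o\<^sub>L h = h o\<^sub>L s"
    using psd_sqrt[OF psd_square[of b]] by blast
  have hM: "h \<in> M" by (rule bicommutant_M[of "real_adj b o\<^sub>L b"]) (intro M_intros b, rule h(3))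
  have hb: "h x \<bullet> h y = b x \<bullet> b y" for x y
    using compose_eqD[OF h(2), of y] self_adjD[OF psd_self_adj[OF h(1)], of x "h y"]
      real_adj_right[of x b "b y"] by simp
  have nh: "norm (h x) = norm (b x)" for x by (simp add: norm_eq_sqrt_inner hb)
  have h1: "h x \<bullet> x \<le> (norm x)\<^sup>2" for x
  proof -
    have "h x \<bullet> x \<le> norm (h x) * norm x" by (rule norm_cauchy_schwarz)
    also have "\<dots> \<le> norm x * norm x"
      using norm_blinfun[of b x] by (intro mult_right_mono) (simp_all add: nh nb)
    finally show ?thesis by (simp add: power2_eq_square)
  qed
  have "h \<noteq> 0"
  proof
    assume "h = 0"
    then have "b x = 0" for x using nh[of x] by simp
    then have "b = 0" by (intro blinfun_eqI) simp
    with nb show False by simp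
  qed
  then obtain e E x0 where e: "0 < e" "2 * e \<le> norm h" and E: "is_proj E" "E x0 \<noteq> 0"
    "\<And>s. s o\<^sub>L h = h o\<^sub>L s \<Longrightarrow> s o\<^sub>L E = E o\<^sub>L s"
    and lower: "\<And>y. E y = y \<Longrightarrow> e * (norm y)\<^sup>2 \<le> h y \<bullet> y"
    using spectral_cut_positive[OF h(1)] by metis
  have "norm h \<le> 1" by (rule psd_norm_le[OF h(1)]) (use h1 in simp_all)
  with e have e1: "2 * e \<le> 1" by simp
  note e = e(1)
  have EM: "E \<in> M" by (rule bicommutant_M[OF hM E(3)])
  have hE: "h (E x) = E (h x)" for x by (rule compose_eqD[OF E(3)[OF refl]])
  note EE = is_proj_idem[OF E(1)]
  have E0: "E \<noteq> 0" using E(2) by auto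
  \<comment> \<open>On the range of \<open>E\<close> this is \<open>1 - h\<close>, of norm at most
    \<open>1 - e\<close>. A solution of \<open>k = E + g k\<close> inverts \<open>h\<close> there;
    it is the Neumann series in disguise.\<close>
  define g where "g = E - (h o\<^sub>L E)"
  have gM: "g \<in> M" unfolding g_def by (intro M_intros EM hM)
  have gx: "g x \<bullet> x = (norm (E x))\<^sup>2 - h (E x) \<bullet> E x" for x
    using is_proj_inner_self[OF E(1), of x] is_proj_inner[OF E(1), of "h (E x)" x]
    by (simp add: g_def blinfun.diff_left inner_diff_left hE EE)
  have ng: "norm g \<le> 1 - e"
  proof (rule psd_norm_le)
    have "self_adj (h o\<^sub>L E)"
      unfolding self_adj_def blinfun_apply_blinfun_compose
      using self_adjD[OF psd_self_adj[OF h(1)]] is_proj_inner[OF E(1)] by (simp add: hE)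
    then show "psd g"
      using E(1) h1 by (intro psdI) (auto simp: g_def is_proj_def intro!: self_adj_diff simp: gx[unfolded g_def])
    show "g x \<bullet> x \<le> (1 - e) * (norm x)\<^sup>2" for x
    proof -
      have "g x \<bullet> x \<le> (1 - e) * (norm (E x))\<^sup>2"
        using lower[OF EE, of x] by (simp add: gx algebra_simps)
      also have "\<dots> \<le> (1 - e) * (norm x)\<^sup>2"
        using e1 e by (intro mult_left_mono power_mono is_proj_norm_le E(1)) simp_all
      finally show ?thesis .
    qed
  qed (use e1 e in simp)
  have "\<exists>!k\<in>M. E + (g o\<^sub>L k) = k"
  proof (rule Banach_fix)
    show "complete M" using closed_M by (simp add: complete_eq_closed)
    show "M \<noteq> {}" using id_M by blast
    show "0 \<le> 1 - e" "1 - e < 1" using e e1 by simp_all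
    show "(\<lambda>k. E + (g o\<^sub>L k)) ` M \<subseteq> M" by (auto intro!: M_intros EM gM)
    fix k l
    have "(E + (g o\<^sub>L k)) - (E + (g o\<^sub>L l)) = g o\<^sub>L (k - l)"
      by (rule blinfun_eqI) (simp add: blinfun.bilinear_simps)
    then have "dist (E + (g o\<^sub>L k)) (E + (g o\<^sub>L l)) \<le> norm g * norm (k - l)"
      by (simp only: dist_norm norm_blinfun_compose)
    also have "\<dots> \<le> (1 - e) * dist k l" by (simp add: dist_norm mult_right_mono ng)
    finally show "dist (E + (g o\<^sub>L k)) (E + (g o\<^sub>L l)) \<le> (1 - e) * dist k l" .
  qed
  then obtain k where kM: "k \<in> M" and k: "E + (g o\<^sub>L k) = k" by blast
  define w where "w = E o\<^sub>L k"
  \<comment> \<open>Applying \<open>E\<close> to the fixed-point equation cancels \<open>E k\<close>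
    and leaves \<open>h E k = E\<close>.\<close>
  have hw: "h (w x) = E x" for x
  proof -
    have "E x + (E (k x) - h (E (k x))) = k x"
      using arg_cong[OF k, of "\<lambda>k. blinfun_apply k x"] by (simp add: g_def blinfun.diff_left blinfun.add_left)
    then have "E (E x + (E (k x) - h (E (k x)))) = E (k x)" by simp
    then show ?thesis by (simp add: w_def blinfun.add_right blinfun.diff_right EE hE)
  qed
  show thesis
  proof (rule that[of "b o\<^sub>L w" "inverse (norm a) *\<^sub>R w" E])
    show wM: "inverse (norm a) *\<^sub>R w \<in> M" "b o\<^sub>L w \<in> M"
      unfolding w_def by (intro M_intros EM kM b)+
    show "real_adj (b o\<^sub>L w) o\<^sub>L (b o\<^sub>L w) = E"
    proof (rule blinfun_eq_innerI)
      fix x y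
      have "b (w x) \<bullet> b (w y) = E x \<bullet> E y" by (simp only: hw flip: hb)
      then show "(real_adj (b o\<^sub>L w) o\<^sub>L (b o\<^sub>L w)) x \<bullet> y = E x \<bullet> y"
        using is_proj_inner[OF E(1), of "E x" y] by (simp add: real_adj_left EE)
    qed
    show "b o\<^sub>L w = a o\<^sub>L inverse (norm a) *\<^sub>R w"
      by (rule blinfun_eqI) (simp add: b_def blinfun.scaleR_left blinfun.scaleR_right)
    \<comment> \<open>\<open>a\<close>, \<open>b\<close> and \<open>h\<close> have the same kernel.
      As \<open>E\<close> commutes with \<open>h\<close>, \<open>E x\<close> lies in it, but there
      the form of \<open>h\<close> is bounded below.\<close>
    fix x assume "a x = 0"
    then have "h x = 0" using nh[of x] by (simp add: b_def blinfun.scaleR_left)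
    then have "h (E x) = 0" by (simp add: hE)
    then have "e * (norm (E x))\<^sup>2 \<le> 0" using lower[OF EE, of x] by simp
    then show "E x = 0" using e by (simp add: mult_le_0_iff)
  qed (fact EM E(1) E0)+
qed

end

section \<open>Partial isometries as graphs, and Zorn's lemma for them\<close>

lemma closure_Union_chain_subspace:
  fixes C :: "'b :: real_normed_vector set set"
  assumes ne: "C \<noteq> {}" and sub: "\<And>K. K \<in> C \<Longrightarrow> subspace K"
    and chain: "\<And>K L. K \<in> C \<Longrightarrow> L \<in> C \<Longrightarrow> K \<subseteq> L \<or> L \<subseteq> K"
  shows "subspace (closure (\<Union>C))"
proof -
  have "subspace (\<Union>C)"
  proof (rule subspaceI)
    show "0 \<in> \<Union>C" using ne sub subspace_0 by blast
    fix x y assume "x \<in> \<Union>C" "y \<in> \<Union>C"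
    then obtain K L where KL: "K \<in> C" "x \<in> K" "L \<in> C" "y \<in> L" by blast
    with chain[OF KL(1,3)] obtain L' where "L' \<in> C" "x \<in> L'" "y \<in> L'" by blast
    then show "x + y \<in> \<Union>C" using sub subspace_add by blast
  next
    fix c x assume "x \<in> \<Union>C"
    then show "c *\<^sub>R x \<in> \<Union>C" using sub subspace_scale by blast
  qed
  then have U: "\<And>x y. x \<in> \<Union>C \<Longrightarrow> y \<in> \<Union>C \<Longrightarrow> x + y \<in> \<Union>C"
    "\<And>c x. x \<in> \<Union>C \<Longrightarrow> c *\<^sub>R x \<in> \<Union>C" "0 \<in> \<Union>C"
    by (auto simp: subspace_def)
  show ?thesis
  proof (rule subspaceI)
    show "0 \<in> closure (\<Union>C)" by (rule subsetD[OF closure_subset U(3)])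
    fix x y assume "x \<in> closure (\<Union>C)" "y \<in> closure (\<Union>C)"
    then obtain f g where fg: "\<forall>n. f n \<in> \<Union>C" "f \<longlonglongrightarrow> x" "\<forall>n. g n \<in> \<Union>C" "g \<longlonglongrightarrow> y"
      unfolding closure_sequential by blast
    have "(\<lambda>n. f n + g n) \<longlonglongrightarrow> x + y" by (intro tendsto_add fg)
    moreover have "\<forall>n. f n + g n \<in> \<Union>C" using fg U(1) by blast
    ultimately show "x + y \<in> closure (\<Union>C)"
      unfolding closure_sequential by (intro exI[of _ "\<lambda>n. f n + g n"] conjI)
  next
    fix c x assume "x \<in> closure (\<Union>C)"
    then obtain f where f: "\<forall>n. f n \<in> \<Union>C" "f \<longlonglongrightarrow> x" unfolding closure_sequential by blast
    have "(\<lambda>n. c *\<^sub>R f n) \<longlonglongrightarrow> c *\<^sub>R x" by (intro tendsto_intros f)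
    moreover have "\<forall>n. c *\<^sub>R f n \<in> \<Union>C" using f U(2) by blast
    ultimately show "c *\<^sub>R x \<in> closure (\<Union>C)"
      unfolding closure_sequential by (intro exI[of _ "\<lambda>n. c *\<^sub>R f n"] conjI)
  qed
qed

lemma blinfun_nonzero:
  assumes "a \<noteq> 0"
  obtains x where "blinfun_apply a x \<noteq> 0"
proof -
  have "a = 0" if "\<And>x. blinfun_apply a x = 0"
    by (rule blinfun_eqI) (simp add: that)
  with assms that show thesis by blast
qed

text \<open>\<open>?d\<close> lies in the kernel of \<open>real_adj v o\<^sub>L v\<close>, which is
  the kernel of \<open>v\<close>.\<close>

lemma partial_isometry_initial:
  assumes v: "is_proj (real_adj v o\<^sub>L v)"
  shows "v (real_adj v (v x)) = v x"
proof -
  let ?d = "x - real_adj v (v x)"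
  have "real_adj v (v ?d) = 0"
    using is_proj_idem[OF v, of x] by (simp add: blinfun.diff_right)
  then have "v ?d \<bullet> v ?d = 0" by (metis inner_zero_left real_adj_left)
  then show ?thesis by (simp add: blinfun.diff_right)
qed

lemma partial_isometry_final:
  assumes v: "is_proj (real_adj v o\<^sub>L v)"
  shows "is_proj (v o\<^sub>L real_adj v)"
    and "real_adj v (v (real_adj v y)) = real_adj v y"
proof -
  show *: "is_proj (v o\<^sub>L real_adj v)"
  proof (rule is_projI)
    show "(v o\<^sub>L real_adj v) x \<bullet> y = x \<bullet> (v o\<^sub>L real_adj v) y" for x y
      by (metis blinfun_apply_blinfun_compose real_adj_left real_adj_right)
    show "(v o\<^sub>L real_adj v) ((v o\<^sub>L real_adj v) x) = (v o\<^sub>L real_adj v) x" for x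
      by (simp add: partial_isometry_initial[OF v])
  qed
  show "real_adj v (v (real_adj v y)) = real_adj v y"
    using partial_isometry_initial[of "real_adj v" y] * by simp
qed

text \<open>Only the initial space of \<open>v\<close> is kept as domain. So inclusion of graphs is
  extension of partial isometries, and a maximal one can be sought among closed subspaces of the
  product space.\<close>

definition op_graph :: "('h :: {real_inner, banach} \<Rightarrow>\<^sub>L 'h) \<Rightarrow> ('h \<times> 'h) set" where
  "op_graph v = {(x, y). real_adj v (v x) = x \<and> y = v x}"

context real_vn_algebra
begin

text \<open>The graphs of the partial isometries in \<open>M\<close>, as
  \<open>iso_subspace_graph\<close> and \<open>op_graph_iso_subspace\<close> show, described by
  conditions that survive the closure of the union of a chain. Invariance under \<open>N\<close>
  stands for membership in \<open>M\<close>.\<close>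

definition iso_subspaces :: "('h \<times> 'h) set set" where
  "iso_subspaces = {K. closed K \<and> subspace K \<and> (\<forall>k\<in>K. norm (fst k) = norm (snd k)) \<and>
     (\<forall>s\<in>N. \<forall>x y. (x, y) \<in> K \<longrightarrow> (blinfun_apply s x, blinfun_apply s y) \<in> K)}"

lemma iso_subspacesI:
  assumes "closed K" "subspace K" "\<And>k. k \<in> K \<Longrightarrow> norm (fst k) = norm (snd k)"
    "\<And>s x y. s \<in> N \<Longrightarrow> (x, y) \<in> K \<Longrightarrow> (blinfun_apply s x, blinfun_apply s y) \<in> K"
  shows "K \<in> iso_subspaces"
  using assms unfolding iso_subspaces_def by simp

text \<open>If \<open>K\<close> is the graph of \<open>v\<close> on the initial space of \<open>v\<close> and \<open>P\<close> is the projection onto \<open>K\<close>,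
  then \<open>2 P (x, 0) = (v\<^sup>* v x, v x)\<close>.\<close>

lemma iso_subspace_graph:
  assumes K: "K \<in> iso_subspaces"
  obtains v where "v \<in> M" "is_proj (real_adj v o\<^sub>L v)" "K = op_graph v"
proof -
  have cK: "closed K" "subspace K" and iso: "\<And>x y. (x, y) \<in> K \<Longrightarrow> norm x = norm y"
    and inv: "\<And>s x y. s \<in> N \<Longrightarrow> (x, y) \<in> K \<Longrightarrow> (blinfun_apply s x, blinfun_apply s y) \<in> K"
    using K unfolding iso_subspaces_def by auto
  \<comment> \<open>Polarization: on a subspace of pairs of equal norm, inner products agree as
    well.\<close>
  have pol: "x \<bullet> x' = y \<bullet> y'" if "(x, y) \<in> K" "(x', y') \<in> K" for x y x' y'
  proof -
    have "(x + x', y + y') \<in> K" using subspace_add[OF cK(2) that] by simp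
    then have "(norm (x + x'))\<^sup>2 = (norm (y + y'))\<^sup>2" by (simp only: iso)
    moreover have "(norm x)\<^sup>2 = (norm y)\<^sup>2" "(norm x')\<^sup>2 = (norm y')\<^sup>2"
      by (simp_all only: iso[OF that(1)] iso[OF that(2)])
    ultimately show ?thesis
      unfolding power2_norm_eq_inner
      by (simp add: inner_add_left inner_add_right inner_commute)
  qed
  define P where "P = blinfun_apply (ortho_proj K)"
  have PK: "P z \<in> K" and P0: "k \<in> K \<Longrightarrow> (z - P z) \<bullet> k = 0" for z k
    unfolding P_def using ortho_proj[OF cK] by blast+
  have Peq: "P z = k" if "k \<in> K" "\<And>y. y \<in> K \<Longrightarrow> (z - k) \<bullet> y = 0" for z k
    unfolding P_def by (rule ortho_proj_eqI[OF cK that])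
  have blP: "bounded_linear (\<lambda>x. P (x, 0))"
    unfolding P_def by (intro bounded_linear_compose[OF blinfun.bounded_linear_right]
        bounded_linear_Pair bounded_linear_ident bounded_linear_zero)
  define v where "v = Blinfun (\<lambda>x. 2 *\<^sub>R snd (P (x, 0)))"
  define E where "E = Blinfun (\<lambda>x. 2 *\<^sub>R fst (P (x, 0)))"
  have v: "v x = 2 *\<^sub>R snd (P (x, 0))" for x
    unfolding v_def
    by (subst bounded_linear_Blinfun_apply) (intro bounded_linear_compose[OF bounded_linear_scaleR_right]
        bounded_linear_compose[OF bounded_linear_snd] blP, rule refl)
  have E: "E x = 2 *\<^sub>R fst (P (x, 0))" for x
    unfolding E_def
    by (subst bounded_linear_Blinfun_apply) (intro bounded_linear_compose[OF bounded_linear_scaleR_right]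
        bounded_linear_compose[OF bounded_linear_fst] blP, rule refl)
  have EvK: "(E x, v x) \<in> K" for x
    using subspace_scale[OF cK(2) PK[of "(x, 0)"], of 2] by (simp add: E v scaleR_prod_def)
  \<comment> \<open>The residual is half of \<open>(x, - y)\<close>, which is orthogonal to
    \<open>K\<close> by \<open>pol\<close>; the factor 2 in \<open>v\<close> and \<open>E\<close>
    undoes this half.\<close>
  have PE: "P (x, 0) = (1/2) *\<^sub>R (x, y)" if xy: "(x, y) \<in> K" for x y
  proof (rule Peq)
    show "(1/2) *\<^sub>R (x, y) \<in> K" by (rule subspace_scale[OF cK(2) xy])
    fix k assume k: "k \<in> K"
    have "x \<bullet> fst k = y \<bullet> snd k" using pol[OF xy, of "fst k" "snd k"] k by simp
    then show "((x, 0) - (1/2) *\<^sub>R (x, y)) \<bullet> k = 0"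
      by (simp add: inner_prod_def inner_diff_left)
  qed
  have Kv: "E x = x \<and> v x = y" if "(x, y) \<in> K" for x y
    using PE[OF that] by (simp add: E v)
  \<comment> \<open>Pair the residual of \<open>(y, 0)\<close> with \<open>(E x, v x)\<close>. By
    \<open>pol\<close> both components contribute equally, which the factor 2 absorbs; so
    \<open>E\<close> is the initial projection of \<open>v\<close>.\<close>
  have Ev: "(E x) \<bullet> y = v x \<bullet> v y" for x y
  proof -
    have "((y, 0) - P (y, 0)) \<bullet> (E x, v x) = 0" by (rule P0[OF EvK])
    then have "y \<bullet> E x = fst (P (y, 0)) \<bullet> E x + snd (P (y, 0)) \<bullet> v x"
      by (simp add: inner_prod_def inner_diff_left)
    moreover have "(fst (P (y, 0))) \<bullet> E x = snd (P (y, 0)) \<bullet> v x"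
      by (rule pol[OF _ EvK]) (simp add: PK)
    ultimately show ?thesis by (simp add: v[of y] inner_commute)
  qed
  have vvE: "real_adj v o\<^sub>L v = E"
    by (rule blinfun_eq_innerI) (simp add: real_adj_left Ev)
  show thesis
  proof (rule that)
    show "is_proj (real_adj v o\<^sub>L v)"
      unfolding vvE
    proof (rule is_projI)
      show "E x \<bullet> y = x \<bullet> E y" for x y using Ev[of x y] Ev[of y x] by (simp add: inner_commute)
      show "E (E x) = E x" for x using Kv[OF EvK] by blast
    qed
    have "real_adj v (v x) = E x" for x by (simp flip: vvE)
    then show "K = op_graph v"
      using Kv EvK by (auto simp: op_graph_def) metis
    show "v \<in> M"
    proof (rule M_I)
      fix s x assume s: "s \<in> N"
      let ?k = "P (x, 0)"
      have k: "(fst ?k, snd ?k) \<in> K" by (simp add: PK)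
      \<comment> \<open>\<open>K\<close> is invariant under \<open>s\<close> and under its adjoint,
        acting on both components, so \<open>P\<close> commutes with this action.\<close>
      have "P (s x, 0) = (s (fst ?k), s (snd ?k))"
      proof (rule Peq)
        show "(s (fst ?k), s (snd ?k)) \<in> K" by (rule inv[OF s k])
        fix y assume "y \<in> K"
        then have "(real_adj s (fst y), real_adj s (snd y)) \<in> K" using inv[OF adj_N[OF s]] by simp
        from P0[OF this, of "(x, 0)"]
        show "((s x, 0) - (s (fst ?k), s (snd ?k))) \<bullet> y = 0"
          by (simp add: inner_prod_def inner_diff_left real_adj_right blinfun.diff_right
              blinfun.minus_right)
      qed
      then show "v (s x) = s (v x)" by (simp add: v blinfun.scaleR_right)
    qed
  qed
qed

lemma op_graph_iso_subspace:
  assumes v: "v \<in> M" "is_proj (real_adj v o\<^sub>L v)"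
  shows "op_graph v \<in> iso_subspaces"
proof -
  have "closed (op_graph v)"
    unfolding op_graph_def case_prod_beta
    by (intro closed_Collect_conj closed_Collect_eq continuous_intros blinfun.continuous_on)
  moreover have "subspace (op_graph v)"
    by (auto simp: op_graph_def subspace_def blinfun.add_right blinfun.scaleR_right zero_prod_def)
  moreover have "norm (fst k) = norm (snd k)" if "k \<in> op_graph v" for k
  proof -
    have "real_adj v (v (fst k)) \<bullet> fst k = v (fst k) \<bullet> v (fst k)" by (rule real_adj_left)
    then show ?thesis using that by (auto simp: op_graph_def norm_eq_sqrt_inner)
  qed
  moreover have "(s x, s y) \<in> op_graph v" if "s \<in> N" "(x, y) \<in> op_graph v"
    for s :: "'h \<Rightarrow>\<^sub>L 'h" and x y
    using that MN_commute[OF v(1) that(1)] MN_commute[OF adj_M[OF v(1)] that(1)]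
    by (auto simp: op_graph_def)
  ultimately show ?thesis by (rule iso_subspacesI)
qed

lemma closure_Union_chain_iso_subspace:
  assumes ne: "C \<noteq> {}" and sub: "C \<subseteq> iso_subspaces"
    and chain: "\<And>K L. K \<in> C \<Longrightarrow> L \<in> C \<Longrightarrow> K \<subseteq> L \<or> L \<subseteq> K"
  shows "closure (\<Union>C) \<in> iso_subspaces"
proof -
  have "subspace (closure (\<Union>C))"
  proof (rule closure_Union_chain_subspace[OF ne _ chain])
    show "subspace K" if "K \<in> C" for K using subsetD[OF sub that] by (simp add: iso_subspaces_def)
  qed
  moreover have "norm (fst k) = norm (snd k)" if "k \<in> closure (\<Union>C)" for k
  proof -
    have "closed {k :: 'h \<times> 'h. norm (fst k) = norm (snd k)}"
      by (intro closed_Collect_eq continuous_intros)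
    moreover have "\<Union>C \<subseteq> {k. norm (fst k) = norm (snd k)}"
      using sub by (auto simp: iso_subspaces_def)
    ultimately have "closure (\<Union>C) \<subseteq> {k. norm (fst k) = norm (snd k)}"
      by (intro closure_minimal)
    from subsetD[OF this that] show ?thesis by simp
  qed
  moreover have "(s x, s y) \<in> closure (\<Union>C)" if s: "s \<in> N" and xy: "(x, y) \<in> closure (\<Union>C)"
    for s :: "'h \<Rightarrow>\<^sub>L 'h" and x y
  proof -
    have "closed ((\<lambda>k. (s (fst k), s (snd k))) -` closure (\<Union>C))"
      by (intro closed_vimage continuous_intros closed_closure blinfun.continuous_on)
    moreover have "\<Union>C \<subseteq> (\<lambda>k. (s (fst k), s (snd k))) -` closure (\<Union>C)"
    proof
      fix k assume "k \<in> \<Union>C"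
      then obtain K where K: "K \<in> C" "(fst k, snd k) \<in> K" by auto
      then have "(s (fst k), s (snd k)) \<in> K" using sub s unfolding iso_subspaces_def by blast
      then have "(s (fst k), s (snd k)) \<in> closure (\<Union>C)"
        by (rule subsetD[OF closure_subset UnionI[OF K(1)]])
      then show "k \<in> (\<lambda>k. (s (fst k), s (snd k))) -` closure (\<Union>C)" by (rule vimageI2)
    qed
    ultimately have "closure (\<Union>C) \<subseteq> (\<lambda>k. (s (fst k), s (snd k))) -` closure (\<Union>C)"
      by (intro closure_minimal)
    then have "(x, y) \<in> (\<lambda>k. (s (fst k), s (snd k))) -` closure (\<Union>C)" using xy by (rule subsetD)
    then show ?thesis by simp
  qed
  ultimately show ?thesis by (intro iso_subspacesI closed_closure)
qed

text \<open>Zorn's lemma on graphs with domain below \<open>p\<close> and values below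
  \<open>q\<close>. A nonzero element of the corner between the two remainders would, by
  \<open>partial_isometry_exists\<close>, yield a partial isometry \<open>u\<close> from a part of
  one remainder into the other, and \<open>v + u\<close> would properly extend
  \<open>v\<close>.\<close>

lemma maximal_partial_isometry:
  assumes p: "p \<in> M" "is_proj p" and q: "q \<in> M" "is_proj q"
  obtains v where "v \<in> M" "is_proj (real_adj v o\<^sub>L v)"
    "\<And>x. p (real_adj v x) = real_adj v x" "\<And>x. q (v x) = v x"
    "\<And>m. m \<in> M \<Longrightarrow> (q - (v o\<^sub>L real_adj v)) o\<^sub>L m o\<^sub>L (p - (real_adj v o\<^sub>L v)) = 0"
proof -
  define A where "A = {K \<in> iso_subspaces. \<forall>x y. (x, y) \<in> K \<longrightarrow> p x = x \<and> q y = y}"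
  have "\<exists>U\<in>A. \<forall>X\<in>C. X \<subseteq> U" if C: "subset.chain A C" for C
  proof (cases "C = {}")
    case True
    have "{0} \<in> iso_subspaces"
      by (rule iso_subspacesI) (auto simp: prod_eq_iff)
    then have "{0} \<in> A" unfolding A_def by (simp add: prod_eq_iff)
    then show ?thesis by (rule bexI[rotated]) (simp add: True)
  next
    case False
    have CA: "C \<subseteq> A" and ch: "\<And>K L. K \<in> C \<Longrightarrow> L \<in> C \<Longrightarrow> K \<subseteq> L \<or> L \<subseteq> K"
      using C unfolding subset_chain_def by blast+
    have "closure (\<Union>C) \<in> iso_subspaces"
      by (rule closure_Union_chain_iso_subspace[OF False _ ch]) (use CA A_def in blast)+
    moreover have "closure (\<Union>C) \<subseteq> {k. p (fst k) = fst k \<and> q (snd k) = snd k}"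
    proof (rule closure_minimal)
      show "closed {k. p (fst k) = fst k \<and> q (snd k) = snd k}"
        by (intro closed_Collect_conj closed_Collect_eq continuous_intros blinfun.continuous_on)
      show "\<Union>C \<subseteq> {k. p (fst k) = fst k \<and> q (snd k) = snd k}"
      proof
        fix k assume "k \<in> \<Union>C"
        then obtain K where "K \<in> A" "(fst k, snd k) \<in> K" using CA by auto
        then show "k \<in> {k. p (fst k) = fst k \<and> q (snd k) = snd k}" unfolding A_def by blast
      qed
    qed
    ultimately have "closure (\<Union>C) \<in> A" unfolding A_def by auto
    then show ?thesis by (rule bexI[rotated]) (use closure_subset[of "\<Union>C"] in blast)
  qed
  then have "\<exists>K\<in>A. \<forall>X\<in>A. K \<subseteq> X \<longrightarrow> X = K" by (rule subset_Zorn)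
  then obtain K where K: "K \<in> A" "\<And>X. X \<in> A \<Longrightarrow> K \<subseteq> X \<Longrightarrow> X = K" by auto
  from K(1) have "K \<in> iso_subspaces" by (simp add: A_def)
  then obtain v where v: "v \<in> M" "is_proj (real_adj v o\<^sub>L v)" and Kv: "K = op_graph v"
    by (rule iso_subspace_graph)
  have pv: "p (real_adj v x) = real_adj v x" for x
  proof -
    have "(real_adj v x, v (real_adj v x)) \<in> K"
      unfolding Kv op_graph_def using partial_isometry_final(2)[OF v(2)] by simp
    then show ?thesis using K(1) unfolding A_def by blast
  qed
  have qv: "q (v x) = v x" for x
  proof -
    have "(real_adj v (v x), v x) \<in> K"
      unfolding Kv op_graph_def using partial_isometry_final(2)[OF v(2)]
        partial_isometry_initial[OF v(2)] by simp
    then show ?thesis using K(1) unfolding A_def by blast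
  qed
  have vp: "v (p x) = v x" for x
    by (rule vector_eq_rdot[THEN iffD1], rule allI) (metis is_proj_inner p(2) pv real_adj_left real_adj_right)
  have vq: "real_adj v (q x) = real_adj v x" for x
    by (rule vector_eq_rdot[THEN iffD1], rule allI) (metis is_proj_inner q(2) qv real_adj_left)
  note vi = partial_isometry_initial[OF v(2)] and vf = partial_isometry_final(2)[OF v(2)]
  define p1 where "p1 = p - (real_adj v o\<^sub>L v)"
  define q1 where "q1 = q - (v o\<^sub>L real_adj v)"
  have p1x: "p1 x = p x - real_adj v (v x)" and q1x: "q1 x = q x - v (real_adj v x)" for x
    by (simp_all add: p1_def q1_def blinfun.diff_left)
  have M1: "p1 \<in> M" "q1 \<in> M" unfolding p1_def q1_def by (intro M_intros p q v)+
  show thesis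
  proof (rule that[OF v pv qv])
    fix m assume m: "m \<in> M"
    show "(q - (v o\<^sub>L real_adj v)) o\<^sub>L m o\<^sub>L (p - (real_adj v o\<^sub>L v)) = 0"
    proof (rule ccontr)
      define a where "a = q1 o\<^sub>L m o\<^sub>L p1"
      assume "\<not> ?thesis"
      then have "a \<noteq> 0" by (simp add: a_def p1_def q1_def)
      moreover have "a \<in> M" unfolding a_def by (intro M_intros M1 m)
      ultimately obtain u w E where u: "u \<in> M" "is_proj E" "E \<noteq> 0" "real_adj u o\<^sub>L u = E"
        "u = a o\<^sub>L w" "\<And>x. blinfun_apply a x = 0 \<Longrightarrow> blinfun_apply E x = 0"
        using partial_isometry_exists by metis
      have uE: "real_adj u (u x) = E x" for x using compose_eqD[of "real_adj u" u E id_blinfun x] u(4)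
        by (metis blinfun_apply_blinfun_compose)
      have uuu: "u (E x) = u x" for x
        using partial_isometry_initial[of u x] u(2,4) by (simp add: uE)
      have q1q: "q (q1 x) = q1 x" "v (real_adj v (q1 x)) = 0" for x
        by (simp_all add: q1x blinfun.diff_right is_proj_idem[OF q(2)] qv vq vf)
      have qu: "q (u x) = u x" and vu0: "v (real_adj v (u x)) = 0" for x
        by (simp_all add: u(5) a_def q1q)
      have vu: "real_adj v (u x) = 0" for x using vf[of "u x"] vu0[of x] by simp
      \<comment> \<open>\<open>a\<close> vanishes on the range of \<open>1 - p1\<close>, hence so
        does \<open>E\<close>: the initial projection of \<open>u\<close> lies below the remainder
        \<open>p1\<close>.\<close>
      have Ep: "E (p1 x) = E x" for x
      proof -
        have "p1 (p1 x) = p1 x" by (simp add: p1x blinfun.diff_right is_proj_idem[OF p(2)] pv vp vi)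
        then have "E (x - p1 x) = 0" by (intro u(6)) (simp add: a_def blinfun.diff_right)
        then show ?thesis by (simp add: blinfun.diff_right)
      qed
      have "p1 (E x) = E x" for x
      proof (rule vector_eq_rdot[THEN iffD1], rule allI)
        fix y
        have "p1 (E x) \<bullet> y = E x \<bullet> p1 y"
          using is_proj_inner[OF p(2)] by (simp add: p1x inner_diff_left inner_diff_right real_adj_left real_adj_right)
        also have "\<dots> = E x \<bullet> y" using is_proj_inner[OF u(2)] by (simp add: Ep)
        finally show "p1 (E x) \<bullet> y = E x \<bullet> y" .
      qed
      then have pE: "p (E x) = E x" and vE: "v (E x) = 0" for x
      proof -
        assume *: "\<And>x. p1 (E x) = E x"
        have p1': "p (p1 x) = p1 x" "v (p1 x) = 0" for x
          by (simp_all add: p1x blinfun.diff_right is_proj_idem[OF p(2)] pv vp vi)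
        show "p (E x) = E x" "v (E x) = 0" using p1'[of "E x"] by (simp_all add: *)
      qed
      have uv: "real_adj u (v x) = 0" for x
        by (rule vector_eq_rdot[THEN iffD1], rule allI) (metis inner_zero_left inner_zero_right real_adj_left real_adj_right vu)
      have Ev: "E (real_adj v x) = 0" for x
        by (rule vector_eq_rdot[THEN iffD1], rule allI)
          (metis inner_zero_left inner_zero_right is_proj_inner real_adj_left u(2) vE)
      define v' where "v' = v + u"
      have v'x: "v' x = v x + u x" for x by (simp add: v'_def blinfun.add_left)
      have adj': "real_adj v' x = real_adj v x + real_adj u x" for x
        by (simp add: v'_def real_adj_add blinfun.add_left)
      have v'v': "real_adj v' (v' x) = real_adj v (v x) + E x" for x
        by (simp add: adj' v'x blinfun.add_right vu uv uE)
      have pi': "is_proj (real_adj v' o\<^sub>L v')"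
      proof (rule is_projI)
        show "(real_adj v' o\<^sub>L v') x \<bullet> y = x \<bullet> (real_adj v' o\<^sub>L v') y" for x y
          by (simp add: real_adj_left real_adj_right)
        show "(real_adj v' o\<^sub>L v') ((real_adj v' o\<^sub>L v') x) = (real_adj v' o\<^sub>L v') x" for x
          by (simp add: v'v' blinfun.add_right vi vE Ev is_proj_idem[OF u(2)])
      qed
      have "op_graph v' \<in> iso_subspaces"
        by (rule op_graph_iso_subspace[OF _ pi']) (unfold v'_def, rule add_M[OF v(1) u(1)])
      moreover have "p x = x \<and> q y = y" if "(x, y) \<in> op_graph v'" for x y
      proof -
        have xy: "real_adj v (v x) + E x = x" "y = v x + u x"
          using that v'v'[of x] v'x[of x] by (simp_all add: op_graph_def)
        have "p (real_adj v (v x) + E x) = real_adj v (v x) + E x"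
          by (simp only: blinfun.add_right pv pE)
        then show ?thesis unfolding xy(1) by (simp add: xy(2) blinfun.add_right qv qu)
      qed
      ultimately have "op_graph v' \<in> A" unfolding A_def by blast
      moreover have "K \<subseteq> op_graph v'"
      proof
        fix k assume "k \<in> K"
        then obtain x where k: "k = (x, v x)" "real_adj v (v x) = x" by (auto simp: Kv op_graph_def)
        then have "E x = 0" using Ev[of "v x"] by simp
        then have "u x = 0" using uuu[of x] by simp
        then show "k \<in> op_graph v'" using k \<open>E x = 0\<close> v'v'[of x] v'x[of x] by (simp add: op_graph_def)
      qed
      ultimately have eq: "op_graph v' = K" by (rule K(2))
      \<comment> \<open>\<open>E x\<close> lies in the initial space of \<open>v'\<close> but is
        annihilated by \<open>v\<close>, so the graphs cannot agree.\<close>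
      obtain x where x: "E x \<noteq> 0" by (rule blinfun_nonzero[OF u(3)])
      have "(E x, v' (E x)) \<in> op_graph v'"
        by (simp add: op_graph_def v'v' vE is_proj_idem[OF u(2)])
      then have "(E x, v' (E x)) \<in> op_graph v" by (simp only: eq Kv)
      then have "real_adj v (v (E x)) = E x" by (simp add: op_graph_def)
      then show False using x by (simp add: vE)
    qed
  qed
qed

text \<open>Let \<open>p1\<close> and \<open>q1\<close> be the remainders left by a maximal
  \<open>v\<close>. The vectors \<open>y\<close> with \<open>q1 (m y) = 0\<close> for all
  \<open>m\<close> in \<open>M\<close> form a subspace invariant under \<open>M\<close> and
  \<open>N\<close>, so its projection \<open>z\<close> is central. It fixes the range of
  \<open>p1\<close> and kills that of \<open>q1\<close>: on \<open>z\<close> all of \<open>q\<close>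
  is used up, off \<open>z\<close> all of \<open>p\<close>.\<close>

lemma comparison:
  assumes p: "p \<in> M" "is_proj p" and q: "q \<in> M" "is_proj q"
  obtains v z where "v \<in> M" "is_proj (real_adj v o\<^sub>L v)" "z \<in> M" "z \<in> N" "is_proj z"
    "\<And>x. p (real_adj v x) = real_adj v x" "\<And>x. q (v x) = v x"
    "\<And>x. z (q x) = z (v (real_adj v x))" "\<And>x. p x - z (p x) = real_adj v (v x) - z (real_adj v (v x))"
proof -
  obtain v where v: "v \<in> M" "is_proj (real_adj v o\<^sub>L v)"
    "\<And>x. p (real_adj v x) = real_adj v x" "\<And>x. q (v x) = v x"
    "\<And>m. m \<in> M \<Longrightarrow> (q - (v o\<^sub>L real_adj v)) o\<^sub>L m o\<^sub>L (p - (real_adj v o\<^sub>L v)) = 0"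
    using maximal_partial_isometry[OF p q] by metis
  define p1 where "p1 = p - (real_adj v o\<^sub>L v)"
  define q1 where "q1 = q - (v o\<^sub>L real_adj v)"
  have q1M: "q1 \<in> M" unfolding q1_def by (intro M_intros q v)
  have v5: "q1 (m (p1 x)) = 0" if "m \<in> M" for m x
    using v(5)[OF that] by (metis blinfun_apply_blinfun_compose p1_def q1_def zero_blinfun.rep_eq)
  define K where "K = (\<Inter>m\<in>M. {y. q1 (blinfun_apply m y) = 0})"
  have K: "closed K" "subspace K"
    unfolding K_def
    by (intro closed_INT ballI closed_Collect_eq continuous_intros blinfun.continuous_on)
      (auto simp: subspace_def blinfun.add_right blinfun.scaleR_right)
  define z where "z = ortho_proj K"
  have zM: "z \<in> M" unfolding z_def
    by (rule ortho_proj_M[OF K]) (use MN_commute q1M in \<open>simp add: K_def\<close>)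
  have zN: "z \<in> N" unfolding z_def
  proof (rule ortho_proj_N[OF K])
    fix s x assume "s \<in> M" "x \<in> K"
    then show "blinfun_apply s x \<in> K" unfolding K_def using compose_M by fastforce
  qed
  have zp: "is_proj z" unfolding z_def by (rule is_proj_ortho_proj[OF K])
  have zp1: "z (p1 x) = p1 x" for x
    unfolding z_def ortho_proj_fixed_iff[OF K] by (simp add: K_def v5)
  have "q1 (z x) = 0" for x
  proof -
    have "z x \<in> K" unfolding z_def by (rule ortho_proj_in[OF K])
    then have "q1 (id_blinfun (z x)) = 0" unfolding K_def using id_M by blast
    then show ?thesis by simp
  qed
  then have zq1: "z (q1 x) = 0" for x using MN_commute[OF q1M zN] by simp
  show thesis
  proof (rule that[OF v(1,2) zM zN zp v(3,4)])
    show "z (q x) = z (v (real_adj v x))" for x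
      using zq1[of x] by (simp add: q1_def blinfun.diff_left blinfun.diff_right)
    show "p x - z (p x) = real_adj v (v x) - z (real_adj v (v x))" for x
      using zp1[of x] by (simp add: p1_def blinfun.diff_left blinfun.diff_right algebra_simps)
  qed
qed

end

subsection \<open>Comparison of positive functionals\<close>

lemma ortho_proj_eq_is_proj:
  fixes p :: "'h :: {real_inner, banach} \<Rightarrow>\<^sub>L 'h"
  assumes p: "is_proj p"
  shows "closed {x. p x = x}" "subspace {x. p x = x}" "ortho_proj {x. p x = x} = p"
proof -
  show K: "closed {x. p x = x}" "subspace {x. p x = x}"
    by (auto simp: subspace_def blinfun.add_right blinfun.scaleR_right
        intro!: closed_Collect_eq continuous_intros blinfun.continuous_on)
  show "ortho_proj {x. p x = x} = p"
    by (rule is_proj_eqI[OF is_proj_ortho_proj[OF K] p]) (simp add: ortho_proj_fixed_iff[OF K])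
qed

lemma is_proj_diff:
  fixes p q :: "'h :: {real_inner, banach} \<Rightarrow>\<^sub>L 'h"
  assumes p: "is_proj p" and q: "is_proj q" and pq: "\<And>x. p (q x) = q x"
  shows "q (p x) = q x" "is_proj (p - q)"
proof -
  show qp: "q (p x) = q x" for x
    by (rule vector_eq_rdot[THEN iffD1], rule allI)
      (simp only: is_proj_inner[OF q] is_proj_inner[OF p] pq)
  show "is_proj (p - q)"
    by (rule is_projI)
      (simp_all add: blinfun.diff_left blinfun.diff_right inner_diff_left inner_diff_right qp pq
        is_proj_idem[OF p] is_proj_idem[OF q] is_proj_inner[OF p] is_proj_inner[OF q])
qed

lemma is_proj_add:
  fixes p q :: "'h :: {real_inner, banach} \<Rightarrow>\<^sub>L 'h"
  assumes p: "is_proj p" and q: "is_proj q" and pq: "\<And>x. p (q x) = 0"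
  shows "q (p x) = 0" "is_proj (p + q)"
proof -
  show qp: "q (p x) = 0" for x
    by (rule vector_eq_rdot[THEN iffD1], rule allI)
      (simp only: is_proj_inner[OF q] is_proj_inner[OF p] pq inner_zero_left inner_zero_right)
  show "is_proj (p + q)"
    by (rule is_projI)
      (simp_all add: blinfun.add_left blinfun.add_right inner_add_left inner_add_right qp pq
        is_proj_idem[OF p] is_proj_idem[OF q] is_proj_inner[OF p] is_proj_inner[OF q])
qed

lemma is_proj_adj: "is_proj p \<Longrightarrow> real_adj p = p"
  by (simp add: is_proj_def flip: self_adj_iff)

lemma psd_proj_sandwich:
  "psd a \<Longrightarrow> is_proj e \<Longrightarrow> psd (e o\<^sub>L a o\<^sub>L e)"
  using psd_sandwich[of a e] by (simp add: is_proj_adj)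

text \<open>On the kernel of \<open>e\<close> the form of \<open>b\<close> is squeezed to 0, and a
  positive operator kills every vector at which its form vanishes.\<close>

lemma psd_support:
  fixes b e :: "'h :: {real_inner, banach} \<Rightarrow>\<^sub>L 'h"
  assumes b: "psd b" and e: "is_proj e" and be: "psd (e - b)"
  shows "b (e x) = b x" "e (b x) = b x"
proof -
  show *: "b (e x) = b x" for x
  proof -
    have ey: "e (x - e x) = 0" by (simp add: blinfun.diff_right is_proj_idem[OF e])
    have "b (x - e x) \<bullet> (x - e x) = 0"
      using psd_nonneg[OF be, of "x - e x"] psd_nonneg[OF b, of "x - e x"]
      by (simp only: blinfun.diff_left ey inner_diff_left inner_zero_left)
    then have "b (x - e x) = 0" by (rule psd_eq_0[OF b])
    then show ?thesis by (simp add: blinfun.diff_right)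
  qed
  show "e (b x) = b x"
    by (rule vector_eq_rdot[THEN iffD1], rule allI)
      (simp only: is_proj_inner[OF e] self_adjD[OF psd_self_adj[OF b]] *)
qed

text \<open>Strong convergence of the projections along a chain, for finitely many vectors. Asking
  for the bound at all \<open>L\<close> above \<open>K\<close> lets the choices for different
  vectors be merged in the induction.\<close>

lemma ortho_proj_chain_approx:
  fixes C :: "'h :: {real_inner, banach} set set"
  assumes ne: "C \<noteq> {}" and sub: "\<And>K. K \<in> C \<Longrightarrow> closed K \<and> subspace K"
    and chain: "\<And>K L. K \<in> C \<Longrightarrow> L \<in> C \<Longrightarrow> K \<subseteq> L \<or> L \<subseteq> K" and d: "0 < d"
  shows "\<exists>K\<in>C. \<forall>L\<in>C. K \<subseteq> L \<longrightarrow>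
    (\<forall>y\<in>set ys. norm (ortho_proj (closure (\<Union>C)) y - ortho_proj L y) < d)"
proof (induction ys)
  case Nil
  then show ?case using ne by auto
next
  case (Cons y ys)
  then obtain K where K: "K \<in> C" "\<And>L y. L \<in> C \<Longrightarrow> K \<subseteq> L \<Longrightarrow> y \<in> set ys \<Longrightarrow>
      norm (ortho_proj (closure (\<Union>C)) y - ortho_proj L y) < d" by blast
  have U: "closed (closure (\<Union>C))" "subspace (closure (\<Union>C))"
    using closure_Union_chain_subspace[OF ne _ chain] sub by auto
  let ?q = "ortho_proj (closure (\<Union>C))"
  have "?q y \<in> closure (\<Union>C)" by (rule ortho_proj_in[OF U])
  then obtain w where w: "w \<in> \<Union>C" "dist w (?q y) < d"
    using d unfolding closure_approachable by blast
  then obtain K' where K': "K' \<in> C" "w \<in> K'" by auto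
  \<comment> \<open>\<open>w\<close> is a point of \<open>K'\<close> close to \<open>?q y\<close>.
    For \<open>L\<close> above \<open>K'\<close>, \<open>ortho_proj L y\<close> is the point of
    \<open>L\<close> nearest to \<open>?q y\<close>, so at least as close as
    \<open>w\<close>.\<close>
  have best: "norm (?q y - ortho_proj L y) < d" if L: "L \<in> C" "K' \<subseteq> L" for L
  proof -
    have cL: "closed L" "subspace L" using sub[OF L(1)] by auto
    have LU: "L \<subseteq> closure (\<Union>C)"
      by (rule order_trans[OF Union_upper[OF L(1)] closure_subset])
    have yL: "ortho_proj L y = ortho_proj L (?q y)"
    proof (rule ortho_proj_eqI[OF cL ortho_proj_in[OF cL]])
      fix u assume u: "u \<in> L"
      have "(y - ?q y) \<bullet> u = 0" by (rule ortho_proj_orthogonal[OF U]) (use u LU in auto)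
      moreover have "(?q y - ortho_proj L (?q y)) \<bullet> u = 0"
        by (rule ortho_proj_orthogonal[OF cL u])
      ultimately show "(y - ortho_proj L (?q y)) \<bullet> u = 0" by (simp add: inner_diff_left)
    qed
    have "ortho_proj L w = w" using ortho_proj_fixed_iff[OF cL] K' L by auto
    then have eq: "?q y - w - ortho_proj L (?q y - w) = ?q y - ortho_proj L (?q y)"
      by (simp add: blinfun.diff_right)
    have "(norm (?q y - ortho_proj L (?q y)))\<^sup>2 \<le> (norm (?q y - w))\<^sup>2"
      using is_proj_pythagoras[OF is_proj_ortho_proj[OF cL], of "?q y - w"] unfolding eq by simp
    then have "norm (?q y - ortho_proj L (?q y)) \<le> norm (?q y - w)"
      by (rule power2_le_imp_le) simp
    also have "\<dots> < d" using w(2) by (simp add: dist_norm norm_minus_commute)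
    finally show ?thesis by (simp only: yL)
  qed
  show ?case
  proof (cases "K \<subseteq> K'")
    case True
    then show ?thesis using K best K'(1) by (intro bexI[of _ K']) auto
  next
    case False
    then have "K' \<subseteq> K" using chain[OF K(1) K'(1)] by blast
    then show ?thesis using K best by (intro bexI[of _ K]) auto
  qed
qed

section \<open>Normal functionals and the Zorn argument for projections\<close>

context real_vn_algebra
begin

definition positive_functional :: "(('h \<Rightarrow>\<^sub>L 'h) \<Rightarrow> real) \<Rightarrow> bool" where
  "positive_functional \<phi> \<longleftrightarrow> (\<forall>a\<in>M. \<forall>b\<in>M. \<phi> (a + b) = \<phi> a + \<phi> b) \<and>
     (\<forall>r. \<forall>a\<in>M. \<phi> (r *\<^sub>R a) = r * \<phi> a) \<and> (\<forall>a\<in>M. psd a \<longrightarrow> 0 \<le> \<phi> a)"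

lemma positive_functionalD:
  assumes "positive_functional \<phi>"
  shows "a \<in> M \<Longrightarrow> b \<in> M \<Longrightarrow> \<phi> (a + b) = \<phi> a + \<phi> b"
    and "a \<in> M \<Longrightarrow> \<phi> (r *\<^sub>R a) = r * \<phi> a"
    and "a \<in> M \<Longrightarrow> psd a \<Longrightarrow> 0 \<le> \<phi> a"
    and "a \<in> M \<Longrightarrow> b \<in> M \<Longrightarrow> \<phi> (a - b) = \<phi> a - \<phi> b"
    and "\<phi> 0 = 0"
    and "a \<in> M \<Longrightarrow> b \<in> M \<Longrightarrow> psd (b - a) \<Longrightarrow> \<phi> a \<le> \<phi> b"
proof -
  show add: "\<phi> (a + b) = \<phi> a + \<phi> b" if "a \<in> M" "b \<in> M" for a b
    using assms that unfolding positive_functional_def by blast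
  show sc: "\<phi> (r *\<^sub>R a) = r * \<phi> a" if "a \<in> M" for r a
    using assms that unfolding positive_functional_def by blast
  show pos: "0 \<le> \<phi> a" if "a \<in> M" "psd a" for a
    using assms that unfolding positive_functional_def by blast
  show diff: "\<phi> (a - b) = \<phi> a - \<phi> b" if "a \<in> M" "b \<in> M" for a b
    using add[OF that(1) scaleR_M[OF that(2), of "-1"]] sc[OF that(2), of "-1"] by simp
  show "\<phi> 0 = 0" using sc[OF zero_M, of 0] by simp
  show "\<phi> a \<le> \<phi> b" if "a \<in> M" "b \<in> M" "psd (b - a)"
    using pos[OF diff_M[OF that(2,1)] that(3)] diff[OF that(2,1)] by simp
qed

text \<open>A quantitative form of normality. Applied to the projection by which a chain member
  falls short of the limit, it gives continuity along chains, in
  \<open>normal_functional_chain\<close>.\<close>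

definition normal_functional :: "(('h \<Rightarrow>\<^sub>L 'h) \<Rightarrow> real) \<Rightarrow> bool" where
  "normal_functional \<phi> \<longleftrightarrow> positive_functional \<phi> \<and>
     (\<forall>e>0. \<exists>ys. \<forall>a\<in>M. psd a \<longrightarrow> \<phi> a \<le> (\<Sum>y\<leftarrow>ys. a y \<bullet> y) + e * norm a)"

text \<open>The ranges of the projections in \<open>M\<close>; as sets they are ordered by inclusion
  and can be joined along chains.\<close>

definition inv_subspaces :: "'h set set" where
  "inv_subspaces = {K. closed K \<and> subspace K \<and> (\<forall>s\<in>N. \<forall>x\<in>K. blinfun_apply s x \<in> K)}"

lemma inv_subspace_proj:
  assumes "K \<in> inv_subspaces"
  shows "closed K" "subspace K" "ortho_proj K \<in> M" "is_proj (ortho_proj K)"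
  using assms ortho_proj_M is_proj_ortho_proj unfolding inv_subspaces_def by auto

lemma closure_Union_chain_inv_subspace:
  assumes ne: "C \<noteq> {}" and sub: "C \<subseteq> inv_subspaces"
    and chain: "\<And>K L. K \<in> C \<Longrightarrow> L \<in> C \<Longrightarrow> K \<subseteq> L \<or> L \<subseteq> K"
  shows "closure (\<Union>C) \<in> inv_subspaces"
proof -
  have "subspace (closure (\<Union>C))"
  proof (rule closure_Union_chain_subspace[OF ne _ chain])
    show "subspace K" if "K \<in> C" for K using subsetD[OF sub that] by (simp add: inv_subspaces_def)
  qed
  moreover have "s x \<in> closure (\<Union>C)" if s: "s \<in> N" and x: "x \<in> closure (\<Union>C)"
    for s :: "'h \<Rightarrow>\<^sub>L 'h" and x
  proof -
    have "closed (blinfun_apply s -` closure (\<Union>C))"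
      by (intro closed_vimage continuous_intros closed_closure blinfun.continuous_on)
    moreover have "\<Union>C \<subseteq> blinfun_apply s -` closure (\<Union>C)"
    proof
      fix k assume "k \<in> \<Union>C"
      then obtain K where K: "K \<in> C" "k \<in> K" by auto
      then have "s k \<in> K" using sub s unfolding inv_subspaces_def by blast
      then have "s k \<in> closure (\<Union>C)" by (rule subsetD[OF closure_subset UnionI[OF K(1)]])
      then show "k \<in> blinfun_apply s -` closure (\<Union>C)" by (rule vimageI2)
    qed
    ultimately have "closure (\<Union>C) \<subseteq> blinfun_apply s -` closure (\<Union>C)"
      by (intro closure_minimal)
    from subsetD[OF this x] show ?thesis by simp
  qed
  ultimately show ?thesis unfolding inv_subspaces_def by (simp del: Union_iff)
qed

lemma normal_functional_chain:
  assumes \<phi>: "normal_functional \<phi>" and ne: "C \<noteq> {}" and sub: "C \<subseteq> inv_subspaces"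
    and chain: "\<And>K L. K \<in> C \<Longrightarrow> L \<in> C \<Longrightarrow> K \<subseteq> L \<or> L \<subseteq> K" and e: "0 < e"
  obtains K where "K \<in> C" "\<phi> (ortho_proj (closure (\<Union>C))) \<le> \<phi> (ortho_proj K) + e"
proof -
  note \<phi>p = \<phi>[unfolded normal_functional_def, THEN conjunct1]
  obtain ys where ys: "\<And>a. a \<in> M \<Longrightarrow> psd a \<Longrightarrow> \<phi> a \<le> (\<Sum>y\<leftarrow>ys. a y \<bullet> y) + (e/2) * norm a"
    using \<phi> half_gt_zero[OF e] unfolding normal_functional_def by blast
  \<comment> \<open>Makes \<open>length ys\<close> terms of size \<open>d\<^sup>2\<close> sum to at
    most \<open>e / 2\<close>; the \<open>+ 1\<close> covers the empty list. The other half of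
    \<open>e\<close> is the error term, as \<open>?a\<close> has norm at most 1.\<close>
  define d where "d = sqrt (e / (2 * (real (length ys) + 1)))"
  have d: "0 < d" using e by (simp add: d_def)
  have d2: "real (length ys) * d\<^sup>2 \<le> e / 2"
  proof -
    have "d\<^sup>2 = e / (2 * (real (length ys) + 1))" using e by (simp add: d_def)
    then have "(2 * (real (length ys) + 1)) * d\<^sup>2 = e" by simp
    then have "2 * (real (length ys) * d\<^sup>2) + 2 * d\<^sup>2 = e" by (simp add: algebra_simps)
    then show ?thesis using zero_le_power2[of d] by linarith
  qed
  have "closed K \<and> subspace K" if "K \<in> C" for K
    using subsetD[OF sub that] by (simp add: inv_subspaces_def)
  from ortho_proj_chain_approx[OF ne this chain d, of ys]
  obtain K where K: "K \<in> C"
    "\<And>y. y \<in> set ys \<Longrightarrow> norm (ortho_proj (closure (\<Union>C)) y - ortho_proj K y) < d" by blast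
  let ?U = "closure (\<Union>C)"
  note U = inv_subspace_proj[OF closure_Union_chain_inv_subspace[OF ne sub chain]]
  note Kp = inv_subspace_proj[OF subsetD[OF sub K(1)]]
  have KU: "K \<subseteq> ?U" by (rule order_trans[OF Union_upper[OF K(1)] closure_subset])
  let ?a = "ortho_proj ?U - ortho_proj K"
  have UK: "ortho_proj ?U (ortho_proj K x) = ortho_proj K x" for x
    using ortho_proj_fixed_iff[OF U(1,2)] ortho_proj_in[OF Kp(1,2)] KU by blast
  have a: "is_proj ?a" by (rule is_proj_diff(2)[OF U(4) Kp(4) UK])
  have "\<phi> ?a \<le> (\<Sum>y\<leftarrow>ys. ?a y \<bullet> y) + (e/2) * norm ?a"
    by (rule ys[OF _ psd_is_proj[OF a]]) (intro M_intros U Kp)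
  also have "(\<Sum>y\<leftarrow>ys. ?a y \<bullet> y) \<le> (\<Sum>y\<leftarrow>ys. d\<^sup>2)"
  proof (rule sum_list_mono)
    fix y assume "y \<in> set ys"
    then have "norm (?a y) \<le> d" using K(2) by (simp add: blinfun.diff_left less_imp_le)
    then show "?a y \<bullet> y \<le> d\<^sup>2" unfolding is_proj_inner_self[OF a] by (simp add: power_mono)
  qed
  also have "(\<Sum>y\<leftarrow>ys. d\<^sup>2) \<le> e / 2" using d2 by (simp add: sum_list_triv)
  also have "(e/2) * norm ?a \<le> (e/2) * 1" using e by (intro mult_left_mono is_proj_norm a) simp
  finally have "\<phi> ?a \<le> e" by simp
  then have "\<phi> (ortho_proj ?U) \<le> \<phi> (ortho_proj K) + e"
    using positive_functionalD(4)[OF \<phi>p U(3) Kp(3)] by simp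
  with K(1) show thesis by (rule that)
qed

text \<open>Binary expansion: a positive contraction below \<open>e\<close> is a convergent sum of halved powers times
  projections below \<open>e\<close>.\<close>

lemma positive_on_corner:
  assumes \<phi>: "positive_functional \<phi>" and \<omega>: "positive_functional \<omega>"
    and e: "e \<in> M" "is_proj e"
    and proj: "\<And>p. p \<in> M \<Longrightarrow> is_proj p \<Longrightarrow> (\<And>x. e (p x) = blinfun_apply p x) \<Longrightarrow> \<phi> p \<le> \<omega> p"
    and a: "a \<in> M" "psd a"
  shows "\<phi> (e o\<^sub>L a o\<^sub>L e) \<le> \<omega> (e o\<^sub>L a o\<^sub>L e)"
proof -
  note ph = positive_functionalD[OF \<phi>] and om = positive_functionalD[OF \<omega>]
  \<comment> \<open>Each binary digit \<open>E\<close> satisfies \<open>proj\<close>, so passing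
    from \<open>b\<close> to \<open>2 b - E\<close> at least doubles the excess of
    \<open>\<phi>\<close> over \<open>\<omega>\<close>. Between 0 and \<open>e\<close> that excess
    never exceeds \<open>\<phi> id_blinfun\<close>.\<close>
  have step: "\<phi> b - \<omega> b \<le> \<phi> id_blinfun / 2 ^ n"
    if "b \<in> M" "psd b" "psd (e - b)" for b n
    using that
  proof (induction n arbitrary: b)
    case 0
    have "psd (id_blinfun - b)"
      using psd_add[OF psd_is_proj[OF is_proj_compl[OF e(2)]] 0(3)] by simp
    then have "\<phi> b \<le> \<phi> id_blinfun" using ph(6) 0 by simp
    then show ?case using om(3)[OF 0(1,2)] by simp
  next
    case (Suc n)
    note b = Suc.prems
    have "psd (id_blinfun - b)"
      using psd_add[OF psd_is_proj[OF is_proj_compl[OF e(2)]] b(3)] by simp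
    then obtain E where E: "is_proj E" "\<And>s. s o\<^sub>L b = b o\<^sub>L s \<Longrightarrow> s o\<^sub>L E = E o\<^sub>L s"
      "psd (2 *\<^sub>R b - E)" "psd (id_blinfun - (2 *\<^sub>R b - E))"
      using psd_binary_step[OF b(2)] by blast
    have EM: "E \<in> M" by (rule bicommutant_M[OF b(1) E(2)])
    note be = psd_support[OF b(2) e(2) b(3)]
    \<comment> \<open>\<open>2 b - E\<close> is positive and \<open>b\<close> vanishes on the kernel
      of \<open>e\<close>, so \<open>E\<close> vanishes there too: the digit is again below
      \<open>e\<close>.\<close>
    have Ee: "E (e x) = E x" for x
    proof -
      have "b (x - e x) = 0" by (simp add: blinfun.diff_right be)
      then have "(2 *\<^sub>R b - E) (x - e x) \<bullet> (x - e x) = - (norm (E (x - e x)))\<^sup>2"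
        using is_proj_inner_self[OF E(1), of "x - e x"]
        by (simp add: blinfun.diff_left blinfun.scaleR_left inner_diff_left)
      then have "E (x - e x) = 0" using psd_nonneg[OF E(3), of "x - e x"] by simp
      then show ?thesis by (simp add: blinfun.diff_right)
    qed
    have eE: "e (E x) = E x" for x
      by (rule vector_eq_rdot[THEN iffD1], rule allI)
        (simp only: is_proj_inner[OF e(2)] is_proj_inner[OF E(1)] Ee)
    let ?b = "2 *\<^sub>R b - E"
    have "psd (e - ?b)"
    proof -
      have "e o\<^sub>L (id_blinfun - ?b) o\<^sub>L e = e - ?b"
        by (rule blinfun_eqI) (simp add: blinfun.bilinear_simps be Ee eE is_proj_idem[OF e(2)])
      then show ?thesis using psd_proj_sandwich[OF E(4) e(2)] by simp
    qed
    moreover have bM: "?b \<in> M" by (intro M_intros b EM)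
    ultimately have IH: "\<phi> ?b - \<omega> ?b \<le> \<phi> id_blinfun / 2 ^ n" using Suc.IH E(3) by blast
    have "\<phi> ?b = 2 * \<phi> b - \<phi> E" "\<omega> ?b = 2 * \<omega> b - \<omega> E"
      using ph om b(1) EM by (simp_all add: scaleR_M)
    moreover have "\<phi> E \<le> \<omega> E" by (rule proj[OF EM E(1) eE])
    ultimately have "2 * (\<phi> b - \<omega> b) \<le> \<phi> id_blinfun / 2 ^ n" using IH by simp
    then show ?case by (simp add: field_simps)
  qed
  \<comment> \<open>Scales \<open>e a e\<close> to lie between 0 and \<open>e\<close>; the
    \<open>+ 1\<close> covers \<open>a = 0\<close>.\<close>
  define r where "r = norm a + 1"
  have r: "0 < r" by (simp add: r_def add_nonneg_pos)
  define b where "b = inverse r *\<^sub>R (e o\<^sub>L a o\<^sub>L e)"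
  have bM: "b \<in> M" unfolding b_def by (intro M_intros e a)
  have eae: "e o\<^sub>L a o\<^sub>L e = r *\<^sub>R b" using r by (simp add: b_def)
  have "psd b" unfolding b_def using r by (intro psd_scaleR psd_proj_sandwich a e) simp
  moreover have "psd (e - b)"
  proof -
    have "psd ((norm a *\<^sub>R id_blinfun - a) + id_blinfun)"
      by (intro psd_add psd_norm_minus psd_self_adj a) (simp add: psdI)
    then have "psd (inverse r *\<^sub>R (e o\<^sub>L ((norm a *\<^sub>R id_blinfun - a) + id_blinfun) o\<^sub>L e))"
      using r by (intro psd_scaleR psd_proj_sandwich e) simp_all
    moreover have "inverse r *\<^sub>R (e o\<^sub>L ((norm a *\<^sub>R id_blinfun - a) + id_blinfun) o\<^sub>L e) = e - b"
    proof (rule blinfun_eqI)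
      fix x
      have "(e o\<^sub>L ((norm a *\<^sub>R id_blinfun - a) + id_blinfun) o\<^sub>L e) x = r *\<^sub>R e x - e (a (e x))"
        by (simp add: r_def blinfun.bilinear_simps is_proj_idem[OF e(2)] scaleR_add_left)
      then show "(inverse r *\<^sub>R (e o\<^sub>L ((norm a *\<^sub>R id_blinfun - a) + id_blinfun) o\<^sub>L e)) x = (e - b) x"
        using r by (simp add: b_def blinfun.scaleR_left blinfun.diff_left scaleR_diff_right)
    qed
    ultimately show ?thesis by simp
  qed
  ultimately have "\<phi> b - \<omega> b \<le> \<phi> id_blinfun / 2 ^ n" for n by (intro step bM)
  moreover have "(\<lambda>n. \<phi> id_blinfun / 2 ^ n) \<longlonglongrightarrow> 0"
    by (intro LIMSEQ_divide_realpow_zero) simp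
  ultimately have "\<phi> b - \<omega> b \<le> 0" by (intro LIMSEQ_le_const) auto
  then show ?thesis unfolding eae using ph(2)[OF bM] om(2)[OF bM] r by simp
qed

text \<open>Zorn's lemma gives a largest projection \<open>q \<le> f\<close> with \<open>\<omega> q \<le> \<phi> q\<close>; take \<open>e = f - q\<close>.\<close>

lemma dominating_corner:
  assumes \<phi>: "positive_functional \<phi>" and \<omega>: "normal_functional \<omega>"
    and f: "f \<in> M" "is_proj f" "\<phi> f < \<omega> f"
  obtains e where "e \<in> M" "is_proj e" "e \<noteq> 0" "\<And>x. f (e x) = e x"
    "\<And>a. a \<in> M \<Longrightarrow> psd a \<Longrightarrow> \<phi> (e o\<^sub>L a o\<^sub>L e) \<le> \<omega> (e o\<^sub>L a o\<^sub>L e)"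
proof -
  have \<omega>p: "positive_functional \<omega>" using \<omega> by (simp add: normal_functional_def)
  note ph = positive_functionalD[OF \<phi>] and om = positive_functionalD[OF \<omega>p]
  define A where "A = {K \<in> inv_subspaces. (\<forall>x\<in>K. f x = x) \<and> \<omega> (ortho_proj K) \<le> \<phi> (ortho_proj K)}"
  have "\<exists>U\<in>A. \<forall>X\<in>C. X \<subseteq> U" if C: "subset.chain A C" for C
  proof (cases "C = {}")
    case True
    have "ortho_proj {x. (0 :: 'h \<Rightarrow>\<^sub>L 'h) x = x} = 0" by (rule ortho_proj_eq_is_proj) simp
    moreover have "{x. (0 :: 'h \<Rightarrow>\<^sub>L 'h) x = x} = {0}" by auto
    ultimately have "ortho_proj {0 :: 'h} = 0" by simp
    then have "{0} \<in> A" by (auto simp: A_def inv_subspaces_def ph om)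
    then show ?thesis by (rule bexI[rotated]) (simp add: True)
  next
    case False
    have CA: "C \<subseteq> A" and ch: "\<And>K L. K \<in> C \<Longrightarrow> L \<in> C \<Longrightarrow> K \<subseteq> L \<or> L \<subseteq> K"
      using C unfolding subset_chain_def by blast+
    have Ci: "C \<subseteq> inv_subspaces" using CA unfolding A_def by blast
    let ?U = "closure (\<Union>C)"
    have Ui: "?U \<in> inv_subspaces" by (rule closure_Union_chain_inv_subspace[OF False Ci ch])
    note U = inv_subspace_proj[OF Ui]
    have "?U \<subseteq> {x. f x = x}"
    proof (rule closure_minimal)
      show "closed {x. f x = x}" by (rule ortho_proj_eq_is_proj(1)[OF f(2)])
      show "\<Union>C \<subseteq> {x. f x = x}" using CA unfolding A_def by blast
    qed
    \<comment> \<open>\<open>\<omega>\<close> is continuous along the chain and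
      \<open>\<phi>\<close> is monotone, so the inequality passes to the limit.\<close>
    moreover have "\<omega> (ortho_proj ?U) \<le> \<phi> (ortho_proj ?U)"
    proof (rule field_le_epsilon)
      fix d :: real assume "0 < d"
      then obtain K where K: "K \<in> C" "\<omega> (ortho_proj ?U) \<le> \<omega> (ortho_proj K) + d"
        using normal_functional_chain[OF \<omega> False Ci ch] by blast
      note Kp = inv_subspace_proj[OF subsetD[OF Ci K(1)]]
      have KU: "K \<subseteq> ?U" by (rule order_trans[OF Union_upper[OF K(1)] closure_subset])
      have "ortho_proj ?U (ortho_proj K x) = ortho_proj K x" for x
        using ortho_proj_fixed_iff[OF U(1,2)] ortho_proj_in[OF Kp(1,2)] KU by blast
      then have "psd (ortho_proj ?U - ortho_proj K)"
        by (intro psd_is_proj is_proj_diff(2) U Kp)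
      then have "\<phi> (ortho_proj K) \<le> \<phi> (ortho_proj ?U)" by (intro ph(6) U Kp)
      moreover have "\<omega> (ortho_proj K) \<le> \<phi> (ortho_proj K)" using K(1) CA unfolding A_def by blast
      ultimately show "\<omega> (ortho_proj ?U) \<le> \<phi> (ortho_proj ?U) + d" using K(2) by linarith
    qed
    ultimately have "?U \<in> A" using Ui unfolding A_def by blast
    moreover have "\<forall>X\<in>C. X \<subseteq> ?U"
      by (intro ballI order_trans[OF Union_upper closure_subset])
    ultimately show ?thesis by (rule bexI[rotated])
  qed
  then have "\<exists>K\<in>A. \<forall>X\<in>A. K \<subseteq> X \<longrightarrow> X = K" by (rule subset_Zorn)
  then obtain K where KA: "K \<in> A" and Kmax: "\<And>X. X \<in> A \<Longrightarrow> K \<subseteq> X \<Longrightarrow> X = K" by auto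
  from KA have Ki: "K \<in> inv_subspaces" and Kf: "\<And>x. x \<in> K \<Longrightarrow> f x = x"
    and Kle: "\<omega> (ortho_proj K) \<le> \<phi> (ortho_proj K)" unfolding A_def by auto
  note Kp = inv_subspace_proj[OF Ki]
  define q where "q = ortho_proj K"
  have qM: "q \<in> M" and qp: "is_proj q" unfolding q_def by (fact Kp)+
  have fq: "f (q x) = q x" for x unfolding q_def by (rule Kf[OF ortho_proj_in[OF Kp(1,2)]])
  define e where "e = f - q"
  have eM: "e \<in> M" unfolding e_def by (intro M_intros f qM)
  have ep: "is_proj e" unfolding e_def by (rule is_proj_diff(2)[OF f(2) qp fq])
  have qf: "q (f x) = q x" for x by (rule is_proj_diff(1)[OF f(2) qp fq])
  have fe: "f (e x) = e x" for x
    by (simp add: e_def blinfun.diff_left blinfun.diff_right fq is_proj_idem[OF f(2)])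
  have qe: "q (e x) = 0" for x
    by (simp add: e_def blinfun.diff_left blinfun.diff_right qf is_proj_idem[OF qp])
  \<comment> \<open>The strict inequality at \<open>f\<close> excludes \<open>q = f\<close>.\<close>
  have "e \<noteq> 0" using Kle f(3) unfolding e_def q_def by auto
  moreover have "\<phi> p \<le> \<omega> p" if p: "p \<in> M" "is_proj p" "\<And>x. e (p x) = blinfun_apply p x" for p
  proof (rule ccontr)
    assume "\<not> ?thesis"
    then have lt: "\<omega> p < \<phi> p" by simp
    have qp0: "q (p x) = 0" for x using qe[of "p x"] p(3) by simp
    note pq = is_proj_add[OF qp p(2) qp0]
    \<comment> \<open>A projection \<open>p\<close> below \<open>e\<close> that violates the
      inequality can be added to \<open>q\<close>, against maximality.\<close>
    define K' where "K' = {x. (q + p) x = x}"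
    have K': "closed K'" "subspace K'" "ortho_proj K' = q + p"
      unfolding K'_def by (rule ortho_proj_eq_is_proj[OF pq(2)])+
    have "q + p \<in> M" by (intro M_intros qM p)
    then have "blinfun_apply s x \<in> K'" if "s \<in> N" "x \<in> K'" for s x
      using that by (simp add: K'_def MN_commute[of "q + p"])
    then have "K' \<in> inv_subspaces" unfolding inv_subspaces_def using K'(1,2) by blast
    moreover have "f x = x" if "x \<in> K'" for x
    proof -
      have x: "q x + p x = x" using that by (simp add: K'_def blinfun.add_left)
      have "f (p x) = p x" using fe[of "p x"] p(3) by simp
      then have "f (q x + p x) = q x + p x" by (simp add: blinfun.add_right fq)
      then show ?thesis by (simp only: x)
    qed
    moreover have "\<omega> (ortho_proj K') \<le> \<phi> (ortho_proj K')"
      unfolding K'(3) using ph(1)[OF qM p(1)] om(1)[OF qM p(1)] lt Kle by (simp add: q_def)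
    ultimately have "K' \<in> A" unfolding A_def by blast
    moreover have "K \<subseteq> K'"
    proof
      fix x assume "x \<in> K"
      then have qx: "q x = x" unfolding q_def using ortho_proj_fixed_iff[OF Kp(1,2)] by blast
      moreover have "p x = 0" using pq(1)[of x] unfolding qx .
      ultimately show "x \<in> K'" by (simp add: K'_def blinfun.add_left)
    qed
    ultimately have "K' = K" by (rule Kmax)
    then have "q + p = q" using K'(3) by (simp add: q_def)
    then have "p = 0" by simp
    then show False using lt ph(5) om(5) by simp
  qed
  ultimately show thesis
    using positive_on_corner[OF \<phi> \<omega>p eM ep] by (intro that[OF eM ep _ fe]) blast+
qed

text \<open>\<open>K\<close> is the orthogonal complement of \<open>N x\<close>, and
  \<open>f\<close> projects onto the closed span of \<open>N x\<close>. An \<open>e\<close> in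
  \<open>M\<close> that kills \<open>x\<close> kills \<open>N x\<close>, since it commutes with
  \<open>N\<close>; below \<open>f\<close> nothing of it remains.\<close>

lemma cyclic_support:
  assumes "x \<noteq> 0"
  obtains f where "f \<in> M" "is_proj f" "f x = x"
    "\<And>e. e \<in> M \<Longrightarrow> is_proj e \<Longrightarrow> (\<And>y. f (e y) = e y) \<Longrightarrow> blinfun_apply e x = 0 \<Longrightarrow> e = 0"
proof -
  define K where "K = (\<Inter>s\<in>N. {y. y \<bullet> blinfun_apply s x = 0})"
  have K: "closed K" "subspace K"
    unfolding K_def by (intro closed_INT ballI closed_Collect_eq continuous_intros)
      (auto simp: subspace_def inner_add_left)
  have KM: "ortho_proj K \<in> M"
  proof (rule ortho_proj_M[OF K])
    fix s y assume s: "s \<in> N" and y: "y \<in> K"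
    have "y \<bullet> real_adj s (t x) = 0" if "t \<in> N" for t
    proof -
      have "real_adj s o\<^sub>L t \<in> N" by (intro compose_N adj_N s that)
      with y have "y \<bullet> (real_adj s o\<^sub>L t) x = 0" unfolding K_def by blast
      then show ?thesis by simp
    qed
    then show "blinfun_apply s y \<in> K" by (simp add: K_def real_adj_right)
  qed
  have Kp: "is_proj (ortho_proj K)" by (rule is_proj_ortho_proj[OF K])
  have "ortho_proj K x = 0"
  proof (rule ortho_proj_eqI[OF K subspace_0[OF K(2)]])
    fix y assume "y \<in> K"
    then have "y \<bullet> id_blinfun x = 0" unfolding K_def using id_N by blast
    then show "(x - 0) \<bullet> y = 0" by (simp add: inner_commute)
  qed
  show thesis
  proof (rule that[of "id_blinfun - ortho_proj K"])
    show "id_blinfun - ortho_proj K \<in> M" by (intro M_intros KM)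
    show "is_proj (id_blinfun - ortho_proj K)" by (rule is_proj_compl[OF Kp])
    show "(id_blinfun - ortho_proj K) x = x" using \<open>ortho_proj K x = 0\<close> by (simp add: blinfun.diff_left)
    fix e assume e: "e \<in> M" "is_proj e" "\<And>y. (id_blinfun - ortho_proj K) (e y) = e y"
      "blinfun_apply e x = 0"
    have "e y \<in> K" for y
      unfolding K_def using e(4) by (simp add: is_proj_inner[OF e(2)] MN_commute[OF e(1)])
    then have "ortho_proj K (e y) = e y" for y using ortho_proj_fixed_iff[OF K] by blast
    then show "e = 0" using e(3) by (intro blinfun_eqI) (simp add: blinfun.diff_left)
  qed
qed

end

subsection \<open>Normality of the center-valued trace\<close>

lemma norm_real_adj_apply: "norm (real_adj a x) \<le> norm a * norm x"
proof -
  have "(norm (real_adj a x))\<^sup>2 = x \<bullet> a (real_adj a x)"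
    by (simp add: power2_norm_eq_inner real_adj_left)
  also have "\<dots> \<le> norm x * norm (a (real_adj a x))" by (rule norm_cauchy_schwarz)
  also have "\<dots> \<le> norm x * (norm a * norm (real_adj a x))"
    by (intro mult_left_mono norm_blinfun) simp
  finally show ?thesis
    by (cases "real_adj a x = 0") (simp_all add: power2_eq_square mult_ac)
qed

lemma psd_inner_add_le:
  assumes "psd h"
  shows "h (x + y) \<bullet> (x + y) \<le> 2 * (h x \<bullet> x) + 2 * (h y \<bullet> y)"
  using psd_nonneg[OF assms, of "x - y"]
  by (simp add: blinfun.add_right blinfun.diff_right inner_add_left inner_add_right
      inner_diff_left inner_diff_right)

lemma sum_list_scaleR_inner:
  fixes R :: "'h :: real_inner \<Rightarrow>\<^sub>L 'h"
  shows "(\<Sum>y\<leftarrow>map (\<lambda>y. c *\<^sub>R y) ys. R y \<bullet> y) = c\<^sup>2 * (\<Sum>y\<leftarrow>ys. R y \<bullet> y)"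
  by (induction ys) (simp_all add: blinfun.scaleR_right power2_eq_square algebra_simps)

locale real_center_trace = real_vn_algebra M N for M N :: "('h :: {real_inner, banach} \<Rightarrow>\<^sub>L 'h) set" +
  fixes T :: "('h \<Rightarrow>\<^sub>L 'h) \<Rightarrow> 'h \<Rightarrow>\<^sub>L 'h"
  assumes T_M: "a \<in> M \<Longrightarrow> T a \<in> M" and T_N: "a \<in> M \<Longrightarrow> T a \<in> N"
    and T_add: "a \<in> M \<Longrightarrow> b \<in> M \<Longrightarrow> T (a + b) = T a + T b"
    and T_scaleR: "a \<in> M \<Longrightarrow> T (r *\<^sub>R a) = r *\<^sub>R T a"
    and T_central: "z \<in> M \<Longrightarrow> z \<in> N \<Longrightarrow> a \<in> M \<Longrightarrow> T (z o\<^sub>L a) = z o\<^sub>L T a"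
    and T_psd: "a \<in> M \<Longrightarrow> psd a \<Longrightarrow> psd (T a)"
    and T_faithful: "a \<in> M \<Longrightarrow> psd a \<Longrightarrow> T a = 0 \<Longrightarrow> a = 0"
    and T_trace: "a \<in> M \<Longrightarrow> T (real_adj a o\<^sub>L a) = T (a o\<^sub>L real_adj a)"
    and T_id: "T id_blinfun = id_blinfun"
begin

lemma T_diff: "a \<in> M \<Longrightarrow> b \<in> M \<Longrightarrow> T (a - b) = T a - T b"
  using T_add[of a "(-1) *\<^sub>R b"] T_scaleR[of b "-1"] scaleR_M[of b "-1"] by simp

lemma T_zero: "T 0 = 0"
  using T_scaleR[OF zero_M, of 0] by simp

lemma T_mono: "a \<in> M \<Longrightarrow> b \<in> M \<Longrightarrow> psd (b - a) \<Longrightarrow> T a x \<bullet> x \<le> T b x \<bullet> x"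
  using psd_nonneg[OF T_psd[of "b - a"], of x]
  by (simp add: T_diff diff_M blinfun.diff_left inner_diff_left)

lemma norm_T_le:
  assumes a: "a \<in> M" "psd a"
  shows "norm (T a) \<le> norm a"
proof (rule psd_norm_le[OF T_psd[OF a]])
  fix x
  have "T a x \<bullet> x \<le> T (norm a *\<^sub>R id_blinfun) x \<bullet> x"
    by (intro T_mono M_intros a psd_norm_minus psd_self_adj)
  then show "T a x \<bullet> x \<le> norm a * (norm x)\<^sup>2"
    by (simp add: T_scaleR T_id blinfun.scaleR_left power2_norm_eq_inner)
qed simp

text \<open>With \<open>c\<close> the square root of \<open>a\<close>, the tracial property
  exchanges the two products of \<open>c m\<close> with its adjoint, and \<open>m\<close> times its
  adjoint is at most \<open>norm m\<close> squared. This is what makes \<open>dom_ideal\<close>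
  stable under right multiplication.\<close>

lemma T_sandwich_le:
  assumes m: "m \<in> M" and a: "a \<in> M" "psd a"
  shows "T (real_adj m o\<^sub>L a o\<^sub>L m) x \<bullet> x \<le> (norm m)\<^sup>2 * (T a x \<bullet> x)"
proof -
  obtain c where c: "psd c" "c o\<^sub>L c = a" "\<And>s. s o\<^sub>L a = a o\<^sub>L s \<Longrightarrow> s o\<^sub>L c = c o\<^sub>L s"
    using psd_sqrt[OF a(2)] by blast
  have cM: "c \<in> M" by (rule bicommutant_M[OF a(1) c(3)])
  have adjc: "real_adj c = c" using psd_self_adj[OF c(1)] by (simp add: self_adj_iff)
  have "real_adj m o\<^sub>L a o\<^sub>L m = real_adj (c o\<^sub>L m) o\<^sub>L (c o\<^sub>L m)"
    by (rule blinfun_eqI) (simp add: real_adj_compose adjc flip: c(2))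
  then have "T (real_adj m o\<^sub>L a o\<^sub>L m) = T ((c o\<^sub>L m) o\<^sub>L real_adj (c o\<^sub>L m))"
    using T_trace[OF compose_M[OF cM m]] by simp
  also have "(c o\<^sub>L m) o\<^sub>L real_adj (c o\<^sub>L m) = c o\<^sub>L (m o\<^sub>L real_adj m) o\<^sub>L c"
    by (rule blinfun_eqI) (simp add: real_adj_compose adjc)
  finally have eq: "T (real_adj m o\<^sub>L a o\<^sub>L m) = T (c o\<^sub>L (m o\<^sub>L real_adj m) o\<^sub>L c)" .
  have "psd ((norm m)\<^sup>2 *\<^sub>R id_blinfun - (m o\<^sub>L real_adj m))"
  proof (rule psdI)
    have "psd (real_adj (real_adj m) o\<^sub>L real_adj m)" by (rule psd_square)
    then show "self_adj ((norm m)\<^sup>2 *\<^sub>R id_blinfun - (m o\<^sub>L real_adj m))"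
      by (intro self_adj_diff self_adj_scaleR self_adj_id) (simp add: psd_self_adj)
    fix y
    have "m (real_adj m y) \<bullet> y = (norm (real_adj m y))\<^sup>2"
      by (simp add: power2_norm_eq_inner real_adj_right)
    also have "\<dots> \<le> (norm m * norm y)\<^sup>2" by (intro power_mono norm_real_adj_apply) simp
    finally show "0 \<le> ((norm m)\<^sup>2 *\<^sub>R id_blinfun - (m o\<^sub>L real_adj m)) y \<bullet> y"
      by (simp add: blinfun.diff_left blinfun.scaleR_left inner_diff_left power_mult_distrib
          power2_norm_eq_inner[of y])
  qed
  then have "psd (real_adj c o\<^sub>L ((norm m)\<^sup>2 *\<^sub>R id_blinfun - (m o\<^sub>L real_adj m)) o\<^sub>L c)"
    by (rule psd_sandwich)
  moreover have "real_adj c o\<^sub>L ((norm m)\<^sup>2 *\<^sub>R id_blinfun - (m o\<^sub>L real_adj m)) o\<^sub>L c =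
      (norm m)\<^sup>2 *\<^sub>R a - (c o\<^sub>L (m o\<^sub>L real_adj m) o\<^sub>L c)"
    unfolding adjc c(2)[symmetric]
    by (rule blinfun_eqI) (simp add: blinfun.bilinear_simps)
  ultimately have "T (c o\<^sub>L (m o\<^sub>L real_adj m) o\<^sub>L c) x \<bullet> x \<le> T ((norm m)\<^sup>2 *\<^sub>R a) x \<bullet> x"
    by (intro T_mono M_intros cM m a) simp
  then show ?thesis by (simp add: eq T_scaleR a blinfun.scaleR_left)
qed

lemma T_corner_le:
  assumes e: "e \<in> M" "is_proj e" and a: "a \<in> M" "psd a"
  shows "T (e o\<^sub>L a o\<^sub>L e) x \<bullet> x \<le> T a x \<bullet> x"
proof -
  have "T (e o\<^sub>L a o\<^sub>L e) x \<bullet> x \<le> (norm e)\<^sup>2 * (T a x \<bullet> x)"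
    using T_sandwich_le[OF e(1) a, of x] by (simp add: is_proj_adj[OF e(2)])
  also have "\<dots> \<le> 1 * (T a x \<bullet> x)"
    by (intro mult_right_mono psd_nonneg T_psd a) (simp add: is_proj_norm[OF e(2)] power_le_one)
  finally show ?thesis by simp
qed

lemma positive_functional_T: "positive_functional (\<lambda>a. T a x \<bullet> x)"
  unfolding positive_functional_def
  by (auto simp: T_add T_scaleR blinfun.add_left blinfun.scaleR_left inner_add_left
      intro: psd_nonneg T_psd)

lemma positive_functional_vector: "positive_functional (\<lambda>a. a x \<bullet> x)"
  unfolding positive_functional_def
  by (auto simp: blinfun.add_left blinfun.scaleR_left inner_add_left intro: psd_nonneg)

text \<open>\<open>L\<close> and \<open>R\<close> stand for \<open>T\<close> and the identity, in either order.\<close>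

definition dominated ::
    "(('h \<Rightarrow>\<^sub>L 'h) \<Rightarrow> 'h \<Rightarrow>\<^sub>L 'h) \<Rightarrow> (('h \<Rightarrow>\<^sub>L 'h) \<Rightarrow> 'h \<Rightarrow>\<^sub>L 'h) \<Rightarrow> 'h set" where
  "dominated L R = {x. \<forall>e>0. \<exists>ys. \<forall>a\<in>M. psd a \<longrightarrow>
     L a x \<bullet> x \<le> (\<Sum>y\<leftarrow>ys. R a y \<bullet> y) + e * norm a}"

lemma dominatedI:
  assumes "\<And>e. 0 < e \<Longrightarrow> \<exists>ys. \<forall>a\<in>M. psd a \<longrightarrow> blinfun_apply (L a) x \<bullet> x \<le> (\<Sum>y\<leftarrow>ys. blinfun_apply (R a) y \<bullet> y) + e * norm a"
  shows "x \<in> dominated L R"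
  using assms unfolding dominated_def by blast

lemma dominatedD:
  assumes "x \<in> dominated L R" "0 < e"
  obtains ys where "\<And>a. a \<in> M \<Longrightarrow> psd a \<Longrightarrow> blinfun_apply (L a) x \<bullet> x \<le> (\<Sum>y\<leftarrow>ys. blinfun_apply (R a) y \<bullet> y) + e * norm a"
  using assms unfolding dominated_def by blast

text \<open>Closedness is due to the error term: replacing \<open>x\<close> by a nearby vector costs
  at most \<open>norm a\<close> times twice the squared distance.\<close>

lemma dominated_closed_subspace:
  assumes L: "\<And>a. a \<in> M \<Longrightarrow> psd a \<Longrightarrow> psd (L a)" "\<And>a. a \<in> M \<Longrightarrow> psd a \<Longrightarrow> norm (L a) \<le> norm a"
  shows "closed (dominated L R)" "subspace (dominated L R)"
proof -
  show "subspace (dominated L R)"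
  proof (rule subspaceI)
    show "0 \<in> dominated L R"
      by (rule dominatedI, rule exI[of _ "[]"]) simp
  next
    fix x y assume x: "x \<in> dominated L R" and y: "y \<in> dominated L R"
    show "x + y \<in> dominated L R"
    proof (rule dominatedI)
      fix e :: real assume "0 < e"
      \<comment> \<open>\<open>psd_inner_add_le\<close> doubles each of the two errors, hence the
        quarters; scaling the vectors by \<open>sqrt 2\<close> doubles the sums.\<close>
      then have e4: "0 < e / 4" by simp
      obtain xs where xs: "\<And>a. a \<in> M \<Longrightarrow> psd a \<Longrightarrow> L a x \<bullet> x \<le> (\<Sum>y\<leftarrow>xs. R a y \<bullet> y) + e / 4 * norm a"
        using dominatedD[OF x e4] by blast
      obtain ys where ys: "\<And>a. a \<in> M \<Longrightarrow> psd a \<Longrightarrow> L a y \<bullet> y \<le> (\<Sum>y\<leftarrow>ys. R a y \<bullet> y) + e / 4 * norm a"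
        using dominatedD[OF y e4] by blast
      have "L a (x + y) \<bullet> (x + y) \<le>
          (\<Sum>y\<leftarrow>map (\<lambda>y. sqrt 2 *\<^sub>R y) (xs @ ys). R a y \<bullet> y) + e * norm a" if a: "a \<in> M" "psd a" for a
        unfolding sum_list_scaleR_inner
        using psd_inner_add_le[OF L(1)[OF a], of x y] xs[OF a] ys[OF a] by simp
      then show "\<exists>ys. \<forall>a\<in>M. psd a \<longrightarrow> L a (x + y) \<bullet> (x + y) \<le> (\<Sum>y\<leftarrow>ys. R a y \<bullet> y) + e * norm a"
        by blast
    qed
  next
    fix c x assume x: "x \<in> dominated L R"
    show "c *\<^sub>R x \<in> dominated L R"
    proof (rule dominatedI)
      fix e :: real assume e: "0 < e"
      \<comment> \<open>\<open>c\<close> may be 0, hence the divisor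
        \<open>c\<^sup>2 + 1\<close>.\<close>
      have c1: "0 < c\<^sup>2 + 1" by (simp add: add_nonneg_pos)
      obtain xs where xs: "\<And>a. a \<in> M \<Longrightarrow> psd a \<Longrightarrow>
          L a x \<bullet> x \<le> (\<Sum>y\<leftarrow>xs. R a y \<bullet> y) + e / (c\<^sup>2 + 1) * norm a"
        using dominatedD[OF x divide_pos_pos[OF e c1]] by blast
      have "L a (c *\<^sub>R x) \<bullet> (c *\<^sub>R x) \<le> (\<Sum>y\<leftarrow>map (\<lambda>y. c *\<^sub>R y) xs. R a y \<bullet> y) + e * norm a"
        if a: "a \<in> M" "psd a" for a
      proof -
        have "L a (c *\<^sub>R x) \<bullet> (c *\<^sub>R x) = c\<^sup>2 * (L a x \<bullet> x)"
          by (simp add: blinfun.scaleR_right power2_eq_square)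
        also have "\<dots> \<le> c\<^sup>2 * ((\<Sum>y\<leftarrow>xs. R a y \<bullet> y) + e / (c\<^sup>2 + 1) * norm a)"
          by (intro mult_left_mono xs a) simp
        also have "\<dots> = c\<^sup>2 * (\<Sum>y\<leftarrow>xs. R a y \<bullet> y) + (c\<^sup>2 / (c\<^sup>2 + 1)) * (e * norm a)"
          by (simp add: distrib_left)
        also have "\<dots> \<le> c\<^sup>2 * (\<Sum>y\<leftarrow>xs. R a y \<bullet> y) + 1 * (e * norm a)"
          using e c1 by (intro add_left_mono mult_right_mono) simp_all
        finally show ?thesis unfolding sum_list_scaleR_inner by simp
      qed
      then show "\<exists>ys. \<forall>a\<in>M. psd a \<longrightarrow> L a (c *\<^sub>R x) \<bullet> (c *\<^sub>R x) \<le> (\<Sum>y\<leftarrow>ys. R a y \<bullet> y) + e * norm a"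
        by blast
    qed
  qed
  show "closed (dominated L R)"
    unfolding closed_sequential_limits
  proof (intro allI impI dominatedI)
    fix f x and e :: real
    assume f: "(\<forall>n. f n \<in> dominated L R) \<and> f \<longlonglongrightarrow> x" and e: "0 < e"
    have e4: "0 < e / 4" "0 < sqrt (e / 4)" using e by simp_all
    from f have "\<exists>n. dist (f n) x < sqrt (e / 4)"
      using e4(2) by (metis LIMSEQ_iff_nz dist_norm lim_sequentially order_refl)
    then obtain n where n: "dist (f n) x < sqrt (e / 4)" by blast
    let ?y = "f n" and ?d = "x - f n"
    have "(norm ?d)\<^sup>2 \<le> (sqrt (e / 4))\<^sup>2"
      using n by (intro power_mono) (simp_all add: dist_norm norm_minus_commute)
    then have d: "(norm ?d)\<^sup>2 \<le> e / 4" using e by simp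
    obtain ys where ys: "\<And>a. a \<in> M \<Longrightarrow> psd a \<Longrightarrow> L a ?y \<bullet> ?y \<le> (\<Sum>y\<leftarrow>ys. R a y \<bullet> y) + e / 4 * norm a"
      using dominatedD[of ?y L R, OF _ e4(1)] f by blast
    have "L a x \<bullet> x \<le> (\<Sum>y\<leftarrow>map (\<lambda>y. sqrt 2 *\<^sub>R y) ys. R a y \<bullet> y) + e * norm a"
      if a: "a \<in> M" "psd a" for a
    proof -
      have "L a x \<bullet> x \<le> 2 * (L a ?y \<bullet> ?y) + 2 * (L a ?d \<bullet> ?d)"
        using psd_inner_add_le[OF L(1)[OF a], of ?y ?d] by simp
      moreover have "L a ?d \<bullet> ?d \<le> e / 4 * norm a"
      proof -
        have "L a ?d \<bullet> ?d \<le> norm (L a) * (norm ?d)\<^sup>2" by (rule inner_le_norm_sq)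
        also have "\<dots> \<le> norm a * (e / 4)" by (intro mult_mono L(2) a d) simp_all
        finally show ?thesis by (simp add: mult.commute)
      qed
      ultimately show ?thesis unfolding sum_list_scaleR_inner using ys[OF a] by simp
    qed
    then show "\<exists>ys. \<forall>a\<in>M. psd a \<longrightarrow> L a x \<bullet> x \<le> (\<Sum>y\<leftarrow>ys. R a y \<bullet> y) + e * norm a" by blast
  qed
qed

text \<open>A nonzero component \<open>d\<close> orthogonal to \<open>K\<close> would come with a
  nonzero \<open>e d\<close> in \<open>K\<close>, but the inner product of \<open>d\<close> and
  \<open>e d\<close> is the square of \<open>norm (e d)\<close>.\<close>

lemma closed_subspace_UNIV:
  fixes K :: "'h set"
  assumes K: "closed K" "subspace K"
    and ex: "\<And>x. x \<noteq> 0 \<Longrightarrow> \<exists>e. is_proj e \<and> blinfun_apply e x \<noteq> 0 \<and> e x \<in> K"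
  shows "x \<in> K"
proof -
  define d where "d = x - ortho_proj K x"
  have dK: "d \<bullet> y = 0" if "y \<in> K" for y
    unfolding d_def by (rule ortho_proj_orthogonal[OF K that])
  have "d = 0"
  proof (rule ccontr)
    assume "d \<noteq> 0"
    then obtain e where e: "is_proj e" "blinfun_apply e d \<noteq> 0" "e d \<in> K" using ex by blast
    have "(norm (e d))\<^sup>2 = d \<bullet> e d" using is_proj_inner_self[OF e(1), of d] by (simp add: inner_commute)
    then show False using dK[OF e(3)] e(2) by simp
  qed
  then show ?thesis using ortho_proj_in[OF K, of x] by (simp add: d_def)
qed

text \<open>Domination without error term, for the functional cut down by \<open>b\<close>. This is
  a two-sided ideal: a right factor is absorbed by \<open>T_sandwich_le\<close>, a left factor moves
  into the vectors, and sums are handled by the parallelogram inequality.\<close>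

definition dom_ideal :: "'h \<Rightarrow> ('h \<Rightarrow>\<^sub>L 'h) set" where
  "dom_ideal x = {b \<in> M. \<exists>ys. \<forall>a\<in>M. psd a \<longrightarrow>
     T (real_adj b o\<^sub>L a o\<^sub>L b) x \<bullet> x \<le> (\<Sum>y\<leftarrow>ys. a y \<bullet> y)}"

lemma dom_ideal_right:
  assumes b: "b \<in> dom_ideal x" and m: "m \<in> M"
  shows "b o\<^sub>L m \<in> dom_ideal x"
proof -
  obtain ys where bM: "b \<in> M" and ys: "\<And>a. a \<in> M \<Longrightarrow> psd a \<Longrightarrow>
      T (real_adj b o\<^sub>L a o\<^sub>L b) x \<bullet> x \<le> (\<Sum>y\<leftarrow>ys. a y \<bullet> y)"
    using b unfolding dom_ideal_def by blast
  have "T (real_adj (b o\<^sub>L m) o\<^sub>L a o\<^sub>L (b o\<^sub>L m)) x \<bullet> x \<le> (\<Sum>y\<leftarrow>map (\<lambda>y. norm m *\<^sub>R y) ys. a y \<bullet> y)"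
    if a: "a \<in> M" "psd a" for a
  proof -
    have "real_adj (b o\<^sub>L m) o\<^sub>L a o\<^sub>L (b o\<^sub>L m) = real_adj m o\<^sub>L (real_adj b o\<^sub>L a o\<^sub>L b) o\<^sub>L m"
      by (rule blinfun_eqI) (simp add: real_adj_compose)
    then have "T (real_adj (b o\<^sub>L m) o\<^sub>L a o\<^sub>L (b o\<^sub>L m)) x \<bullet> x \<le>
        (norm m)\<^sup>2 * (T (real_adj b o\<^sub>L a o\<^sub>L b) x \<bullet> x)"
      using T_sandwich_le[OF m _ psd_sandwich[OF a(2), of b]] by (simp add: compose_M adj_M a bM)
    also have "\<dots> \<le> (norm m)\<^sup>2 * (\<Sum>y\<leftarrow>ys. a y \<bullet> y)" by (intro mult_left_mono ys a) simp
    finally show ?thesis unfolding sum_list_scaleR_inner .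
  qed
  then show ?thesis using compose_M[OF bM m] unfolding dom_ideal_def by blast
qed

lemma dom_ideal_left:
  assumes b: "b \<in> dom_ideal x" and m: "m \<in> M"
  shows "m o\<^sub>L b \<in> dom_ideal x"
proof -
  obtain ys where bM: "b \<in> M" and ys: "\<And>a. a \<in> M \<Longrightarrow> psd a \<Longrightarrow>
      T (real_adj b o\<^sub>L a o\<^sub>L b) x \<bullet> x \<le> (\<Sum>y\<leftarrow>ys. a y \<bullet> y)"
    using b unfolding dom_ideal_def by blast
  have "T (real_adj (m o\<^sub>L b) o\<^sub>L a o\<^sub>L (m o\<^sub>L b)) x \<bullet> x \<le> (\<Sum>y\<leftarrow>map m ys. a y \<bullet> y)"
    if a: "a \<in> M" "psd a" for a
  proof -
    have "real_adj (m o\<^sub>L b) o\<^sub>L a o\<^sub>L (m o\<^sub>L b) = real_adj b o\<^sub>L (real_adj m o\<^sub>L a o\<^sub>L m) o\<^sub>L b"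
      by (rule blinfun_eqI) (simp add: real_adj_compose)
    moreover have "T (real_adj b o\<^sub>L (real_adj m o\<^sub>L a o\<^sub>L m) o\<^sub>L b) x \<bullet> x \<le>
        (\<Sum>y\<leftarrow>ys. (real_adj m o\<^sub>L a o\<^sub>L m) y \<bullet> y)"
      by (intro ys compose_M adj_M a m psd_sandwich)
    ultimately show ?thesis by (simp add: real_adj_left comp_def)
  qed
  then show ?thesis using compose_M[OF m bM] unfolding dom_ideal_def by blast
qed

lemma dom_ideal_add:
  assumes b: "b \<in> dom_ideal x" and c: "c \<in> dom_ideal x"
  shows "b + c \<in> dom_ideal x"
proof -
  obtain ys where bM: "b \<in> M" and ys: "\<And>a. a \<in> M \<Longrightarrow> psd a \<Longrightarrow>
      T (real_adj b o\<^sub>L a o\<^sub>L b) x \<bullet> x \<le> (\<Sum>y\<leftarrow>ys. a y \<bullet> y)"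
    using b unfolding dom_ideal_def by blast
  obtain zs where cM: "c \<in> M" and zs: "\<And>a. a \<in> M \<Longrightarrow> psd a \<Longrightarrow>
      T (real_adj c o\<^sub>L a o\<^sub>L c) x \<bullet> x \<le> (\<Sum>y\<leftarrow>zs. a y \<bullet> y)"
    using c unfolding dom_ideal_def by blast
  have "T (real_adj (b + c) o\<^sub>L a o\<^sub>L (b + c)) x \<bullet> x \<le>
      (\<Sum>y\<leftarrow>map (\<lambda>y. sqrt 2 *\<^sub>R y) (ys @ zs). a y \<bullet> y)"
    if a: "a \<in> M" "psd a" for a
  proof -
    let ?b = "real_adj b o\<^sub>L a o\<^sub>L b" and ?c = "real_adj c o\<^sub>L a o\<^sub>L c"
    have adjd: "real_adj (b - c) = real_adj b - real_adj c"
      by (rule real_adj_eqI) (simp add: blinfun.diff_left inner_diff_left inner_diff_right real_adj_left)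
    have "psd (real_adj (b - c) o\<^sub>L a o\<^sub>L (b - c))" by (rule psd_sandwich[OF a(2)])
    also have "real_adj (b - c) o\<^sub>L a o\<^sub>L (b - c) =
        2 *\<^sub>R (?b + ?c) - (real_adj (b + c) o\<^sub>L a o\<^sub>L (b + c))"
      unfolding adjd real_adj_add
      by (rule blinfun_eqI) (simp add: blinfun.bilinear_simps scaleR_2 algebra_simps)
    finally have "T (real_adj (b + c) o\<^sub>L a o\<^sub>L (b + c)) x \<bullet> x \<le> T (2 *\<^sub>R (?b + ?c)) x \<bullet> x"
      by (intro T_mono M_intros a bM cM)
    also have "\<dots> = 2 * (T ?b x \<bullet> x + T ?c x \<bullet> x)"
      by (simp add: T_scaleR T_add add_M compose_M adj_M a bM cM blinfun.scaleR_left
          blinfun.add_left inner_add_left)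
    also have "\<dots> \<le> 2 * ((\<Sum>y\<leftarrow>ys. a y \<bullet> y) + (\<Sum>y\<leftarrow>zs. a y \<bullet> y))"
      by (intro mult_left_mono add_mono ys zs a) simp
    finally show ?thesis unfolding sum_list_scaleR_inner by simp
  qed
  then show ?thesis using add_M[OF bM cM] unfolding dom_ideal_def by blast
qed

text \<open>On a central projection \<open>E\<close> with \<open>T e \<ge> d E\<close> there is no room for more than \<open>1 / d\<close>
  orthogonal copies of \<open>e\<close>. When no further copy fits, what is left over is, on some central
  projection, itself equivalent to a part of \<open>e\<close>.\<close>

lemma central_projection_in_ideal:
  assumes e: "e \<in> M" "is_proj e" "e \<noteq> 0" "e \<in> dom_ideal x"
  obtains z where "z \<in> M" "z \<in> N" "is_proj z" "z \<in> dom_ideal x" "z o\<^sub>L e \<noteq> 0"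
proof -
  define h where "h = T e"
  have h: "h \<in> M" "h \<in> N" "psd h"
    unfolding h_def using T_M T_N T_psd e psd_is_proj by blast+
  have "h \<noteq> 0" using T_faithful[OF e(1) psd_is_proj[OF e(2)]] e(3) by (auto simp: h_def)
  then obtain d E x0 where d: "0 < d" "2 * d \<le> norm h" and E: "is_proj E" "E x0 \<noteq> 0"
    "\<And>s. s o\<^sub>L h = h o\<^sub>L s \<Longrightarrow> s o\<^sub>L E = E o\<^sub>L s"
    and lower: "\<And>y. E y = y \<Longrightarrow> d * (norm y)\<^sup>2 \<le> h y \<bullet> y"
    using spectral_cut_positive[OF h(3)] by metis
  note d = d(1)
  have EM: "E \<in> M" by (rule bicommutant_M[OF h(1) E(3)])
  have EN: "E \<in> N" by (rule bicommutant_N[OF h(2) E(3)])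
  note EE = is_proj_idem[OF E(1)]
  have eE: "e (E y) = E (e y)" for y by (rule MN_commute[OF e(1) EN])
  define p where "p = E o\<^sub>L e"
  have pM: "p \<in> M" unfolding p_def by (intro M_intros EM e)
  have pp: "is_proj p"
    unfolding p_def
    by (rule is_projI) (simp_all add: is_proj_inner[OF E(1)] is_proj_inner[OF e(2)] eE EE is_proj_idem[OF e(2)])
  have Tp: "T p = E o\<^sub>L h" unfolding p_def h_def by (rule T_central[OF EM EN e(1)])
  define good where "good z \<longleftrightarrow> z \<in> M \<and> z \<in> N \<and> is_proj z \<and> z \<in> dom_ideal x \<and> z \<noteq> 0 \<and> (\<forall>y. E (blinfun_apply z y) = z y)" for z
  have "\<exists>z. good z"
  proof (rule ccontr)
    assume no: "\<nexists>z. good z"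
    \<comment> \<open>\<open>g\<close> is a sum of \<open>n\<close> orthogonal projections below
      \<open>E\<close>, each equivalent to \<open>p\<close>; as long as no \<open>good\<close>
      projection exists, another copy fits.\<close>
    have copies: "\<exists>g. g \<in> M \<and> is_proj g \<and> g \<in> dom_ideal x \<and> (\<forall>y. E (blinfun_apply g y) = g y) \<and>
        T g = real n *\<^sub>R (E o\<^sub>L h)" for n
    proof (induction n)
      case 0
      have "e o\<^sub>L 0 \<in> dom_ideal x" by (rule dom_ideal_right[OF e(4) zero_M])
      then have "0 \<in> dom_ideal x" by simp
      then show ?case by (intro exI[of _ 0]) (simp add: T_zero)
    next
      case (Suc n)
      then obtain g where g: "g \<in> M" "is_proj g" "g \<in> dom_ideal x" "\<And>y. E (g y) = g y"
        "T g = real n *\<^sub>R (E o\<^sub>L h)" by blast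
      define r where "r = E - g"
      have rM: "r \<in> M" unfolding r_def by (intro M_intros EM g)
      have rp: "is_proj r" unfolding r_def by (rule is_proj_diff(2)[OF E(1) g(2,4)])
      obtain v z where v: "v \<in> M" "is_proj (real_adj v o\<^sub>L v)" and z: "z \<in> M" "z \<in> N" "is_proj z"
        and pv: "\<And>x. p (real_adj v x) = real_adj v x" and rv: "\<And>x. r (v x) = v x"
        and zr: "\<And>x. z (r x) = z (v (real_adj v x))"
        and zp: "\<And>x. p x - z (p x) = real_adj v (v x) - z (real_adj v (v x))"
        using comparison[OF pM pp rM rp] by metis
      have vp: "v (p y) = v y" for y
        by (rule vector_eq_rdot[THEN iffD1], rule allI)
          (metis is_proj_inner pp pv real_adj_left real_adj_right)
      \<comment> \<open>\<open>v\<close> lives on \<open>p\<close>, which lies below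
        \<open>e\<close>, so \<open>v\<close> is a left multiple of \<open>e\<close> and belongs to
        the ideal.\<close>
      have vvJ: "v o\<^sub>L real_adj v \<in> dom_ideal x"
      proof -
        have "v = (v o\<^sub>L E) o\<^sub>L e" using vp by (intro blinfun_eqI) (simp add: p_def)
        then have "v \<in> dom_ideal x" using dom_ideal_left[OF e(4) compose_M[OF v(1) EM]] by simp
        then show ?thesis by (rule dom_ideal_right[OF _ adj_M[OF v(1)]])
      qed
      have zE: "z (E y) = E (z y)" for y by (rule MN_commute[OF z(1) EN])
      show ?case
      proof (cases "z o\<^sub>L E = 0")
        \<comment> \<open>On \<open>z\<close> the remainder \<open>r\<close> is the final projection
          of \<open>v\<close>, so \<open>z E\<close> is a sum of two members of the ideal and thus a
          \<open>good\<close> projection.\<close>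
        case False
        have "is_proj (z o\<^sub>L E)"
          by (rule is_projI)
            (simp_all add: is_proj_inner[OF E(1)] is_proj_inner[OF z(3)] zE EE is_proj_idem[OF z(3)])
        moreover have "z o\<^sub>L E \<in> M" "z o\<^sub>L E \<in> N" by (intro compose_M compose_N z EM EN)+
        moreover have "z o\<^sub>L E \<in> dom_ideal x"
        proof -
          have "z o\<^sub>L E = (z o\<^sub>L g) + (z o\<^sub>L (v o\<^sub>L real_adj v))"
            by (rule blinfun_eqI) (simp add: blinfun.add_left r_def blinfun.diff_left blinfun.diff_right flip: zr)
          then show ?thesis using dom_ideal_add[OF dom_ideal_left[OF g(3) z(1)] dom_ideal_left[OF vvJ z(1)]]
            by simp
        qed
        moreover have "E ((z o\<^sub>L E) y) = (z o\<^sub>L E) y" for y by (simp add: zE EE)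
        ultimately have "good (z o\<^sub>L E)" using False unfolding good_def by blast
        with no show ?thesis by blast
      next
        \<comment> \<open>Now \<open>z\<close> kills \<open>p\<close>, so \<open>v\<close> uses up
          all of \<open>p\<close>, and its final projection is one more copy below the
          remainder.\<close>
        case True
        then have zE0: "z (E y) = 0" for y by (metis blinfun_apply_blinfun_compose zero_blinfun.rep_eq)
        have zp0: "z (p y) = 0" for y using zE0 by (simp add: p_def)
        have zv0: "z (real_adj v y) = 0" for y using zp0[of "real_adj v y"] by (simp add: pv)
        have vv: "real_adj v o\<^sub>L v = p" using zp by (intro blinfun_eqI) (simp add: zp0 zv0)
        have vvp: "is_proj (v o\<^sub>L real_adj v)" by (rule partial_isometry_final(1)[OF v(2)])
        have gr: "g (r y) = 0" for y
          by (simp add: r_def blinfun.diff_left blinfun.diff_right is_proj_diff(1)[OF E(1) g(2,4)] is_proj_idem[OF g(2)])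
        have gv: "g ((v o\<^sub>L real_adj v) y) = 0" for y using gr[of "v (real_adj v y)"] by (simp add: rv)
        have Er: "E (r y) = r y" for y by (simp add: r_def blinfun.diff_left blinfun.diff_right EE g)
        have "E (v y) = v y" for y using Er[of "v y"] by (simp add: rv)
        moreover have "T (v o\<^sub>L real_adj v) = E o\<^sub>L h" using T_trace[OF v(1)] by (simp add: vv Tp)
        ultimately show ?thesis
          using is_proj_add(2)[OF g(2) vvp gv] dom_ideal_add[OF g(3) vvJ] g v(1)
          by (intro exI[of _ "g + (v o\<^sub>L real_adj v)"])
            (simp add: add_M compose_M adj_M blinfun.add_left blinfun.add_right T_add scaleR_add_left)
      qed
    qed
    \<comment> \<open>More than \<open>1 / d\<close> copies would make the trace of \<open>g\<close>
      exceed that of \<open>E\<close> at the vector \<open>E x0\<close>, where the form of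
      \<open>h\<close> is bounded below by \<open>d\<close>.\<close>
    obtain n where n: "1 / d < real n" using reals_Archimedean2 by blast
    obtain g where g: "g \<in> M" "is_proj g" "\<And>y. E (g y) = g y" "T g = real n *\<^sub>R (E o\<^sub>L h)"
      using copies[of n] by blast
    let ?y = "E x0"
    have "psd (E - g)" by (intro psd_is_proj is_proj_diff(2) E(1) g)
    then have "T g ?y \<bullet> ?y \<le> T E ?y \<bullet> ?y" by (intro T_mono EM g)
    moreover have "T E = E"
    proof -
      have "E o\<^sub>L id_blinfun = E" by (rule blinfun_eqI) simp
      then show ?thesis using T_central[OF EM EN id_M] by (simp add: T_id)
    qed
    moreover have "T g ?y \<bullet> ?y = real n * (h ?y \<bullet> ?y)"
      using is_proj_inner[OF E(1), of "h ?y" ?y] by (simp add: g(4) blinfun.scaleR_left EE)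
    moreover have "real n * (d * (norm ?y)\<^sup>2) \<le> real n * (h ?y \<bullet> ?y)"
      by (intro mult_left_mono lower EE) simp
    ultimately have "real n * d * (norm ?y)\<^sup>2 \<le> 1 * (norm ?y)\<^sup>2"
      by (simp add: EE power2_norm_eq_inner mult.assoc)
    moreover have "0 < (norm ?y)\<^sup>2" using E(2) by simp
    ultimately have "real n * d \<le> 1" by (rule mult_right_le_imp_le)
    then show False using n d by (simp add: field_simps)
  qed
  then obtain z where z: "z \<in> M" "z \<in> N" "is_proj z" "z \<in> dom_ideal x" "z \<noteq> 0" "\<And>y. E (z y) = z y"
    unfolding good_def by blast
  \<comment> \<open>\<open>z T e\<close> equals \<open>T (z e)\<close>, while \<open>T e\<close> is
    bounded below by \<open>d\<close> on the nonzero range of \<open>z\<close>.\<close>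
  have "z o\<^sub>L e \<noteq> 0"
  proof
    assume "z o\<^sub>L e = 0"
    then have "z o\<^sub>L h = 0" using T_central[OF z(1,2) e(1)] by (simp add: h_def T_zero)
    then have zh: "z (h y) = 0" for y by (metis blinfun_apply_blinfun_compose zero_blinfun.rep_eq)
    obtain w where w: "z w \<noteq> 0" by (rule blinfun_nonzero[OF z(5)])
    have "h (z w) = 0" using MN_commute[OF h(1) z(2), of w] zh by simp
    then have "d * (norm (z w))\<^sup>2 \<le> 0" using lower[OF z(6), of w] by simp
    then show False using d w by (simp add: mult_le_0_iff)
  qed
  with z show thesis by (intro that)
qed

text \<open>Centrality of \<open>z\<close> takes the domination from the corner back to a vector:
  \<open>T (z a z)\<close> is \<open>z (T a) z\<close>, so dominating it at \<open>x\<close> is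
  dominating \<open>T a\<close> at \<open>z x\<close>.\<close>

lemma T_normal: "x \<in> dominated T (\<lambda>a. a)"
proof (rule closed_subspace_UNIV)
  show "closed (dominated T (\<lambda>a. a))" "subspace (dominated T (\<lambda>a. a))"
    by (rule dominated_closed_subspace; fact T_psd norm_T_le)+
  fix x :: 'h assume x: "x \<noteq> 0"
  obtain f where f: "f \<in> M" "is_proj f" "f x = x"
    "\<And>e. e \<in> M \<Longrightarrow> is_proj e \<Longrightarrow> (\<And>y. f (e y) = e y) \<Longrightarrow> blinfun_apply e x = 0 \<Longrightarrow> e = 0"
    using cyclic_support[OF x] by blast
  \<comment> \<open>At \<open>f\<close> the vector functional of \<open>y = c x\<close> exceeds
    \<open>T f x \<bullet> x\<close> by exactly 1, which supplies the strict inequality for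
    \<open>dominating_corner\<close>.\<close>
  define c where "c = sqrt ((T f x \<bullet> x + 1) / (x \<bullet> x))"
  have "0 \<le> T f x \<bullet> x" by (rule psd_nonneg[OF T_psd[OF f(1) psd_is_proj[OF f(2)]]])
  then have c2: "c\<^sup>2 * (x \<bullet> x) = T f x \<bullet> x + 1" using x by (simp add: c_def)
  define y where "y = c *\<^sub>R x"
  have normal: "normal_functional (\<lambda>a. a y \<bullet> y)"
    unfolding normal_functional_def
    by (auto simp: positive_functional_vector intro!: exI[of _ "[y]"])
  have lt: "T f x \<bullet> x < f y \<bullet> y"
    using c2 by (simp add: y_def blinfun.scaleR_right f power2_eq_square)
  obtain e where e: "e \<in> M" "is_proj e" "e \<noteq> 0" "\<And>x. f (e x) = e x"
    "\<And>a. a \<in> M \<Longrightarrow> psd a \<Longrightarrow> T (e o\<^sub>L a o\<^sub>L e) x \<bullet> x \<le> (e o\<^sub>L a o\<^sub>L e) y \<bullet> y"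
    using dominating_corner[OF positive_functional_T normal f(1,2) lt] by metis
  have "e \<in> dom_ideal x"
  proof -
    have "T (real_adj e o\<^sub>L a o\<^sub>L e) x \<bullet> x \<le> (\<Sum>y\<leftarrow>[e y]. a y \<bullet> y)" if "a \<in> M" "psd a" for a
      using e(5)[OF that] by (simp add: is_proj_adj[OF e(2)] is_proj_inner[OF e(2)])
    then show ?thesis using e(1) unfolding dom_ideal_def by blast
  qed
  then obtain z where z: "z \<in> M" "z \<in> N" "is_proj z" "z \<in> dom_ideal x" "z o\<^sub>L e \<noteq> 0"
    using central_projection_in_ideal[OF e(1-3)] by blast
  have ez: "e (z w) = z (e w)" for w by (rule MN_commute[OF e(1) z(2)])
  \<comment> \<open>\<open>z e\<close> is a nonzero projection below the support \<open>f\<close> of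
    \<open>x\<close>, so it cannot kill \<open>x\<close>.\<close>
  have "z x \<noteq> 0"
  proof
    assume "z x = 0"
    have "is_proj (z o\<^sub>L e)"
      by (rule is_projI)
        (simp_all add: is_proj_inner[OF e(2)] is_proj_inner[OF z(3)] ez is_proj_idem[OF e(2)] is_proj_idem[OF z(3)])
    moreover have "f ((z o\<^sub>L e) w) = (z o\<^sub>L e) w" for w
      using e(4) by (simp flip: ez)
    moreover have "(z o\<^sub>L e) x = 0" using \<open>z x = 0\<close> by (simp flip: ez)
    ultimately have "z o\<^sub>L e = 0" by (intro f(4) compose_M z e)
    with z(5) show False by simp
  qed
  moreover have "z x \<in> dominated T (\<lambda>a. a)"
  proof (rule dominatedI)
    fix d :: real assume d: "0 < d"
    obtain ys where ys: "\<And>a. a \<in> M \<Longrightarrow> psd a \<Longrightarrow>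
        T (real_adj z o\<^sub>L a o\<^sub>L z) x \<bullet> x \<le> (\<Sum>y\<leftarrow>ys. a y \<bullet> y)"
      using z(4) unfolding dom_ideal_def by blast
    have "T a (z x) \<bullet> z x \<le> (\<Sum>y\<leftarrow>ys. a y \<bullet> y) + d * norm a" if a: "a \<in> M" "psd a" for a
    proof -
      have "real_adj z o\<^sub>L a o\<^sub>L z = z o\<^sub>L (z o\<^sub>L a)"
        using MN_commute[OF a(1) z(2)] by (intro blinfun_eqI) (simp add: is_proj_adj[OF z(3)])
      then have "T (real_adj z o\<^sub>L a o\<^sub>L z) = z o\<^sub>L (z o\<^sub>L T a)"
        using T_central[OF z(1,2)] a z by (simp add: compose_M)
      moreover have "T a (z x) \<bullet> z x = (z o\<^sub>L (z o\<^sub>L T a)) x \<bullet> x"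
        using MN_commute[OF T_M[OF a(1)] z(2), of x] is_proj_inner[OF z(3), of "T a (z x)" x]
        by (simp add: is_proj_idem[OF z(3)])
      ultimately have "T a (z x) \<bullet> z x \<le> (\<Sum>y\<leftarrow>ys. a y \<bullet> y)" using ys[OF a] by simp
      then show ?thesis using d by (simp add: add_increasing2)
    qed
    then show "\<exists>ys. \<forall>a\<in>M. psd a \<longrightarrow> T a (z x) \<bullet> z x \<le> (\<Sum>y\<leftarrow>ys. a y \<bullet> y) + d * norm a" by blast
  qed
  ultimately show "\<exists>e. is_proj e \<and> blinfun_apply e x \<noteq> 0 \<and> e x \<in> dominated T (\<lambda>a. a)"
    using z(3) by blast
qed

text \<open>The roles are exchanged: the larger functional is now that of \<open>T\<close> at a
  vector \<open>y\<close>, normal by \<open>T_normal\<close> and positive on \<open>f\<close> by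
  faithfulness. \<open>T_corner_le\<close> removes the corner on the larger side, so
  \<open>e x\<close> itself is dominated.\<close>

lemma vector_dominated_by_T: "x \<in> dominated (\<lambda>a. a) T"
proof (rule closed_subspace_UNIV)
  show "closed (dominated (\<lambda>a. a) T)" "subspace (dominated (\<lambda>a. a) T)"
    by (rule dominated_closed_subspace; simp)+
  fix x :: 'h assume x: "x \<noteq> 0"
  obtain f where f: "f \<in> M" "is_proj f" "f x = x"
    "\<And>e. e \<in> M \<Longrightarrow> is_proj e \<Longrightarrow> (\<And>y. f (e y) = e y) \<Longrightarrow> blinfun_apply e x = 0 \<Longrightarrow> e = 0"
    using cyclic_support[OF x] by blast
  have Tf: "psd (T f)" by (rule T_psd[OF f(1) psd_is_proj[OF f(2)]])
  have "T f \<noteq> 0"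
  proof
    assume "T f = 0"
    then have "f = 0" by (rule T_faithful[OF f(1) psd_is_proj[OF f(2)]])
    then show False using f(3) x by simp
  qed
  then obtain y0 where y0: "0 < T f y0 \<bullet> y0" using psd_eq_0I[OF Tf] by (auto simp: not_le[symmetric])
  define c where "c = sqrt ((x \<bullet> x + 1) / (T f y0 \<bullet> y0))"
  have c2: "c\<^sup>2 * (T f y0 \<bullet> y0) = x \<bullet> x + 1" using y0 by (simp add: c_def add_nonneg_nonneg)
  define y where "y = c *\<^sub>R y0"
  have normal: "normal_functional (\<lambda>a. T a y \<bullet> y)"
    using T_normal[of y] positive_functional_T[of y] unfolding normal_functional_def dominated_def by blast
  have lt: "f x \<bullet> x < T f y \<bullet> y"
    using c2 by (simp add: y_def blinfun.scaleR_right f power2_eq_square)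
  obtain e where e: "e \<in> M" "is_proj e" "e \<noteq> 0" "\<And>x. f (e x) = e x"
    "\<And>a. a \<in> M \<Longrightarrow> psd a \<Longrightarrow> (e o\<^sub>L a o\<^sub>L e) x \<bullet> x \<le> T (e o\<^sub>L a o\<^sub>L e) y \<bullet> y"
    using dominating_corner[OF positive_functional_vector normal f(1,2) lt] by metis
  have "e x \<noteq> 0" using f(4)[OF e(1,2,4)] e(3) by blast
  moreover have "e x \<in> dominated (\<lambda>a. a) T"
  proof (rule dominatedI)
    fix d :: real assume d: "0 < d"
    have "a (e x) \<bullet> e x \<le> (\<Sum>y\<leftarrow>[y]. T a y \<bullet> y) + d * norm a" if a: "a \<in> M" "psd a" for a
    proof -
      have "a (e x) \<bullet> e x = (e o\<^sub>L a o\<^sub>L e) x \<bullet> x" using is_proj_inner[OF e(2), of "a (e x)" x] by simp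
      also have "\<dots> \<le> T (e o\<^sub>L a o\<^sub>L e) y \<bullet> y" by (rule e(5)[OF a])
      also have "\<dots> \<le> T a y \<bullet> y" by (rule T_corner_le[OF e(1,2) a])
      finally show ?thesis using d by (simp add: add_increasing2)
    qed
    then show "\<exists>ys. \<forall>a\<in>M. psd a \<longrightarrow> a (e x) \<bullet> e x \<le> (\<Sum>y\<leftarrow>ys. T a y \<bullet> y) + d * norm a" by blast
  qed
  ultimately show "\<exists>e. is_proj e \<and> blinfun_apply e x \<noteq> 0 \<and> e x \<in> dominated (\<lambda>a. a) T"
    using e(2) by blast
qed

end

subsection \<open>Projections with nearby traces\<close>

context real_center_trace
begin

text \<open>Let \<open>r\<close> and \<open>s\<close> be the initial and final projections of the
  \<open>v\<close> from \<open>comparison\<close>. The remainders \<open>p - r\<close> and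
  \<open>q - s\<close> have equal traces and live on \<open>z\<close> and on its complement
  respectively. So both traces vanish, and faithfulness applies.\<close>

lemma equivalent_of_T_eq:
  assumes p: "p \<in> M" "is_proj p" and q: "q \<in> M" "is_proj q" and eq: "T p = T q"
  obtains v where "v \<in> M" "real_adj v o\<^sub>L v = p" "v o\<^sub>L real_adj v = q"
proof -
  obtain v z where v: "v \<in> M" "is_proj (real_adj v o\<^sub>L v)" and z: "z \<in> M" "z \<in> N" "is_proj z"
    and pv: "\<And>x. p (real_adj v x) = real_adj v x" and qv: "\<And>x. q (v x) = v x"
    and zq: "\<And>x. z (q x) = z (v (real_adj v x))"
    and zp: "\<And>x. p x - z (p x) = real_adj v (v x) - z (real_adj v (v x))"
    using comparison[OF p q] by metis
  define r where "r = real_adj v o\<^sub>L v"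
  define s where "s = v o\<^sub>L real_adj v"
  have rM: "r \<in> M" and sM: "s \<in> M" unfolding r_def s_def by (intro M_intros v)+
  have rs: "T r = T s" unfolding r_def s_def by (rule T_trace[OF v(1)])
  have rp: "is_proj r" and sp: "is_proj s"
    unfolding r_def s_def by (rule v(2), rule partial_isometry_final(1)[OF v(2)])
  have pr: "is_proj (p - r)" by (rule is_proj_diff(2)[OF p(2) rp]) (simp add: r_def pv)
  have qs: "is_proj (q - s)" by (rule is_proj_diff(2)[OF q(2) sp]) (simp add: s_def qv)
  have prM: "p - r \<in> M" and qsM: "q - s \<in> M" by (intro M_intros p q rM sM)+
  have zc: "(p - r) (z x) = z ((p - r) x)" for x by (rule MN_commute[OF prM z(2)])
  have zpr: "is_proj (z o\<^sub>L (p - r))"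
    by (rule is_projI)
      (simp_all only: blinfun_apply_blinfun_compose is_proj_inner[OF z(3)] is_proj_inner[OF pr] zc
        is_proj_idem[OF z(3)] is_proj_idem[OF pr])
  have "z o\<^sub>L (q - s) = 0"
    by (rule blinfun_eqI) (simp add: blinfun.diff_left blinfun.diff_right s_def zq)
  then have "z o\<^sub>L T (q - s) = 0" using T_central[OF z(1,2) qsM] by (simp add: T_zero)
  moreover have TT: "T (q - s) = T (p - r)" using p q rM sM eq rs by (simp add: T_diff)
  ultimately have "T (z o\<^sub>L (p - r)) = 0" using T_central[OF z(1,2) prM] by simp
  then have "z o\<^sub>L (p - r) = 0" by (rule T_faithful[OF compose_M[OF z(1) prM] psd_is_proj[OF zpr]])
  then have "z (p x - r x) = 0" for x
    by (metis blinfun.diff_left blinfun_apply_blinfun_compose zero_blinfun.rep_eq)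
  then have "z (p x) = z (r x)" for x by (simp add: blinfun.diff_right)
  then have "p x = r x" for x using zp[of x] by (simp add: r_def)
  then have p_eq: "r = p" by (intro blinfun_eqI) simp
  then have "T (q - s) = 0" using TT by (simp add: T_zero)
  then have "q - s = 0" by (rule T_faithful[OF qsM psd_is_proj[OF qs]])
  then have "s = q" by simp
  with v(1) p_eq show thesis unfolding r_def s_def by (rule that)
qed

text \<open>By comparison, \<open>q\<close> is equivalent to some \<open>q'\<close> which lies below \<open>p\<close> on a central projection
  \<open>z\<close> and above \<open>p\<close> on its complement. Then \<open>e = |q' - p|\<close> is a projection and
  \<open>T e = |T q - T p|\<close>.\<close>

lemma equivalent_nearby_projection:
  assumes p: "p \<in> M" "is_proj p" and q: "q \<in> M" "is_proj q"
  obtains w e where "w \<in> M" "real_adj w o\<^sub>L w = q" "e \<in> M" "is_proj e"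
    "\<And>x. norm ((w o\<^sub>L real_adj w) x - p x) = norm (e x)"
    "\<And>y. T e y \<bullet> y \<le> norm (T q y - T p y) * norm y"
proof -
  obtain v z where v: "v \<in> M" "is_proj (real_adj v o\<^sub>L v)" and z: "z \<in> M" "z \<in> N" "is_proj z"
    and pv: "\<And>x. p (real_adj v x) = real_adj v x" and qv: "\<And>x. q (v x) = v x"
    and zq: "\<And>x. z (q x) = z (v (real_adj v x))"
    and zp: "\<And>x. p x - z (p x) = real_adj v (v x) - z (real_adj v (v x))"
    using comparison[OF p q] by metis
  note vi = partial_isometry_initial[OF v(2)] and vf = partial_isometry_final(2)[OF v(2)]
  define r where "r = real_adj v o\<^sub>L v"
  define s where "s = v o\<^sub>L real_adj v"
  have rx: "r x = real_adj v (v x)" and sx: "s x = v (real_adj v x)" for x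
    by (simp_all add: r_def s_def)
  have rM: "r \<in> M" and sM: "s \<in> M" unfolding r_def s_def by (intro M_intros v)+
  have rp: "is_proj r" and sp: "is_proj s"
    unfolding r_def s_def by (rule v(2), rule partial_isometry_final(1)[OF v(2)])
  \<comment> \<open>The complements of \<open>r\<close> and \<open>s\<close> have equal traces, so
    \<open>equivalent_of_T_eq\<close> supplies a \<open>w0\<close> that completes the adjoint of
    \<open>v\<close> to an isometry \<open>u\<close> carrying \<open>s\<close> to
    \<open>r\<close>.\<close>
  have "T (id_blinfun - s) = T (id_blinfun - r)"
    using T_trace[OF v(1)] rM sM by (simp add: T_diff r_def s_def)
  then obtain w0 where w0: "w0 \<in> M" "real_adj w0 o\<^sub>L w0 = id_blinfun - s"
    "w0 o\<^sub>L real_adj w0 = id_blinfun - r"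
    using equivalent_of_T_eq[of "id_blinfun - s" "id_blinfun - r"] rM sM rp sp
    by (metis diff_M id_M is_proj_compl)
  have w0p: "is_proj (real_adj w0 o\<^sub>L w0)" unfolding w0(2) by (rule is_proj_compl[OF sp])
  have ww: "real_adj w0 (w0 x) = x - s x" "w0 (real_adj w0 x) = x - r x" for x
    using arg_cong[OF w0(2), of "\<lambda>a. blinfun_apply a x"] arg_cong[OF w0(3), of "\<lambda>a. blinfun_apply a x"]
    by (simp_all add: blinfun.diff_left)
  have rw0: "r (w0 x) = 0" for x
    using partial_isometry_initial[OF w0p, of x] ww(2)[of "w0 x"] by simp
  have sw0: "s (real_adj w0 x) = 0" for x
    using partial_isometry_final(2)[OF w0p, of x] ww(1)[of "real_adj w0 x"] by simp
  have vw0: "v (w0 x) = 0" for x using vi[of "w0 x"] rw0[of x] by (simp add: rx)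
  have w0v: "w0 (v x) = 0" for x
    by (rule vector_eq_rdot[THEN iffD1], rule allI)
      (metis inner_zero_left inner_zero_right is_proj_inner real_adj_left real_adj_right sp sw0 sx vi)
  have vaw0: "real_adj v (real_adj w0 x) = 0" for x
    using vf[of "real_adj w0 x"] sw0[of x] by (simp add: sx)
  have w0av: "real_adj w0 (real_adj v x) = 0" for x
    by (rule vector_eq_rdot[THEN iffD1], rule allI) (simp add: real_adj_left vw0)
  define u where "u = real_adj v + w0"
  have uM: "u \<in> M" unfolding u_def by (intro M_intros v w0)
  have ux: "u x = real_adj v x + w0 x" and uax: "real_adj u x = v x + real_adj w0 x" for x
    by (simp_all add: u_def real_adj_add blinfun.add_left)
  have uu: "real_adj u (u x) = x" for x
    by (simp add: ux uax blinfun.add_right vw0 w0av ww flip: sx)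
  define w where "w = u o\<^sub>L q"
  have wM: "w \<in> M" unfolding w_def by (intro M_intros uM q)
  have wq: "real_adj w o\<^sub>L w = q"
    by (rule blinfun_eqI) (simp add: w_def real_adj_compose uu is_proj_adj[OF q(2)] is_proj_idem[OF q(2)])
  have wp: "is_proj (real_adj w o\<^sub>L w)" unfolding wq by (rule q(2))
  define q' where "q' = w o\<^sub>L real_adj w"
  have q'M: "q' \<in> M" unfolding q'_def by (intro M_intros wM)
  have q'p: "is_proj q'" unfolding q'_def by (rule partial_isometry_final(1)[OF wp])
  have q'x: "q' x = u (q (real_adj u x))" for x
    by (simp add: q'_def w_def real_adj_compose is_proj_adj[OF q(2)] is_proj_idem[OF q(2)])
  have Tq': "T q' = T q" using T_trace[OF wM] by (simp add: q'_def wq)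
  have zu: "z (u x) = u (z x)" for x using MN_commute[OF uM z(2), of x] by simp
  have usu: "u (s (real_adj u x)) = r x" for x
    by (simp add: ux uax blinfun.add_right sx vf vaw0 vi w0v rx)
  \<comment> \<open>On \<open>z\<close>, \<open>q\<close> equals \<open>s\<close>, so its copy
    \<open>q'\<close> equals \<open>r\<close>, which lies below \<open>p\<close>. Off
    \<open>z\<close>, \<open>p\<close> equals \<open>r\<close>, which lies below \<open>q'\<close>
    by \<open>q'r\<close>.\<close>
  have zq': "z (q' x) = z (r x)" for x
  proof -
    have "z (q' x) = u (z (s (real_adj u x)))" by (simp add: q'x zu zq sx)
    also have "\<dots> = z (r x)" by (simp add: usu flip: zu)
    finally show ?thesis .
  qed
  have "q (s x) = s x" for x by (simp add: sx qv)
  moreover have "real_adj u (r x) = s (real_adj u x)" for x using uu by (metis usu)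
  ultimately have q'r: "q' (r x) = r x" for x by (simp add: q'x usu)
  have pr: "is_proj (p - r)" by (rule is_proj_diff(2)[OF p(2) rp]) (simp add: rx pv)
  have qr: "is_proj (q' - r)" by (rule is_proj_diff(2)[OF q'p rp q'r])
  \<comment> \<open>The central symmetry that is -1 on \<open>z\<close> and 1 off \<open>z\<close>.
    It turns \<open>q' - p\<close> into its absolute value, preserves norms and can be pulled out of
    \<open>T\<close>.\<close>
  define g where "g = id_blinfun - 2 *\<^sub>R z"
  have gM: "g \<in> M" and gN: "g \<in> N" unfolding g_def by (intro M_intros z, intro diff_N scaleR_N id_N z)
  have ng: "norm (g x) = norm x" for x
  proof -
    have "(norm (g x))\<^sup>2 = (norm x)\<^sup>2"
      using is_proj_inner_self[OF z(3), of x]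
      by (simp add: g_def blinfun.diff_left blinfun.scaleR_left power2_norm_eq_inner inner_diff_left
          inner_diff_right inner_commute)
    then show ?thesis by simp
  qed
  define e where "e = g o\<^sub>L (q' - p)"
  have eM: "e \<in> M" unfolding e_def by (intro M_intros gM q'M p)
  have zc: "(p - r) (z x) = z ((p - r) x)" "(q' - r) (z x) = z ((q' - r) x)" for x
    by (rule MN_commute[OF _ z(2)], intro M_intros p rM q'M)+
  have zi: "is_proj (id_blinfun - z)" by (rule is_proj_compl[OF z(3)])
  have ziN: "id_blinfun - z \<in> N" by (intro diff_N id_N z)
  have zic: "(q' - r) ((id_blinfun - z) x) = (id_blinfun - z) ((q' - r) x)" for x
    by (rule MN_commute[OF _ ziN], intro M_intros rM q'M)
  have A: "is_proj (z o\<^sub>L (p - r))"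
    by (rule is_projI)
      (simp_all only: blinfun_apply_blinfun_compose is_proj_inner[OF z(3)] is_proj_inner[OF pr] zc
        is_proj_idem[OF z(3)] is_proj_idem[OF pr])
  have B: "is_proj ((id_blinfun - z) o\<^sub>L (q' - r))"
    by (rule is_projI)
      (simp_all only: blinfun_apply_blinfun_compose is_proj_inner[OF zi] is_proj_inner[OF qr] zic
        is_proj_idem[OF zi] is_proj_idem[OF qr])
  have zz0: "z ((id_blinfun - z) x) = 0" for x
    by (simp add: blinfun.diff_left blinfun.diff_right is_proj_idem[OF z(3)])
  have "(z o\<^sub>L (p - r)) (((id_blinfun - z) o\<^sub>L (q' - r)) x) = 0" for x
    by (simp only: blinfun_apply_blinfun_compose flip: zc(1)) (simp only: zz0 blinfun.zero_right)
  from is_proj_add(2)[OF A B this]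
  have "is_proj ((z o\<^sub>L (p - r)) + ((id_blinfun - z) o\<^sub>L (q' - r)))" .
  also have "(z o\<^sub>L (p - r)) + ((id_blinfun - z) o\<^sub>L (q' - r)) = e"
  proof (rule blinfun_eqI)
    fix x
    have "p x = z (p x) + (r x - z (r x))" using zp[of x] by (simp add: rx algebra_simps)
    then show "((z o\<^sub>L (p - r)) + ((id_blinfun - z) o\<^sub>L (q' - r))) x = e x"
      by (simp add: e_def g_def blinfun.bilinear_simps zq' scaleR_2 algebra_simps)
  qed
  finally have ep: "is_proj e" .
  show thesis
  proof (rule that[OF wM wq eM ep])
    show "norm ((w o\<^sub>L real_adj w) x - p x) = norm (e x)" for x
      by (simp add: e_def ng blinfun.diff_left flip: q'_def)
    fix y
    have "T e = g o\<^sub>L (T q - T p)"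
      unfolding e_def using T_central[OF gM gN diff_M[OF q'M p(1)]] by (simp add: T_diff q'M p Tq')
    then have "T e y \<bullet> y = g (T q y - T p y) \<bullet> y" by (simp add: blinfun.diff_left)
    also have "\<dots> \<le> norm (g (T q y - T p y)) * norm y" by (rule norm_cauchy_schwarz)
    finally show "T e y \<bullet> y \<le> norm (T q y - T p y) * norm y" by (simp only: ng)
  qed
qed

text \<open>Kadison's inequality \<open>T b\<^sup>2 \<le> T (b\<^sup>2)\<close>, from \<open>0 \<le> T ((b - T b)\<^sup>2)\<close>.\<close>

lemma T_square_le:
  assumes b: "b \<in> M" "self_adj b" and Tb: "self_adj (T b)"
  shows "(norm (T b x))\<^sup>2 \<le> T (b o\<^sub>L b) x \<bullet> x"
proof -
  define c where "c = T b"
  have c: "c \<in> M" "c \<in> N" unfolding c_def using T_M T_N b by blast+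
  have "psd (real_adj (b - c) o\<^sub>L (b - c))" by (rule psd_square)
  moreover have "real_adj (b - c) = b - c"
    using self_adj_diff[OF b(2) Tb] by (simp add: c_def self_adj_iff)
  ultimately have "psd ((b - c) o\<^sub>L (b - c))" by simp
  moreover have "(b - c) o\<^sub>L (b - c) = (b o\<^sub>L b) + (c o\<^sub>L c) - 2 *\<^sub>R (c o\<^sub>L b)"
    using MN_commute[OF b(1) c(2)]
    by (intro blinfun_eqI) (simp add: blinfun.bilinear_simps scaleR_2 algebra_simps)
  ultimately have "psd (T ((b o\<^sub>L b) + (c o\<^sub>L c) - 2 *\<^sub>R (c o\<^sub>L b)))"
    by (intro T_psd M_intros b c) simp
  moreover have "T (c o\<^sub>L c) = c o\<^sub>L c"
  proof -
    have "T (c o\<^sub>L (c o\<^sub>L id_blinfun)) = c o\<^sub>L (c o\<^sub>L id_blinfun)"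
      using T_central[OF c] c by (simp add: compose_M T_id)
    moreover have "c o\<^sub>L (c o\<^sub>L id_blinfun) = c o\<^sub>L c" by (rule blinfun_eqI) simp
    ultimately show ?thesis by simp
  qed
  moreover have "T (c o\<^sub>L b) = c o\<^sub>L c" using T_central[OF c b(1)] by (simp add: c_def)
  ultimately have "psd (T (b o\<^sub>L b) + (c o\<^sub>L c) - 2 *\<^sub>R (c o\<^sub>L c))"
    by (simp add: T_diff T_add T_scaleR b c compose_M add_M scaleR_M)
  from psd_nonneg[OF this, of x] have "c (c x) \<bullet> x \<le> T (b o\<^sub>L b) x \<bullet> x"
    by (simp add: blinfun.bilinear_simps inner_diff_left inner_add_left)
  moreover have "c (c x) \<bullet> x = (norm (c x))\<^sup>2"
    using self_adjD[OF Tb, of "c x" x] by (simp add: c_def power2_norm_eq_inner)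
  ultimately show ?thesis by (simp add: c_def)
qed

text \<open>For \<open>b = q - p\<close>, \<open>T_square_le\<close> bounds \<open>T b x\<close>
  through \<open>T (b b)\<close>, and \<open>T_normal\<close> bounds the latter through the norms of
  finitely many \<open>b y\<close>.\<close>

lemma T_continuous_on_projections:
  assumes e: "0 < e"
  obtains J d where "finite J" "0 < d"
    "\<And>p q. p \<in> M \<Longrightarrow> is_proj p \<Longrightarrow> q \<in> M \<Longrightarrow> is_proj q \<Longrightarrow>
      \<forall>y\<in>J. norm (blinfun_apply q y - p y) < d \<Longrightarrow> norm (T q x - T p x) < e"
proof -
  \<comment> \<open>The square of \<open>q - p\<close> has norm at most 4, so the error is at most
    \<open>e\<^sup>2 / 2\<close>; the sum takes the other half.\<close>
  have e8: "0 < e\<^sup>2 / 8" using e by simp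
  obtain ys where ys: "\<And>a. a \<in> M \<Longrightarrow> psd a \<Longrightarrow> T a x \<bullet> x \<le> (\<Sum>y\<leftarrow>ys. a y \<bullet> y) + e\<^sup>2 / 8 * norm a"
    using dominatedD[OF T_normal e8] by blast
  define d where "d = sqrt (e\<^sup>2 / (4 * (real (length ys) + 1)))"
  have d: "0 < d" using e by (simp add: d_def)
  have d2: "real (length ys) * d\<^sup>2 < e\<^sup>2 / 2"
  proof -
    have "d\<^sup>2 = e\<^sup>2 / (4 * (real (length ys) + 1))" by (simp add: d_def)
    then have "(4 * (real (length ys) + 1)) * d\<^sup>2 = e\<^sup>2" by simp
    then have "4 * (real (length ys) * d\<^sup>2) + 4 * d\<^sup>2 = e\<^sup>2" by (simp add: algebra_simps)
    then show ?thesis using zero_le_power2[of d] zero_less_power[OF e, of 2] by linarith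
  qed
  show thesis
  proof (rule that[of "set ys" d])
    fix p q assume p: "p \<in> M" "is_proj p" and q: "q \<in> M" "is_proj q"
      and close: "\<forall>y\<in>set ys. norm (blinfun_apply q y - p y) < d"
    let ?b = "q - p"
    have bM: "?b \<in> M" by (intro M_intros p q)
    have sb: "self_adj ?b" using p q by (intro self_adj_diff) (simp_all add: is_proj_def)
    then have adjb: "real_adj ?b = ?b" by (simp add: self_adj_iff)
    have "self_adj (T ?b)"
      unfolding T_diff[OF q(1) p(1)] by (intro self_adj_diff psd_self_adj T_psd psd_is_proj p q)
    then have "(norm (T ?b x))\<^sup>2 \<le> T (?b o\<^sub>L ?b) x \<bullet> x" by (rule T_square_le[OF bM sb])
    also have "\<dots> \<le> (\<Sum>y\<leftarrow>ys. (?b o\<^sub>L ?b) y \<bullet> y) + e\<^sup>2 / 8 * norm (?b o\<^sub>L ?b)"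
      using psd_square[of ?b] by (intro ys M_intros bM p q) (simp add: adjb)
    also have "(\<Sum>y\<leftarrow>ys. (?b o\<^sub>L ?b) y \<bullet> y) \<le> (\<Sum>y\<leftarrow>ys. d\<^sup>2)"
    proof (rule sum_list_mono)
      fix y assume "y \<in> set ys"
      then have "norm (?b y) \<le> d" using close by (simp add: blinfun.diff_left less_imp_le)
      then have "(norm (?b y))\<^sup>2 \<le> d\<^sup>2" by (intro power_mono) simp_all
      then show "(?b o\<^sub>L ?b) y \<bullet> y \<le> d\<^sup>2"
        using self_adjD[OF sb, of "?b y" y] by (simp add: power2_norm_eq_inner)
    qed
    also have "(\<Sum>y\<leftarrow>ys. d\<^sup>2) < e\<^sup>2 / 2" using d2 by (simp add: sum_list_triv)
    also have "e\<^sup>2 / 8 * norm (?b o\<^sub>L ?b) \<le> e\<^sup>2 / 8 * (2 * 2)"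
    proof (rule mult_left_mono)
      have "norm ?b \<le> 2"
        using norm_triangle_ineq4[of q p] is_proj_norm[OF p(2)] is_proj_norm[OF q(2)] by linarith
      then have "norm ?b * norm ?b \<le> 2 * 2" by (intro mult_mono) simp_all
      then show "norm (?b o\<^sub>L ?b) \<le> 2 * 2" by (rule order_trans[OF norm_blinfun_compose])
    qed simp
    finally have "(norm (T ?b x))\<^sup>2 < e\<^sup>2" by simp
    then have "norm (T ?b x) < e" using e by (intro power_less_imp_less_base[of _ 2 e]) simp_all
    then show "norm (T q x - T p x) < e" by (simp add: T_diff p q blinfun.diff_left)
  qed (use d in simp_all)
qed

text \<open>The square of \<open>norm (p x)\<close> is the form of \<open>p\<close> at
  \<open>x\<close>, which \<open>vector_dominated_by_T\<close> controls by finitely many traces. The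
  bound \<open>d * norm y\<close> matches the estimate in
  \<open>equivalent_nearby_projection\<close>.\<close>

lemma small_trace_small_projection:
  assumes "finite I" "0 < e"
  shows "\<exists>J d. finite J \<and> 0 < d \<and> (\<forall>p\<in>M. is_proj p \<longrightarrow>
    (\<forall>y\<in>J. T p y \<bullet> y \<le> d * norm y) \<longrightarrow> (\<forall>x\<in>I. norm (blinfun_apply p x) < e))"
  using assms(1)
proof (induction I rule: finite_induct)
  case empty
  then show ?case by (intro exI[of _ "{}"] exI[of _ 1]) simp
next
  case (insert x I)
  then obtain J d where Jd: "finite J" "0 < d" "\<And>p. p \<in> M \<Longrightarrow> is_proj p \<Longrightarrow>
      \<forall>y\<in>J. T p y \<bullet> y \<le> d * norm y \<Longrightarrow> \<forall>x\<in>I. norm (blinfun_apply p x) < e" by blast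
  have e4: "0 < e\<^sup>2 / 4" using assms(2) by simp
  obtain ys where ys: "\<And>a. a \<in> M \<Longrightarrow> psd a \<Longrightarrow> a x \<bullet> x \<le> (\<Sum>y\<leftarrow>ys. T a y \<bullet> y) + e\<^sup>2 / 4 * norm a"
    using dominatedD[OF vector_dominated_by_T e4] by blast
  \<comment> \<open>The sum of traces is at most \<open>d' * S\<close>, a quarter of
    \<open>e\<^sup>2\<close>, and the error term is another quarter. The \<open>+ 1\<close> in
    \<open>d'\<close> covers \<open>S = 0\<close>.\<close>
  define S where "S = (\<Sum>y\<leftarrow>ys. norm y)"
  have S: "0 \<le> S" unfolding S_def by (intro sum_list_nonneg) auto
  define d' where "d' = e\<^sup>2 / (4 * (S + 1))"
  have d': "0 < d'" using assms(2) S by (simp add: d'_def)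
  have "d' * (4 * (S + 1)) = e\<^sup>2" using S by (simp add: d'_def)
  then have d'S: "d' * S \<le> e\<^sup>2 / 4" using d' by (simp add: algebra_simps)
  show ?case
  proof (intro exI conjI ballI impI)
    show "finite (J \<union> set ys)" "0 < min d d'" using Jd d' by simp_all
    fix p w assume p: "p \<in> M" "is_proj p" and small: "\<forall>y\<in>J \<union> set ys. T p y \<bullet> y \<le> min d d' * norm y"
      and w: "w \<in> insert x I"
    have sm: "T p y \<bullet> y \<le> d * norm y" if "y \<in> J" for y
      using small that mult_right_mono[OF min.cobounded1[of d d'] norm_ge_zero[of y]] by force
    have sm': "T p y \<bullet> y \<le> d' * norm y" if "y \<in> set ys" for y
      using small that mult_right_mono[OF min.cobounded2[of d d'] norm_ge_zero[of y]] by force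
    have "(norm (p x))\<^sup>2 = p x \<bullet> x" by (rule is_proj_inner_self[OF p(2), symmetric])
    also have "\<dots> \<le> (\<Sum>y\<leftarrow>ys. T p y \<bullet> y) + e\<^sup>2 / 4 * norm p" by (rule ys[OF p(1) psd_is_proj[OF p(2)]])
    also have "(\<Sum>y\<leftarrow>ys. T p y \<bullet> y) \<le> (\<Sum>y\<leftarrow>ys. d' * norm y)" by (intro sum_list_mono sm')
    also have "(\<Sum>y\<leftarrow>ys. d' * norm y) = d' * S" by (simp add: S_def sum_list_const_mult)
    also have "d' * S \<le> e\<^sup>2 / 4" by (rule d'S)
    also have "e\<^sup>2 / 4 * norm p \<le> e\<^sup>2 / 4 * 1" by (intro mult_left_mono is_proj_norm p) simp
    finally have "(norm (p x))\<^sup>2 < e\<^sup>2" using zero_less_power[OF assms(2), of 2] by linarith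
    then have "norm (p x) < e" using assms(2) by (intro power_less_imp_less_base[of _ 2 e]) simp_all
    moreover have "\<forall>x\<in>I. norm (blinfun_apply p x) < e" using Jd(3)[OF p] sm by blast
    ultimately show "norm (blinfun_apply p w) < e" using w by blast
  qed
qed

text \<open>The local form of openness: \<open>w\<close> leads from \<open>q\<close> to a
  representative of its class that is close to \<open>p\<close>.\<close>

lemma nearby_trace_nearby_projection:
  assumes p: "p \<in> M" "is_proj p" and "finite I" "0 < e"
  obtains J d where "finite J" "0 < d"
    "\<And>q. q \<in> M \<Longrightarrow> is_proj q \<Longrightarrow> \<forall>y\<in>J. norm (T q y - T p y) < d \<Longrightarrow>
      \<exists>w\<in>M. real_adj w o\<^sub>L w = q \<and> (\<forall>x\<in>I. norm ((w o\<^sub>L real_adj w) x - p x) < e)"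
proof -
  obtain J d where Jd: "finite J" "0 < d" "\<And>e'. e' \<in> M \<Longrightarrow> is_proj e' \<Longrightarrow>
      \<forall>y\<in>J. T e' y \<bullet> y \<le> d * norm y \<Longrightarrow> \<forall>x\<in>I. norm (blinfun_apply e' x) < e"
    using small_trace_small_projection[OF assms(3,4)] by blast
  show thesis
  proof (rule that[OF Jd(1,2)])
    fix q assume q: "q \<in> M" "is_proj q" and close: "\<forall>y\<in>J. norm (T q y - T p y) < d"
    obtain w e' where w: "w \<in> M" "real_adj w o\<^sub>L w = q" "e' \<in> M" "is_proj e'"
      "\<And>x. norm ((w o\<^sub>L real_adj w) x - p x) = norm (e' x)"
      "\<And>y. T e' y \<bullet> y \<le> norm (T q y - T p y) * norm y"
      using equivalent_nearby_projection[OF p q] by metis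
    have "T e' y \<bullet> y \<le> d * norm y" if "y \<in> J" for y
      by (rule order_trans[OF w(6)]) (use close that in \<open>simp add: mult_right_mono less_imp_le\<close>)
    then have "\<forall>x\<in>I. norm (blinfun_apply e' x) < e" using Jd(3)[OF w(3,4)] by blast
    then show "\<exists>w\<in>M. real_adj w o\<^sub>L w = q \<and> (\<forall>x\<in>I. norm ((w o\<^sub>L real_adj w) x - p x) < e)"
      using w by (intro bexI[of _ w]) auto
  qed
qed

end

subsection \<open>The strong operator topology\<close>

lemma openin_sot_ball:
  assumes "finite J"
  shows "openin strong_operator_topology {t. \<forall>y\<in>J. norm (blinfun_apply t y - p y) < d}"
  using strong_operator_topology_basis[of J "\<lambda>y. ball (p y) d" "\<lambda>y. y"] assms
  by (simp add: dist_norm norm_minus_commute)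

lemma openin_sot_contains_ball:
  fixes p :: "'a :: real_normed_vector \<Rightarrow>\<^sub>L 'b :: real_normed_vector"
  assumes U: "openin strong_operator_topology U" and p: "p \<in> U"
  obtains J d where "finite J" "0 < d" "{t. \<forall>y\<in>J. norm (blinfun_apply t y - p y) < d} \<subseteq> U"
proof -
  obtain V where V: "open V" "U = blinfun_apply -` V"
    using U unfolding strong_operator_topology_def openin_pullback_topology by auto
  have "openin (product_topology (\<lambda>i. euclidean) UNIV) V" "blinfun_apply p \<in> V"
    using V p by (simp_all add: open_fun_def)
  from product_topology_open_contains_basis[OF this]
  obtain X where X: "blinfun_apply p \<in> (\<Pi>\<^sub>E i\<in>UNIV. X i)" "\<And>i. open (X i)" "finite {i. X i \<noteq> UNIV}"
    "(\<Pi>\<^sub>E i\<in>UNIV. X i) \<subseteq> V" by auto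
  define J where "J = {i. X i \<noteq> UNIV}"
  have "\<exists>r>0. ball (p i) r \<subseteq> X i" for i
    using X(1) X(2)[of i] by (auto simp: open_contains_ball)
  then obtain r where r: "\<And>i. 0 < r i" "\<And>i. ball (p i) (r i) \<subseteq> X i" by metis
  \<comment> \<open>The \<open>1\<close> keeps the minimum defined when no coordinate is
    restricted.\<close>
  define d where "d = Min (insert 1 (r ` J))"
  have fin: "finite (insert 1 (r ` J))" using X(3) by (simp add: J_def)
  have d: "0 < d" using fin r(1) by (auto simp: d_def)
  have dr: "d \<le> r i" if "i \<in> J" for i unfolding d_def using fin that by (intro Min_le) auto
  show thesis
  proof (rule that[of J d])
    show "{t. \<forall>y\<in>J. norm (blinfun_apply t y - p y) < d} \<subseteq> U"
    proof
      fix t assume t: "t \<in> {t. \<forall>y\<in>J. norm (blinfun_apply t y - p y) < d}"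
      have "t i \<in> X i" for i
      proof (cases "i \<in> J")
        case True
        then have "norm (t i - p i) < r i" using t dr[OF True] by auto
        then have "t i \<in> ball (p i) (r i)" by (simp add: dist_norm norm_minus_commute)
        with r(2) show ?thesis by blast
      qed (simp add: J_def)
      then have "blinfun_apply t \<in> V" using X(4) by (auto simp: PiE_UNIV_domain)
      then show "t \<in> U" by (simp add: V(2))
    qed
  qed (use X(3) d in \<open>simp_all add: J_def\<close>)
qed

lemma closedin_sot_singleton: "closedin strong_operator_topology {t}"
proof -
  have "{t} = (\<Inter>x. {a \<in> topspace strong_operator_topology. blinfun_apply a x \<in> {t x}})"
    by (auto simp: strong_operator_topology_topspace intro: blinfun_eqI)
  moreover have "closedin strong_operator_topology
      (\<Inter>x. {a \<in> topspace strong_operator_topology. blinfun_apply a x \<in> {t x}})"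
    by (intro closedin_INT closedin_continuous_map_preimage[OF strong_operator_topology_continuous_evaluation])
      auto
  ultimately show ?thesis by simp
qed

subsection \<open>Reduction to real-linear operators\<close>

instance chilbert_space \<subseteq> banach ..

lemma Im_cinner: "Im (cinner x y) = - (x \<bullet> (\<i> *\<^sub>C y))"
  for x y :: "'a :: chilbert_space"
proof -
  have "x \<bullet> (\<i> *\<^sub>C y) = Re (\<i> * cinner x y)" by (simp add: cinner_scaleC_right flip: Re_cinner)
  then show ?thesis by simp
qed

lemma bounded_ops_scaleC: "a \<in> bounded_ops \<Longrightarrow> a (c *\<^sub>C x) = c *\<^sub>C a x"
  by (simp add: bounded_ops_def)

lemma cinner_real_adj:
  fixes a :: "'a :: chilbert_space \<Rightarrow>\<^sub>L 'a"
  assumes "a \<in> bounded_ops"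
  shows "cinner (real_adj a x) y = cinner x (a y)"
  by (rule complex_eqI)
    (simp_all add: Re_cinner Im_cinner real_adj_left bounded_ops_scaleC[OF assms])

lemma adj_eq_real_adj:
  fixes a :: "'a :: chilbert_space \<Rightarrow>\<^sub>L 'a"
  assumes "a \<in> bounded_ops"
  shows "adj a = real_adj a"
  unfolding adj_def
proof (rule the_equality)
  show "\<forall>x y. cinner (real_adj a x) y = cinner x (a y)" using cinner_real_adj[OF assms] by blast
  fix b :: "'a \<Rightarrow>\<^sub>L 'a" assume b: "\<forall>x y. cinner (b x) y = cinner x (a y)"
  then have "b x \<bullet> y = x \<bullet> a y" for x y by (metis Re_cinner)
  then show "b = real_adj a" by (rule real_adj_eqI[symmetric])
qed

lemma inner_scaleC_i: "(\<i> *\<^sub>C x) \<bullet> y = - (x \<bullet> (\<i> *\<^sub>C y))"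
  for x y :: "'a :: chilbert_space"
proof -
  have "(\<i> *\<^sub>C x) \<bullet> y = Re (\<i> * cinner y x)" by (simp add: cinner_scaleC_right inner_commute flip: Re_cinner)
  also have "\<dots> = Im (cinner x y)" by (subst cinner_commute) simp
  finally show ?thesis by (simp add: Im_cinner)
qed

lemma scaleC_i_i: "\<i> *\<^sub>C \<i> *\<^sub>C x = - x"
  for x :: "'a :: chilbert_space"
  using scaleC_of_real[of "-1" x] by (simp add: scaleC_scaleC)

lemma positive_op_iff_psd:
  fixes a :: "'a :: chilbert_space \<Rightarrow>\<^sub>L 'a"
  assumes a: "a \<in> bounded_ops"
  shows "positive_op a \<longleftrightarrow> psd a"
proof
  assume "positive_op a"
  then have pos: "0 \<le> x \<bullet> a x" and im: "x \<bullet> (\<i> *\<^sub>C a x) = 0" for x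
    unfolding positive_op_def complex_nonneg_Reals_iff Re_cinner Im_cinner by simp_all
  \<comment> \<open>Polarizing the vanishing imaginary part gives a skew form; replacing
    \<open>x\<close> by \<open>\<i> *\<^sub>C x\<close> then turns skewness into the symmetry of
    \<open>a\<close>.\<close>
  have skew: "x \<bullet> (\<i> *\<^sub>C a y) = - (y \<bullet> (\<i> *\<^sub>C a x))" for x y
    using im[of "x + y"] im[of x] im[of y]
    by (simp add: blinfun.add_right scaleC_add_right inner_add_left inner_add_right)
  have "a x \<bullet> y = x \<bullet> a y" for x y
  proof -
    have "(\<i> *\<^sub>C x) \<bullet> (\<i> *\<^sub>C a y) = - (y \<bullet> (\<i> *\<^sub>C a (\<i> *\<^sub>C x)))" by (rule skew)
    then show ?thesis
      by (simp add: inner_scaleC_i scaleC_i_i bounded_ops_scaleC[OF a] inner_commute)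
  qed
  then show "psd a" using pos by (simp add: psd_def self_adj_def inner_commute)
next
  assume p: "psd a"
  then have "real_adj a = a" using psd_self_adj self_adj_iff by blast
  then have "cinner (a x) x = cinner x (a x)" for x using cinner_real_adj[OF a, of x x] by simp
  then have "cinner x (a x) = cnj (cinner x (a x))" for x by (metis cinner_commute)
  then have "Im (cinner x (a x)) = 0" for x by (metis Reals_cnj_iff complex_is_Real_iff)
  then show "positive_op a"
    using a psd_nonneg[OF p]
    unfolding positive_op_def complex_nonneg_Reals_iff Re_cinner by (simp add: inner_commute)
qed

lemma scalar_op_apply [simp]: "scalar_op c x = c *\<^sub>C x"
  by (simp add: scalar_op.rep_eq)

lemma in_commutant_scalar_op:
  fixes a :: "'a :: chilbert_space \<Rightarrow>\<^sub>L 'a"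
  assumes "\<And>c. a o\<^sub>L scalar_op c = scalar_op c o\<^sub>L a"
  shows "a \<in> bounded_ops"
  unfolding bounded_ops_def using compose_eqD[OF assms] by simp

lemma scalar_op_bounded_ops: "scalar_op c \<in> bounded_ops"
  by (simp add: bounded_ops_def scaleC_scaleC mult.commute)

lemma scalar_op_commute: "a \<in> bounded_ops \<Longrightarrow> a o\<^sub>L scalar_op c = scalar_op c o\<^sub>L a"
  by (rule blinfun_eqI) (simp add: bounded_ops_scaleC)

lemma scalar_op_of_real: "scalar_op (complex_of_real r) o\<^sub>L a = r *\<^sub>R a"
  by (rule blinfun_eqI) (simp add: scaleC_of_real blinfun.scaleR_left)

text \<open>The locale takes commutants among all real-linear operators. Commuting with the scalars
  forces complex linearity, so these commutants agree with the complex ones.\<close>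

lemma von_neumann_algebra_real:
  fixes M :: "('a :: chilbert_space \<Rightarrow>\<^sub>L 'a) set"
  assumes "von_neumann_algebra M"
  shows "real_vn_algebra M (commutant M)"
proof -
  have star: "star_subalgebra M" and bic: "commutant (commutant M) = M"
    using assms by (simp_all add: von_neumann_algebra_def)
  have Mb: "M \<subseteq> bounded_ops" and idM: "id_blinfun \<in> M" and adjM: "\<And>a. a \<in> M \<Longrightarrow> adj a \<in> M"
    and scM: "\<And>c a. a \<in> M \<Longrightarrow> scalar_op c o\<^sub>L a \<in> M"
    using star unfolding star_subalgebra_def by blast+
  have scalar_M: "scalar_op c \<in> M" for c
  proof -
    have "scalar_op c o\<^sub>L id_blinfun = (scalar_op c :: 'a \<Rightarrow>\<^sub>L 'a)" by (rule blinfun_eqI) simp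
    with scM[OF idM, of c] show ?thesis by simp
  qed
  have scalar_N: "scalar_op c \<in> commutant M" for c
    unfolding commutant_def using scalar_op_bounded_ops scalar_op_commute Mb by fastforce
  show ?thesis
  proof
    fix a :: "'a \<Rightarrow>\<^sub>L 'a"
    show "a \<in> M \<longleftrightarrow> (\<forall>s\<in>commutant M. a o\<^sub>L s = s o\<^sub>L a)"
    proof
      assume "\<forall>s\<in>commutant M. a o\<^sub>L s = s o\<^sub>L a"
      moreover from this have "a \<in> bounded_ops" by (intro in_commutant_scalar_op) (use scalar_N in blast)
      ultimately have "a \<in> commutant (commutant M)" by (simp add: commutant_def[of "commutant M"])
      then show "a \<in> M" by (simp only: bic)
    qed (auto simp: commutant_def)
    show "a \<in> commutant M \<longleftrightarrow> (\<forall>s\<in>M. a o\<^sub>L s = s o\<^sub>L a)"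
    proof
      assume *: "\<forall>s\<in>M. a o\<^sub>L s = s o\<^sub>L a"
      then have "a \<in> bounded_ops" by (intro in_commutant_scalar_op) (use scalar_M in blast)
      with * show "a \<in> commutant M" by (simp add: commutant_def)
    qed (simp add: commutant_def)
    show "real_adj a \<in> M" if "a \<in> M"
      using adjM[OF that] adj_eq_real_adj[of a] Mb that by auto
  qed
qed

lemma center_valued_trace_real:
  assumes M: "von_neumann_algebra M" and T: "center_valued_trace M T"
  shows "real_center_trace M (commutant M) T"
proof -
  have Mb: "\<And>a. a \<in> M \<Longrightarrow> a \<in> bounded_ops"
    using M unfolding von_neumann_algebra_def star_subalgebra_def by blast
  note T' = T[unfolded center_valued_trace_def center_def]
  interpret real_vn_algebra M "commutant M" by (rule von_neumann_algebra_real[OF M])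
  show ?thesis
  proof
    show TM: "T a \<in> M" and "T a \<in> commutant M" if "a \<in> M" for a using T' that by blast+
    show "T (a + b) = T a + T b" if "a \<in> M" "b \<in> M" for a b using T' that by blast
    show "T (r *\<^sub>R a) = r *\<^sub>R T a" if "a \<in> M" for r a
    proof -
      have "T (scalar_op (complex_of_real r) o\<^sub>L a) = scalar_op (complex_of_real r) o\<^sub>L T a"
        using T' that by blast
      then show ?thesis by (simp only: scalar_op_of_real)
    qed
    show "T (z o\<^sub>L a) = z o\<^sub>L T a" if "z \<in> M" "z \<in> commutant M" "a \<in> M" for z a
      using T' that by blast
    show "psd (T a)" if "a \<in> M" "psd a" for a
    proof -
      have "T a \<in> M" using T' that by blast
      then show ?thesis using T' that positive_op_iff_psd[OF Mb] by blast
    qed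
    show "a = 0" if "a \<in> M" "psd a" "T a = 0" for a
      using T' that positive_op_iff_psd[OF Mb] by blast
    show "T (real_adj a o\<^sub>L a) = T (a o\<^sub>L real_adj a)" if "a \<in> M" for a
      using T' that adj_eq_real_adj[OF Mb[OF that]] by metis
    show "T id_blinfun = id_blinfun" using T' by blast
  qed
qed

theorem theorem3p3:
  fixes M :: "('a :: chilbert_space \<Rightarrow>\<^sub>L 'a) set"
    and T :: "('a \<Rightarrow>\<^sub>L 'a) \<Rightarrow> ('a \<Rightarrow>\<^sub>L 'a)"
  assumes "finite_von_neumann_algebra M"
    and "center_valued_trace M T"
  shows "(\<exists>F. (\<forall>p\<in>projections M. F (mvn_class M p) = T p) \<and>
            embedding_map (QOT M) (subtopology strong_operator_topology (center_pos_ball M)) F) \<and>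
         (\<forall>p\<in>projections M. (QOT M) closure_of {mvn_class M p} = {mvn_class M p})"
proof -
  have vn: "von_neumann_algebra M" using assms(1) by (simp add: finite_von_neumann_algebra_def)
  interpret real_center_trace M "commutant M" T
    by (rule center_valued_trace_real[OF vn assms(2)])
  have Mb: "\<And>a. a \<in> M \<Longrightarrow> a \<in> bounded_ops"
    using vn unfolding von_neumann_algebra_def star_subalgebra_def by blast
  have adj: "adj a = real_adj a" if "a \<in> M" for a by (rule adj_eq_real_adj[OF Mb[OF that]])
  have proj: "p \<in> projections M \<longleftrightarrow> p \<in> M \<and> is_proj p" for p
    using adj by (auto simp: projections_def is_proj_def self_adj_iff)
  have rel: "(p, q) \<in> mvn_rel M \<longleftrightarrow> p \<in> M \<and> is_proj p \<and>
      (\<exists>v\<in>M. real_adj v o\<^sub>L v = p \<and> v o\<^sub>L real_adj v = q)" for p q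
  proof -
    have "is_proj q" if "is_proj p" "real_adj v o\<^sub>L v = p" "v o\<^sub>L real_adj v = q" for v
      using partial_isometry_final(1)[of v] that by simp
    moreover have "q \<in> M" if "v \<in> M" "v o\<^sub>L real_adj v = q" for v
      using compose_M[OF that(1) adj_M[OF that(1)]] that(2) by simp
    ultimately show ?thesis unfolding mvn_rel_def using proj adj by auto
  qed
  have T_eq: "T p = T q \<longleftrightarrow> (p, q) \<in> mvn_rel M" if "p \<in> projections M" "q \<in> projections M" for p q
  proof
    show "(p, q) \<in> mvn_rel M" if "T p = T q"
      using equivalent_of_T_eq[of p q] that \<open>p \<in> projections M\<close> \<open>q \<in> projections M\<close>
      unfolding rel proj by metis
  qed (use rel T_trace in metis)
  \<comment> \<open>On projections the classes are the fibres of \<open>T\<close>, which gives both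
    that the induced map is well defined and that it is injective.\<close>
  have cls: "mvn_class M p = {q \<in> projections M. T p = T q}" if "p \<in> projections M" for p
  proof -
    have "q \<in> projections M" if "(p, q) \<in> mvn_rel M" for q using that by (simp add: mvn_rel_def)
    then show ?thesis using T_eq[OF that] unfolding mvn_class_def by auto
  qed
  have class_eq: "mvn_class M p = mvn_class M q \<longleftrightarrow> T p = T q"
    if "p \<in> projections M" "q \<in> projections M" for p q
    using that by (auto simp: cls)
  \<comment> \<open>\<open>T\<close> of some representative; \<open>class_eq\<close> makes the
    choice immaterial.\<close>
  define F where "F c = T (SOME p. p \<in> projections M \<and> mvn_class M p = c)" for c
  have F: "F (mvn_class M p) = T p" if p: "p \<in> projections M" for p
  proof -
    have "\<exists>q. q \<in> projections M \<and> mvn_class M q = mvn_class M p" using p by blast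
    from someI_ex[OF this] show ?thesis unfolding F_def using class_eq p by metis
  qed
  let ?X = "subtopology strong_operator_topology (projections M)"
  have tX: "topspace ?X = projections M" by (simp add: strong_operator_topology_topspace)
  have qm: "quotient_map ?X (QOT M) (mvn_class M)"
    unfolding QOT_def by (rule quotient_map_quotient_topology)
  have tQ: "topspace (QOT M) = mvn_class M ` projections M"
    unfolding QOT_def topspace_quotient_topology tX ..
  \<comment> \<open>By the universal property of the quotient map, continuity of \<open>F\<close> is
    continuity of \<open>T\<close> on projections, which can be tested at each vector.\<close>
  have "continuous_map ?X strong_operator_topology T"
    unfolding continuous_on_strong_operator_topo_iff_coordinatewise
  proof (intro allI)
    fix x
    show "continuous_map ?X euclidean (\<lambda>p. T p x)"
      unfolding continuous_map_def
    proof (intro conjI allI impI)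
      fix U :: "'a set" assume "openin euclidean U"
      then have U: "open U" by simp
      show "openin ?X {p \<in> topspace ?X. T p x \<in> U}"
        unfolding openin_subopen[of _ "{p \<in> topspace ?X. T p x \<in> U}"]
      proof
        fix p assume "p \<in> {p \<in> topspace ?X. T p x \<in> U}"
        then have p: "p \<in> projections M" "T p x \<in> U" by (simp_all add: tX)
        then obtain e where e: "0 < e" "ball (T p x) e \<subseteq> U" using U open_contains_ball by blast
        obtain J d where J: "finite J" "0 < d"
          "\<And>p q. p \<in> M \<Longrightarrow> is_proj p \<Longrightarrow> q \<in> M \<Longrightarrow> is_proj q \<Longrightarrow>
            \<forall>y\<in>J. norm (blinfun_apply q y - p y) < d \<Longrightarrow> norm (T q x - T p x) < e"
          using T_continuous_on_projections[OF e(1), of x] by metis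
        let ?B = "projections M \<inter> {t. \<forall>y\<in>J. norm (blinfun_apply t y - p y) < d}"
        have "openin ?X ?B" by (rule openin_subtopology_Int2[OF openin_sot_ball[OF J(1)]])
        moreover have "p \<in> ?B" using p(1) J(2) by simp
        moreover have "?B \<subseteq> {p \<in> topspace ?X. T p x \<in> U}"
        proof
          fix q assume q: "q \<in> ?B"
          then have "norm (T q x - T p x) < e" using J(3)[of p q] p(1) by (simp add: proj)
          then have "T q x \<in> ball (T p x) e" by (simp add: dist_norm norm_minus_commute)
          then show "q \<in> {p \<in> topspace ?X. T p x \<in> U}" using e(2) q
            by (auto simp: strong_operator_topology_topspace)
        qed
        ultimately show "\<exists>B. openin ?X B \<and> p \<in> B \<and> B \<subseteq> {p \<in> topspace ?X. T p x \<in> U}" by blast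
      qed
    qed simp
  qed
  then have "continuous_map ?X strong_operator_topology (F \<circ> mvn_class M)"
    by (rule continuous_map_eq) (simp add: F strong_operator_topology_topspace)
  then have Fc: "continuous_map (QOT M) strong_operator_topology F"
    using continuous_compose_quotient_map_eq[OF qm] by blast
  have ball: "T p \<in> center_pos_ball M" if "p \<in> projections M" for p
  proof -
    have p: "p \<in> M" "is_proj p" using that by (simp_all add: proj)
    have "norm (T p) \<le> 1"
      by (rule order_trans[OF norm_T_le[OF p(1) psd_is_proj[OF p(2)]] is_proj_norm[OF p(2)]])
    moreover have "positive_op (T p)"
      using positive_op_iff_psd[OF Mb[OF T_M[OF p(1)]]] T_psd[OF p(1) psd_is_proj[OF p(2)]] by blast
    ultimately show ?thesis using T_M[OF p(1)] T_N[OF p(1)] by (simp add: center_pos_ball_def center_def)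
  qed
  let ?Y = "subtopology strong_operator_topology (center_pos_ball M)"
  let ?S = "F ` topspace (QOT M)"
  have FS: "?S = T ` projections M" unfolding tQ image_image by (rule image_cong[OF refl F])
  have SB: "?S \<subseteq> center_pos_ball M" unfolding FS using ball by blast
  have YS: "subtopology ?Y ?S = subtopology strong_operator_topology ?S"
    using SB by (simp add: subtopology_subtopology Int_absorb1)
  have inj: "inj_on F (topspace (QOT M))"
  proof (rule inj_onI)
    fix c c' assume "c \<in> topspace (QOT M)" "c' \<in> topspace (QOT M)" and eq: "F c = F c'"
    then obtain p q where pq: "p \<in> projections M" "c = mvn_class M p" "q \<in> projections M" "c' = mvn_class M q"
      unfolding tQ by blast
    with eq have "T p = T q" by (simp add: F)
    then show "c = c'" unfolding pq(2,4) class_eq[OF pq(1,3)] .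
  qed
  \<comment> \<open>A projection \<open>q\<close> with \<open>T q\<close> close to
    \<open>T p\<close> may itself be far from \<open>p\<close>, but an equivalent \<open>q'\<close>
    is close; its class is that of \<open>q\<close> and lies in \<open>U\<close>.\<close>
  have "open_map (QOT M) (subtopology strong_operator_topology ?S) F"
    unfolding open_map_def
  proof (intro allI impI)
    fix U assume U: "openin (QOT M) U"
    then have Usub: "U \<subseteq> mvn_class M ` projections M" using openin_subset tQ by blast
    have Up: "openin ?X {q \<in> projections M. mvn_class M q \<in> U}"
      using U unfolding QOT_def openin_quotient_topology tX by blast
    then obtain V where V: "openin strong_operator_topology V"
      "{q \<in> projections M. mvn_class M q \<in> U} = V \<inter> projections M"
      unfolding openin_subtopology by blast
    show "openin (subtopology strong_operator_topology ?S) (F ` U)"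
      unfolding openin_subopen[of _ "F ` U"]
    proof
      fix t assume "t \<in> F ` U"
      then obtain p where p: "p \<in> projections M" "mvn_class M p \<in> U" "t = T p"
        using Usub F by blast
      then have "p \<in> V" using V(2) by blast
      obtain I e where I: "finite I" "0 < e" "{q. \<forall>x\<in>I. norm (blinfun_apply q x - p x) < e} \<subseteq> V"
        by (rule openin_sot_contains_ball[OF V(1) \<open>p \<in> V\<close>])
      have pM: "p \<in> M" "is_proj p" using p(1) by (simp_all add: proj)
      obtain J d where J: "finite J" "0 < d"
        "\<And>q. q \<in> M \<Longrightarrow> is_proj q \<Longrightarrow> \<forall>y\<in>J. norm (T q y - T p y) < d \<Longrightarrow>
          \<exists>w\<in>M. real_adj w o\<^sub>L w = q \<and> (\<forall>x\<in>I. norm ((w o\<^sub>L real_adj w) x - p x) < e)"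
        using nearby_trace_nearby_projection[OF pM I(1,2)] by blast
      let ?B = "?S \<inter> {s. \<forall>y\<in>J. norm (blinfun_apply s y - T p y) < d}"
      have "openin (subtopology strong_operator_topology ?S) ?B"
        by (rule openin_subtopology_Int2[OF openin_sot_ball[OF J(1)]])
      moreover have "t \<in> ?B" unfolding FS using p J(2) by simp
      moreover have "?B \<subseteq> F ` U"
      proof
        fix s assume s: "s \<in> ?B"
        then obtain q where q: "q \<in> projections M" "s = T q" unfolding FS by blast
        then obtain w where w: "w \<in> M" "real_adj w o\<^sub>L w = q"
          "\<forall>x\<in>I. norm ((w o\<^sub>L real_adj w) x - p x) < e"
          using J(3)[of q] s by (auto simp: proj)
        define q' where "q' = w o\<^sub>L real_adj w"
        have qq': "(q, q') \<in> mvn_rel M" using w q(1) unfolding rel proj q'_def by blast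
        then have q': "q' \<in> projections M" by (simp add: mvn_rel_def)
        have "q' \<in> V" using I(3) w(3) unfolding q'_def by blast
        then have "mvn_class M q' \<in> U" using V(2) q' by blast
        moreover have "F (mvn_class M q') = s" using F[OF q'] T_eq[OF q(1) q'] qq' q(2) by simp
        ultimately show "s \<in> F ` U" by blast
      qed
      ultimately show "\<exists>B. openin (subtopology strong_operator_topology ?S) B \<and> t \<in> B \<and> B \<subseteq> F ` U"
        by blast
    qed
  qed
  then have emb: "embedding_map (QOT M) ?Y F"
    unfolding embedding_map_def YS
    by (intro bijective_open_imp_homeomorphic_map continuous_map_into_subtopology Fc inj)
      (auto simp: strong_operator_topology_topspace)
  have "QOT M closure_of {mvn_class M p} = {mvn_class M p}" if p: "p \<in> projections M" for p
  proof -
    have top: "mvn_class M p \<in> topspace (QOT M)" unfolding tQ using p by (rule imageI)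
    \<comment> \<open>The fibre of \<open>F\<close> over the closed point \<open>T p\<close>;
      injectivity makes it a single class.\<close>
    have "{c \<in> topspace (QOT M). F c \<in> {T p}} = {mvn_class M p}"
      unfolding F[OF p, symmetric] using inj_onD[OF inj _ _ top] top by blast
    moreover have "closedin (QOT M) {c \<in> topspace (QOT M). F c \<in> {T p}}"
      by (rule closedin_continuous_map_preimage[OF Fc closedin_sot_singleton])
    ultimately show ?thesis by (simp only: closure_of_eq)
  qed
  with emb F show ?thesis by blast
qed

end
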